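(* Let $(\xi,\eta),(\xi',\eta')\in L^2_{\mathcal F}(T,T+u)\times L^2_{\mathcal F}(T,T+u;\mathbf R^d)$ with $\xi_T,\xi'_T\in L^2(\mathcal F_T)$. Let $g,g':\Omega\times[0,T]\times\overline L^2_{\mathcal F}(-l,T+u)\times\overline L^2_{\mathcal F}(-l,T+u;\mathbf R^d)\to\mathbf R$ be such that $g(t,\mathbf y,\mathbf z)$ and $g'(t,\mathbf y,\mathbf z)$ are progressively measurable in $t$ for each $(\mathbf y,\mathbf z)$, and depend only on $(t,\mathbf y,z_t)$; write them $g(t,\mathbf y,z_t)$, $g'(t,\mathbf y,z_t)$. Suppose that $g(\cdot,\mathbf 0,0),g'(\cdot,\mathbf 0,0)\in L^2_{\mathcal F}(0,T)$ and that $h=g$ and $h=g'$ both satisfy: there are a constant $K'>0$ and a probability measure $\lambda'$ on $[-l,u]$ such that for each $t\in[0,T]$ and all $(\mathbf y,z_t),(\tilde{\mathbf y},\tilde z_t)\in\overline L^2_{\mathcal F}(-l,T+u)\times L^2(\mathcal F_t;\mathbf R^d)$, $$|h(t,\mathbf y,z_t)-h(t,\tilde{\mathbf y},\tilde z_t)|\le K'\Big(E\Big[\int_{-l}^u|y_{t+r}-\tilde y_{t+r}|\lambda'(dr)\,\Big|\,\mathcal F_t\Big]+|z_t-\tilde z_t|\Big).$$ Suppose moreover that (i) $\xi_t\ge\xi'_t$ for each $t\in[T,T+u]$; (ii) for each $t\in[0,T]$ and $(\mathbf y,\mathbf z)\in\overline L^2_{\mathcal F}(-l,T+u)\times\overline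 L^2_{\mathcal F}(-l,T+u;\mathbf R^d)$, $g(t,\mathbf y,z_t)\ge g'(t,\mathbf y,z_t)$; and for each $t\in[0,T]$, $\mathbf z \in\overline L^2_{\mathcal F}(-l,T+u;\mathbf R^d)$ and $\mathbf y,\mathbf y'\in\overline L^2_{\mathcal F}(-l,T+u)$, $g'(t,\mathbf y,z_t)\ge g'(t,\mathbf y',z_t)$ whenever $y_r\ge y'_r$ for each $r\in[0,T]$. Let $(\mathbf Y,\mathbf Z)$ and $(\mathbf Y',\mathbf Z')$ be the solutions of the BSDEs with parameters $(g,\xi,\eta)$ and $(g',\xi',\eta')$, respectively. Then, for a sufficiently small $l$ or a sufficiently small $K'$ (that is: given $K'$, provided $l$ is below some positive threshold; or given $l$, provided $K'$ is below some positive threshold), $Y_t\ge Y'_t$ for each $t\in[-l,T+u]$.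
   Context: $(\Omega,\mathcal F,P)$ is a complete probability space with a $d$-dimensional standard Brownian motion $(B_t)_{t\ge0}$; $(\mathcal F_t)_{t\ge0}$ is its natural filtration augmented by the $P$-null sets. $T>0$, $l\ge0$, $u\ge0$ are given constants. $|\cdot|$ is the Euclidean norm. Spaces (when $d=1$, the target $\mathbf R^d$ is omitted from the notation): - $L^2(\mathcal F_t;\mathbf R^d)$: $\mathcal F_t$-measurable $\mathbf R^d$-valued random variables $\xi$ with $E|\xi|^2<\infty$. - $L^2_{\mathcal F}(a,b;\mathbf R^d)$ ($0\le a\le b$): $\mathbf R^d$-valued progressively measurable processes $\psi$ on $[a,b]$ with $E\int_a^b|\psi_r|^2dr<\infty$. - $\mathcal S^2_{\mathcal F}(a,b;\mathbf R^d)$: continuous processes in $L^2_{\mathcal F}(a,b;\mathbf R^d)$ with $E[\sup_{r\in[a,b]}|\psi_r|^2]<\infty$. - $\overline L^2_{\mathcal F}(-s,t;\mathbf R^d)$ ($s\ge0$): processes $\psi$ on $[-s,t]$ such that $(\psi_r)_{r\in[0,t]}\in L^2_{\mathcal F}(0,t;\mathbf R^d)$ and $(\psi_r)_{r\in[-s,0]}$ is a (deterministic) Lebesgue measurable function with $\int_{-s}^0|\psi_r|^2dr<\infty$. Boldface $\mathbf X$ denotes the whole process $\{X_r\}_{-l\le r\le T+u}$. The BSDE with parameters $(g,\xi,\eta)$ is $$Y_t=\xi_T+\int_t^Tg(s,\mathbf Y,Z_s)\,ds-\int_t^TZ_s\,dB_s,\ t\in[0,T);\quad (Y_t,Z_t)=(\xi_t,\eta_t),\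 t\in[T,T+u];\quad (Y_t,Z_t)=(Y_0,0),\ t\in[-l,0).$$ A solution is a pair $(\mathbf Y,\mathbf Z)$ satisfying it with $(Y_t,Z_t)_{t\in[0,T]}\in\mathcal S^2_{\mathcal F}(0,T)\times L^2_{\mathcal F}(0,T;\mathbf R^d)$. *)

theory Defs
  imports "HOL-Probability.Probability"
begin

text \<open>
  Processes are total functions \<open>time \<Rightarrow> \<Omega> \<Rightarrow> value\<close>; only their values at the times of the stated
  interval matter. Relations between random variables are understood almost surely.
\<close>

definition natural_filtration :: "'w measure \<Rightarrow> (real \<Rightarrow> 'w \<Rightarrow> real ^ 'd) \<Rightarrow> real \<Rightarrow> 'w measure" where
  "natural_filtration M B t =
     sigma (space M) {B s -` A \<inter> space M | s A. 0 \<le> s \<and> s \<le> t \<and> A \<in> sets borel}"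

definition aug_filtration :: "'w measure \<Rightarrow> (real \<Rightarrow> 'w \<Rightarrow> real ^ 'd) \<Rightarrow> real \<Rightarrow> 'w measure" where
  "aug_filtration M B t = sigma (space M) (sets (natural_filtration M B t) \<union> null_sets M)"

definition standard_brownian_motion :: "'w measure \<Rightarrow> (real \<Rightarrow> 'w \<Rightarrow> real ^ 'd) \<Rightarrow> bool" where
  "standard_brownian_motion M B \<longleftrightarrow>
     (\<forall>t\<ge>0. B t \<in> borel_measurable M) \<and>
     (AE \<omega> in M. B 0 \<omega> = 0) \<and>
     (AE \<omega> in M. continuous_on {0..} (\<lambda>t. B t \<omega>)) \<and>
     (\<forall>s t. 0 \<le> s \<and> s < t \<longrightarrow>
        distributed M lborel (\<lambda>\<omega>. B t \<omega> - B s \<omega>)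
          (\<lambda>x. \<Prod>i\<in>UNIV. ennreal (normal_density 0 (sqrt (t - s)) (x $ i))) \<and>
        prob_space.indep_set M (sets (natural_filtration M B s))
          {(\<lambda>\<omega>. B t \<omega> - B s \<omega>) -` A \<inter> space M | A. A \<in> sets borel})"

subsection \<open>Spaces of random variables and processes\<close>

definition L2_rv :: "'w measure \<Rightarrow> (real \<Rightarrow> 'w \<Rightarrow> real ^ 'd) \<Rightarrow> real \<Rightarrow>
    ('w \<Rightarrow> 'e::euclidean_space) set" where
  "L2_rv M B t = {\<zeta> \<in> borel_measurable (aug_filtration M B t).
     (\<integral>\<^sup>+ \<omega>. ennreal ((norm (\<zeta> \<omega>))\<^sup>2) \<partial>M) < \<infinity>}"

definition prog_measurable :: "'w measure \<Rightarrow> (real \<Rightarrow> 'w \<Rightarrow> real ^ 'd) \<Rightarrow> real \<Rightarrow> real \<Rightarrow>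
    (real \<Rightarrow> 'w \<Rightarrow> 'e::euclidean_space) \<Rightarrow> bool" where
  "prog_measurable M B a b \<psi> \<longleftrightarrow> (\<forall>t\<in>{a..b}.
     (\<lambda>(r, \<omega>). \<psi> r \<omega>) \<in> borel_measurable (restrict_space borel {a..t} \<Otimes>\<^sub>M aug_filtration M B t))"

definition L2_proc :: "'w measure \<Rightarrow> (real \<Rightarrow> 'w \<Rightarrow> real ^ 'd) \<Rightarrow> real \<Rightarrow> real \<Rightarrow>
    (real \<Rightarrow> 'w \<Rightarrow> 'e::euclidean_space) set" where
  "L2_proc M B a b = {\<psi>. prog_measurable M B a b \<psi> \<and>
     (\<integral>\<^sup>+ \<omega>. (\<integral>\<^sup>+ r\<in>{a..b}. ennreal ((norm (\<psi> r \<omega>))\<^sup>2) \<partial>lborel) \<partial>M) < \<infinity>}"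

definition S2_proc :: "'w measure \<Rightarrow> (real \<Rightarrow> 'w \<Rightarrow> real ^ 'd) \<Rightarrow> real \<Rightarrow> real \<Rightarrow>
    (real \<Rightarrow> 'w \<Rightarrow> 'e::euclidean_space) set" where
  "S2_proc M B a b = {\<psi> \<in> L2_proc M B a b.
     (AE \<omega> in M. continuous_on {a..b} (\<lambda>r. \<psi> r \<omega>)) \<and>
     (\<integral>\<^sup>+ \<omega>. (SUP r\<in>{a..b}. ennreal ((norm (\<psi> r \<omega>))\<^sup>2)) \<partial>M) < \<infinity>}"

text \<open>
  ``Deterministic on \<open>[-s, 0]\<close>'' has to be read up to a null set: a solution is constant in time on
  \<open>[-l, 0]\<close> with value \<open>Y\<^sub>0\<close>, and an \<open>F\<^sub>0\<close>-measurable random variable is only almost surely constant.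
\<close>

definition L2_bar :: "'w measure \<Rightarrow> (real \<Rightarrow> 'w \<Rightarrow> real ^ 'd) \<Rightarrow> real \<Rightarrow> real \<Rightarrow>
    (real \<Rightarrow> 'w \<Rightarrow> 'e::euclidean_space) set" where
  "L2_bar M B s t = {\<psi> \<in> L2_proc M B 0 t.
     \<exists>f. f \<in> borel_measurable (lebesgue_on {-s..0}) \<and>
         (\<integral>\<^sup>+ r\<in>{-s..0}. ennreal ((norm (f r))\<^sup>2) \<partial>lebesgue) < \<infinity> \<and>
         (AE \<omega> in M. \<forall>r\<in>{-s..0}. \<psi> r \<omega> = f r)}"

subsection \<open>The Ito integral\<close>

text \<open>
  A simple integrand is given by a number \<open>n\<close> of steps, grid points \<open>\<tau> 0 \<le> \<dots> \<le> \<tau> n\<close> in \<open>[a, b]\<close>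
  and bounded vectors \<open>H k\<close>, the value on \<open>(\<tau> k, \<tau> (k + 1)]\<close>, known at time \<open>\<tau> k\<close>.
\<close>

definition simple_integrand :: "'w measure \<Rightarrow> (real \<Rightarrow> 'w \<Rightarrow> real ^ 'd) \<Rightarrow> real \<Rightarrow> real \<Rightarrow>
    nat \<Rightarrow> (nat \<Rightarrow> real) \<Rightarrow> (nat \<Rightarrow> 'w \<Rightarrow> real ^ 'd) \<Rightarrow> bool" where
  "simple_integrand M B a b n \<tau> H \<longleftrightarrow>
     a \<le> \<tau> 0 \<and> \<tau> n \<le> b \<and>
     (\<forall>k<n. \<tau> k \<le> \<tau> (Suc k) \<and> H k \<in> borel_measurable (aug_filtration M B (\<tau> k)) \<and>
        (\<exists>C. \<forall>\<omega>\<in>space M. norm (H k \<omega>) \<le> C))"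

definition simple_value :: "nat \<Rightarrow> (nat \<Rightarrow> real) \<Rightarrow> (nat \<Rightarrow> 'w \<Rightarrow> real ^ 'd) \<Rightarrow>
    real \<Rightarrow> 'w \<Rightarrow> real ^ 'd" where
  "simple_value n \<tau> H r \<omega> = (\<Sum>k<n. indicator {\<tau> k<..\<tau> (Suc k)} r *\<^sub>R H k \<omega>)"

definition simple_integral :: "(real \<Rightarrow> 'w \<Rightarrow> real ^ 'd) \<Rightarrow>
    nat \<Rightarrow> (nat \<Rightarrow> real) \<Rightarrow> (nat \<Rightarrow> 'w \<Rightarrow> real ^ 'd) \<Rightarrow> 'w \<Rightarrow> real" where
  "simple_integral B n \<tau> H \<omega> = (\<Sum>k<n. H k \<omega> \<bullet> (B (\<tau> (Suc k)) \<omega> - B (\<tau> k) \<omega>))"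

text \<open>
  \<open>I\<close> is (a version of) the integral of \<open>Z\<close> against \<open>B\<close> over \<open>[a, b]\<close>: the \<open>L\<^sup>2\<close>-limit of the integrals
  of simple integrands that approximate \<open>Z\<close> in \<open>L\<^sup>2(dr \<otimes> dP)\<close>.
\<close>

definition has_ito_integral :: "'w measure \<Rightarrow> (real \<Rightarrow> 'w \<Rightarrow> real ^ 'd) \<Rightarrow> real \<Rightarrow> real \<Rightarrow>
    (real \<Rightarrow> 'w \<Rightarrow> real ^ 'd) \<Rightarrow> ('w \<Rightarrow> real) \<Rightarrow> bool" where
  "has_ito_integral M B a b Z I \<longleftrightarrow>
     Z \<in> L2_proc M B a b \<and> I \<in> borel_measurable M \<and>
     (\<exists>n \<tau> H.
        (\<forall>m. simple_integrand M B a b (n m) (\<tau> m) (H m)) \<and>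
        (\<lambda>m. \<integral>\<^sup>+ \<omega>. (\<integral>\<^sup>+ r\<in>{a..b}.
           ennreal ((norm (Z r \<omega> - simple_value (n m) (\<tau> m) (H m) r \<omega>))\<^sup>2) \<partial>lborel) \<partial>M)
          \<longlonglongrightarrow> 0 \<and>
        (\<lambda>m. \<integral>\<^sup>+ \<omega>. ennreal ((I \<omega> - simple_integral B (n m) (\<tau> m) (H m) \<omega>)\<^sup>2) \<partial>M)
          \<longlonglongrightarrow> 0)"

subsection \<open>Generators and solutions\<close>

text \<open>
  A generator \<open>g(\<omega>, t, \<^bold>y, \<^bold>z)\<close> depending on \<open>\<^bold>z\<close> through the random variable \<open>z\<^sub>t\<close> only is written
  \<open>g t y (z t) \<omega>\<close>.
\<close>

type_synonym ('w, 'd) generator =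
  "real \<Rightarrow> (real \<Rightarrow> 'w \<Rightarrow> real) \<Rightarrow> ('w \<Rightarrow> real ^ 'd) \<Rightarrow> 'w \<Rightarrow> real"

definition prog_generator :: "'w measure \<Rightarrow> (real \<Rightarrow> 'w \<Rightarrow> real ^ 'd) \<Rightarrow> real \<Rightarrow> real \<Rightarrow> real \<Rightarrow>
    ('w, 'd) generator \<Rightarrow> bool" where
  "prog_generator M B l T u g \<longleftrightarrow>
     (\<forall>y\<in>L2_bar M B l (T + u). \<forall>z\<in>L2_bar M B l (T + u).
        prog_measurable M B 0 T (\<lambda>t. g t y (z t)))"

text \<open>
  The conditional expectation is that of a \<open>[0, \<infinity>]\<close>-valued variable: for processes that are merely
  square integrable in time, the integral against \<open>\<mu>\<close> may be infinite. Moreover \<open>\<mu>\<close> is a Borel measure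
  (possibly with atoms), while the paths on \<open>[-l, 0]\<close> are merely Lebesgue measurable; the inequality
  is required whenever the integral against \<open>\<mu>\<close> exists, i.e. whenever its integrand is
  \<open>\<mu>\<close>-measurable (in the completed sense) for almost every \<open>\<omega>\<close>.
\<close>

definition lipschitz_generator :: "'w measure \<Rightarrow> (real \<Rightarrow> 'w \<Rightarrow> real ^ 'd) \<Rightarrow> real \<Rightarrow> real \<Rightarrow> real \<Rightarrow>
    real \<Rightarrow> real measure \<Rightarrow> ('w, 'd) generator \<Rightarrow> bool" where
  "lipschitz_generator M B l T u K' \<mu> h \<longleftrightarrow>
     (\<forall>t\<in>{0..T}. \<forall>y\<in>L2_bar M B l (T + u). \<forall>y'\<in>L2_bar M B l (T + u).
        \<forall>\<zeta>\<in>L2_rv M B t. \<forall>\<zeta>'\<in>L2_rv M B t.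
        (AE \<omega> in M. (\<lambda>r. \<bar>y (t + r) \<omega> - y' (t + r) \<omega>\<bar>) \<in> borel_measurable (completion \<mu>)) \<longrightarrow>
        (AE \<omega> in M.
           ennreal \<bar>h t y \<zeta> \<omega> - h t y' \<zeta>' \<omega>\<bar>
             \<le> ennreal K' *
                (nn_cond_exp M (aug_filtration M B t)
                   (\<lambda>\<omega>. \<integral>\<^sup>+ r. ennreal \<bar>y (t + r) \<omega> - y' (t + r) \<omega>\<bar> \<partial>completion \<mu>) \<omega>
                 + ennreal (norm (\<zeta> \<omega> - \<zeta>' \<omega>)))))"

definition prob_measure_on :: "real \<Rightarrow> real \<Rightarrow> real measure \<Rightarrow> bool" where
  "prob_measure_on a b \<mu> \<longleftrightarrow> prob_space \<mu> \<and> sets \<mu> = sets (restrict_space borel {a..b})"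

text \<open>
  Membership of \<open>Y\<close> and \<open>Z\<close> in \<open>L2_bar\<close> is what makes \<open>g(s, \<^bold>Y, Z\<^sub>s)\<close> meaningful. It is stated since
  the equations outside \<open>[0, T)\<close>, which only hold almost surely at each time, do not
  force joint measurability there.
\<close>

definition bsde_solution :: "'w measure \<Rightarrow> (real \<Rightarrow> 'w \<Rightarrow> real ^ 'd) \<Rightarrow> real \<Rightarrow> real \<Rightarrow> real \<Rightarrow>
    ('w, 'd) generator \<Rightarrow> (real \<Rightarrow> 'w \<Rightarrow> real) \<Rightarrow> (real \<Rightarrow> 'w \<Rightarrow> real ^ 'd) \<Rightarrow>
    (real \<Rightarrow> 'w \<Rightarrow> real) \<Rightarrow> (real \<Rightarrow> 'w \<Rightarrow> real ^ 'd) \<Rightarrow> bool" where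
  "bsde_solution M B l T u g \<xi> \<eta> Y Z \<longleftrightarrow>
     Y \<in> S2_proc M B 0 T \<and> Z \<in> L2_proc M B 0 T \<and>
     Y \<in> L2_bar M B l (T + u) \<and> Z \<in> L2_bar M B l (T + u) \<and>
     (\<forall>t\<in>{0..<T}. \<exists>I. has_ito_integral M B t T Z I \<and>
        (AE \<omega> in M. set_integrable lborel {t..T} (\<lambda>s. g s Y (Z s) \<omega>) \<and>
           Y t \<omega> = \<xi> T \<omega> + (LINT s:{t..T}|lborel. g s Y (Z s) \<omega>) - I \<omega>)) \<and>
     (\<forall>t\<in>{T..T + u}. AE \<omega> in M. Y t \<omega> = \<xi> t \<omega> \<and> Z t \<omega> = \<eta> t \<omega>) \<and>
     (\<forall>t\<in>{-l..<0}. AE \<omega> in M. Y t \<omega> = Y 0 \<omega> \<and> Z t \<omega> = 0)"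

end

theory Submission
  imports Defs "HOL-Real_Asymp.Real_Asymp"
begin

text \<open>
  Put \<open>D = Y' - Y\<close>, write \<open>x\<^sup>+\<close> for \<open>max 0 x\<close>, and let \<open>y\<close> be \<open>max Y Y'\<close> on \<open>[0, T]\<close> and \<open>Y\<close> elsewhere.
  Since \<open>g'\<close> is monotone, replacing \<open>Y'\<close> by \<open>y\<close> in \<open>g'\<close> only increases it, and \<open>g \<ge> g'\<close> at
  \<open>(Y, Z)\<close>; as \<open>y - Y\<close> is \<open>D\<^sup>+\<close> on \<open>[0, T]\<close> and \<open>0\<close> elsewhere, the Lipschitz condition of \<open>g'\<close> gives
  the one-sided bound
  \<open>g'(s, Y', Z'\<^sub>s) - g(s, Y, Z\<^sub>s) \<le> K (E[X\<^sub>s | F\<^sub>s] + |Z'\<^sub>s - Z\<^sub>s|)\<close>, where \<open>X\<^sub>s = \<integral> D\<^sup>+\<^sub>s\<^sub>+\<^sub>r \<mu>(dr)\<close>.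

  Let \<open>V t = E (D\<^sub>t\<^sup>+)\<^sup>2\<close>, so that \<open>V T = 0\<close>. The equation for \<open>D\<close> and the convexity of \<open>(x\<^sup>+)\<^sup>2\<close> yield
  \<open>V a \<le> \<integral> ((K + 2 K\<^sup>2) V s + K E X\<^sub>s\<^sup>2) ds\<close> over \<open>[a, T]\<close>: the quadratic variation of \<open>D\<close> on \<open>{D > 0}\<close>
  absorbs the term with \<open>|Z' - Z|\<close>. If \<open>N\<close> is the supremum of \<open>exp (\<beta> t) V t\<close> over \<open>[0, T]\<close>, then
  \<open>V s \<le> N exp (- \<beta> s)\<close>, and \<open>E X\<^sub>s\<^sup>2 \<le> exp (\<beta> l) N exp (- \<beta> s)\<close> because the shift \<open>r\<close> is at least \<open>- l\<close>.
  Integrating, \<open>N \<le> N (K + 2 K\<^sup>2 + K exp (\<beta> l)) / \<beta>\<close>. Hence \<open>N = 0\<close>, which is the claim, as soon as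
  \<open>K + 2 K\<^sup>2 + K exp (\<beta> l) < \<beta>\<close>. Given \<open>K\<close>, a suitable \<open>\<beta>\<close> exists for all small \<open>l\<close>; given \<open>l\<close>, the
  choice \<open>\<beta> = 1\<close> works for all small \<open>K\<close>.

  The integral inequality for \<open>V\<close> is obtained on a time grid. On a step \<open>(p, q]\<close> the integrand
  \<open>Z' - Z\<close> is approximated by a bounded \<open>F\<^sub>p\<close>-measurable vector \<open>h\<close>. Given \<open>F\<^sub>p\<close>, the increment
  \<open>m = h \<bullet> (B\<^sub>q - B\<^sub>p)\<close> is symmetric, so averaging over \<open>m\<close> and \<open>- m\<close> gives
  \<open>E ((x + m)\<^sup>+)\<^sup>2 \<ge> E (x\<^sup>+)\<^sup>2 + E (1\<^sub>{\<^sub>x\<^sub>>\<^sub>0\<^sub>} m\<^sup>2) / 2\<close> for every \<open>F\<^sub>p\<close>-measurable \<open>x\<close>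
  (\<open>symmetric_square_expectation\<close>); half of the quadratic variation is enough for the absorption.
  The difference between the stochastic integral over \<open>(p, q]\<close> and \<open>m\<close> is orthogonal to \<open>F\<^sub>p\<close>, and its
  second moment is controlled by the isometry (\<open>ito_orth\<close>, \<open>ito_second_moment\<close>). The lemma
  \<open>step_estimate\<close> collects this for one step, \<open>backward_inequality\<close> sums over the grid and lets the
  errors tend to \<open>0\<close>, and \<open>comparison\<close> applies the result to two solutions.
\<close>

section \<open>Brownian increments and the augmented filtration\<close>

text \<open>
  Lebesgue measure on a Euclidean space is the image of a product of one-dimensional measures, so
  integrals of products of functions of the single coordinates factorise. The version for vectors
  indexed by a finite type is what the density of a Brownian increment calls for.
\<close>

lemma
  fixes f :: "'a::euclidean_space \<Rightarrow> real \<Rightarrow> real"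
  assumes f: "\<And>b. b \<in> Basis \<Longrightarrow> integrable lborel (f b)"
  shows lborel_integrable_prod: "integrable lborel (\<lambda>x::'a. \<Prod>b\<in>Basis. f b (x \<bullet> b))"
    and lborel_integral_prod:
      "(\<integral>x. (\<Prod>b\<in>Basis. f b ((x::'a) \<bullet> b)) \<partial>lborel) = (\<Prod>b\<in>Basis. (\<integral>x. f b x \<partial>lborel))"
proof -
  interpret product_sigma_finite "\<lambda>b::'a. lborel :: real measure" ..
  have L: "(lborel :: 'a measure) =
      distr (\<Pi>\<^sub>M b\<in>Basis. lborel) borel (\<lambda>f. \<Sum>b\<in>Basis. f b *\<^sub>R b)"
    unfolding lborel_eq_real by (rule lborel_def)
  have [measurable]: "f b \<in> borel_measurable borel" if "b \<in> Basis" for b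
    using f[OF that] by (simp add: integrable_iff_bounded)
  have eq: "(\<Prod>b\<in>Basis. f b ((\<Sum>b\<in>Basis. x b *\<^sub>R b) \<bullet> b)) = (\<Prod>b\<in>Basis. f b (x b))" for x :: "'a \<Rightarrow> real"
    by simp
  show "integrable lborel (\<lambda>x::'a. \<Prod>b\<in>Basis. f b (x \<bullet> b))"
    by (subst L, subst integrable_distr_eq) (auto simp: eq intro!: product_integrable_prod f)
  show "(\<integral>x. (\<Prod>b\<in>Basis. f b ((x::'a) \<bullet> b)) \<partial>lborel) = (\<Prod>b\<in>Basis. (\<integral>x. f b x \<partial>lborel))"
    by (subst L, subst integral_distr) (auto simp: eq product_integral_prod f)
qed

lemma
  fixes f :: "'d::finite \<Rightarrow> real \<Rightarrow> real"
  assumes f: "\<And>i. integrable lborel (f i)"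
  shows lborel_integrable_prod_vec: "integrable lborel (\<lambda>x::real^'d. \<Prod>i\<in>UNIV. f i (x $ i))"
    and lborel_integral_prod_vec:
      "(\<integral>x. (\<Prod>i\<in>UNIV. f i ((x::real^'d) $ i)) \<partial>lborel) = (\<Prod>i\<in>UNIV. (\<integral>x. f i x \<partial>lborel))"
proof -
  \<comment> \<open>The index of a basis vector.\<close>
  define ix where "ix = (\<lambda>b::real^'d. SOME i. b = axis i 1)"
  have ix: "ix (axis i 1) = i" for i
    unfolding ix_def by (rule some_equality) (auto simp: axis_eq_axis)
  have Bs: "(Basis :: (real^'d) set) = (\<lambda>i. axis i 1) ` UNIV"
    by (auto simp: Basis_vec_def)
  have inj: "inj (\<lambda>i::'d. axis i (1::real))"
    by (auto intro!: injI simp: axis_eq_axis)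
  have P: "(\<Prod>b\<in>(Basis :: (real^'d) set). g b) = (\<Prod>i\<in>UNIV. g (axis i 1))" for g :: "real^'d \<Rightarrow> real"
    unfolding Bs by (subst prod.reindex[OF inj]) simp
  show "integrable lborel (\<lambda>x::real^'d. \<Prod>i\<in>UNIV. f i (x $ i))"
    using lborel_integrable_prod[where f="\<lambda>b::real^'d. f (ix b)"] f
    by (simp add: P ix cart_eq_inner_axis)
  show "(\<integral>x. (\<Prod>i\<in>UNIV. f i ((x::real^'d) $ i)) \<partial>lborel) = (\<Prod>i\<in>UNIV. (\<integral>x. f i x \<partial>lborel))"
    using lborel_integral_prod[where f="\<lambda>b::real^'d. f (ix b)"] f
    by (simp add: P ix cart_eq_inner_axis)
qed

locale brownian = prob_space M for M :: "'w measure" +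
  fixes B :: "real \<Rightarrow> 'w \<Rightarrow> real ^ 'd"
  assumes BM: "standard_brownian_motion M B"
begin

abbreviation F :: "real \<Rightarrow> 'w measure" where "F \<equiv> aug_filtration M B"
abbreviation incr :: "real \<Rightarrow> real \<Rightarrow> 'w \<Rightarrow> real ^ 'd" where "incr s t \<equiv> \<lambda>w. B t w - B s w"

abbreviation mean_sq :: "('w \<Rightarrow> 'b::real_normed_vector) \<Rightarrow> ennreal" where
  "mean_sq X \<equiv> \<integral>\<^sup>+w. ennreal ((norm (X w))\<^sup>2) \<partial>M"

abbreviation pos_sq :: "('w \<Rightarrow> real) \<Rightarrow> ennreal" where
  "pos_sq X \<equiv> \<integral>\<^sup>+w. ennreal ((max 0 (X w))\<^sup>2) \<partial>M"

abbreviation pos_dot :: "('w \<Rightarrow> real) \<Rightarrow> ('w \<Rightarrow> ennreal) \<Rightarrow> ennreal" where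
  "pos_dot x X \<equiv> \<integral>\<^sup>+w. ennreal (max 0 (x w)) * X w \<partial>M"

text \<open>
  The bound \<open>\<phi> \<le> K (E[X | F\<^sub>s] + |z|)\<close>, tested against \<open>x\<^sup>+\<close> for an \<open>F\<^sub>s\<close>-measurable \<open>x\<close>: in this form the
  conditional expectation can be replaced by \<open>X\<close> itself.
\<close>

abbreviation drift_le ::
  "real \<Rightarrow> ('w \<Rightarrow> ennreal) \<Rightarrow> ('w \<Rightarrow> ennreal) \<Rightarrow> ('w \<Rightarrow> real^'d) \<Rightarrow> ('w \<Rightarrow> real) \<Rightarrow> bool" where
  "drift_le K \<phi> X z x \<equiv> pos_dot x \<phi> \<le> ennreal K * (pos_dot x X + pos_dot x (\<lambda>w. ennreal (norm (z w))))"

abbreviation on :: "real set \<Rightarrow> (real \<Rightarrow> 'w \<Rightarrow> 'b::real_vector) \<Rightarrow> real \<Rightarrow> 'w \<Rightarrow> 'b" where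
  "on A Z \<equiv> \<lambda>r w. indicator A r *\<^sub>R Z r w"

lemma B_measurable [measurable]: "0 \<le> t \<Longrightarrow> B t \<in> borel_measurable M"
  using BM by (auto simp: standard_brownian_motion_def)

lemma natural_gen: "{B s -` A \<inter> space M | s A. 0 \<le> s \<and> s \<le> t \<and> A \<in> sets borel} \<subseteq> sets M"
  using B_measurable by (auto intro: measurable_sets)

lemma sets_natural: "sets (natural_filtration M B t) =
    sigma_sets (space M) {B s -` A \<inter> space M | s A. 0 \<le> s \<and> s \<le> t \<and> A \<in> sets borel}"
  unfolding natural_filtration_def by (rule sets_measure_of) auto

lemma natural_sub: "sets (natural_filtration M B t) \<subseteq> sets M"
  unfolding sets_natural using natural_gen by (rule sets.sigma_sets_subset)

lemma space_F [simp]: "space (F t) = space M"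
  by (simp add: aug_filtration_def space_measure_of_conv)

lemma sets_F: "sets (F t) = sigma_sets (space M) (sets (natural_filtration M B t) \<union> null_sets M)"
proof -
  have "sets (natural_filtration M B t) \<union> null_sets M \<subseteq> Pow (space M)"
    using natural_sub sets.space_closed[of M] by (auto dest!: null_setsD2)
  then show ?thesis unfolding aug_filtration_def by (rule sets_measure_of)
qed

lemma subalg_F: "subalgebra M (F t)"
proof -
  have "sets (natural_filtration M B t) \<union> null_sets M \<subseteq> sets M"
    using natural_sub by (auto intro: null_setsD2)
  then show ?thesis
    unfolding subalgebra_def sets_F by (simp add: sets.sigma_sets_subset)
qed

lemma F_imp_M: "f \<in> measurable (F t) N \<Longrightarrow> f \<in> measurable M N"
  using measurable_from_subalg[OF subalg_F] .

lemma F_mono_sets: "s \<le> t \<Longrightarrow> sets (F s) \<subseteq> sets (F t)"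
proof -
  assume "s \<le> t"
  then have "{B r -` A \<inter> space M |r A. 0 \<le> r \<and> r \<le> s \<and> A \<in> sets borel}
      \<subseteq> {B r -` A \<inter> space M |r A. 0 \<le> r \<and> r \<le> t \<and> A \<in> sets borel}"
    by fastforce
  then have "sets (natural_filtration M B s) \<subseteq> sets (natural_filtration M B t)"
    unfolding sets_natural by (rule sigma_sets_mono')
  then show ?thesis
    unfolding sets_F by (intro sigma_sets_mono' Un_mono) auto
qed

lemma F_mono: "f \<in> measurable (F s) N \<Longrightarrow> s \<le> t \<Longrightarrow> f \<in> measurable (F t) N"
  using F_mono_sets[of s t] by (auto simp: measurable_def)

lemma sigma_finite_F: "sigma_finite_subalgebra M (F t)"
proof -
  interpret finite_measure_subalgebra M "F t"
    unfolding finite_measure_subalgebra_def finite_measure_subalgebra_axioms_def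
    using subalg_F finite_measure_axioms by simp
  show ?thesis by (rule sigma_finite_subalgebra_axioms)
qed

lemma B_measurable_F: "0 \<le> s \<Longrightarrow> s \<le> t \<Longrightarrow> B s \<in> borel_measurable (F t)"
  by (rule measurableI)
     (auto simp: sets_F sets_natural intro!: sigma_sets.Basic)

text \<open>
  Augmentation by null sets changes events only by null sets. This carries the independence of the
  increments from the natural filtration over to the augmented one.
\<close>

lemma F_natural_approx:
  assumes "A \<in> sets (F t)"
  shows "A \<in> sets M \<and> (\<exists>A'\<in>sets (natural_filtration M B t). AE w in M. w \<in> A \<longleftrightarrow> w \<in> A')"
  using assms unfolding sets_F
proof (induction rule: sigma_sets.induct)
  case (Basic a)
  then show ?case
  proof
    assume "a \<in> null_sets M"
    then have "AE w in M. w \<in> a \<longleftrightarrow> w \<in> {}" using AE_not_in by auto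
    then show ?thesis using \<open>a \<in> null_sets M\<close> by (auto intro!: bexI[of _ "{}"])
  qed (use natural_sub in auto)
next
  case Empty
  show ?case by (auto intro!: bexI[of _ "{}"])
next
  case (Compl a)
  then obtain A' where A': "A' \<in> sets (natural_filtration M B t)" "AE w in M. w \<in> a \<longleftrightarrow> w \<in> A'"
    by auto
  have "space M - A' \<in> sets (natural_filtration M B t)"
    using A'(1) by (auto simp: sets_natural intro: sigma_sets.Compl)
  moreover have "AE w in M. w \<in> space M - a \<longleftrightarrow> w \<in> space M - A'" using A'(2) by auto
  moreover have "space M - a \<in> sets M" using Compl.IH by auto
  ultimately show ?case by blast
next
  case (Union a)
  then obtain A' where A': "\<And>i. A' i \<in> sets (natural_filtration M B t)"
      "\<And>i::nat. AE w in M. w \<in> a i \<longleftrightarrow> w \<in> A' i"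
    by metis
  have "AE w in M. \<forall>i. w \<in> a i \<longleftrightarrow> w \<in> A' i" using A'(2) by (simp add: AE_all_countable)
  then have "AE w in M. w \<in> \<Union>(range a) \<longleftrightarrow> w \<in> \<Union>(range A')" by auto
  then show ?case using A'(1) Union
    by (intro conjI sets.countable_UN bexI[of _ "\<Union>(range A')"]) auto
qed

lemma incr_F: "0 \<le> s \<Longrightarrow> s \<le> t \<Longrightarrow> t \<le> r \<Longrightarrow> incr s t \<in> borel_measurable (F r)"
  using B_measurable_F[of s r] B_measurable_F[of t r] by auto

lemma incr_indep:
  assumes "0 \<le> s" "s < t"
  shows "indep_set (sets (F s)) {incr s t -` A \<inter> space M | A. A \<in> sets borel}" (is "indep_set _ ?E")
proof -
  have [measurable]: "incr s t \<in> borel_measurable M"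
    using assms by (intro borel_measurable_diff B_measurable) auto
  have E: "?E \<subseteq> events" by (auto intro: measurable_sets)
  have i: "indep_set (sets (natural_filtration M B s)) ?E"
    using BM assms by (auto simp: standard_brownian_motion_def)
  show ?thesis
  proof (rule indep_setI[OF _ E])
    show "sets (F s) \<subseteq> events" using subalg_F by (auto simp: subalgebra_def)
    fix a b assume a: "a \<in> sets (F s)" and b: "b \<in> ?E"
    obtain a' where a': "a \<in> sets M" "a' \<in> sets (natural_filtration M B s)" "AE w in M. w \<in> a \<longleftrightarrow> w \<in> a'"
      using F_natural_approx[OF a] by auto
    have [measurable]: "a' \<in> sets M" "b \<in> sets M" "a \<in> sets M"
      using a' natural_sub b E by auto
    have "prob (a \<inter> b) = prob (a' \<inter> b)" using a'(3) by (intro finite_measure_eq_AE) auto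
    also have "\<dots> = prob a' * prob b" using indep_setD[OF i a'(2) b] .
    also have "prob a' = prob a" using a'(3) by (intro finite_measure_eq_AE) auto
    finally show "prob (a \<inter> b) = prob a * prob b" .
  qed
qed

lemma incr_indep_var:
  assumes st: "0 \<le> s" "s < t" and X: "X \<in> borel_measurable (F s)" and g: "g \<in> borel_measurable borel"
  shows "indep_var borel (X :: 'w \<Rightarrow> real) borel (\<lambda>w. g (incr s t w) :: real)"
proof -
  note g[measurable]
  have [measurable]: "incr s t \<in> borel_measurable M" "X \<in> borel_measurable M"
    using st F_imp_M[OF X] by (auto intro!: borel_measurable_diff B_measurable)
  let ?E = "{incr s t -` A \<inter> space M | A. A \<in> sets borel}"
  have "sigma_sets (space M) {X -` A \<inter> space M |A. A \<in> sets borel} \<subseteq> sets (F s)"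
    using measurable_sets[OF X] by (intro sets.sigma_sets_subset[of _ "F s", simplified]) auto
  moreover have "sigma_sets (space M) {(\<lambda>w. g (incr s t w)) -` A \<inter> space M |A. A \<in> sets borel} \<subseteq> ?E"
  proof -
    have "{(\<lambda>w. g (incr s t w)) -` A \<inter> space M |A. A \<in> sets borel} \<subseteq> ?E"
    proof safe
      fix A :: "real set" assume "A \<in> sets borel"
      then have "g -` A \<in> sets borel" using g by (auto simp: in_borel_measurable_borel)
      then show "\<exists>A'. (\<lambda>w. g (incr s t w)) -` A \<inter> space M = incr s t -` A' \<inter> space M \<and> A' \<in> sets borel"
        by (intro exI[of _ "g -` A"]) auto
    qed
    then have "sigma_sets (space M) {(\<lambda>w. g (incr s t w)) -` A \<inter> space M |A. A \<in> sets borel}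
        \<subseteq> sigma_sets (space M) ?E"
      by (rule sigma_sets_mono')
    also have "\<dots> = ?E"
      using sigma_sets_vimage_commute[of "incr s t" "space M" UNIV "sets borel"]
        sets.sigma_sets_eq[of "borel :: (real^'d) measure"] by auto
    finally show ?thesis .
  qed
  ultimately have "indep_set (sigma_sets (space M) {X -` A \<inter> space M |A. A \<in> sets borel})
      (sigma_sets (space M) {(\<lambda>w. g (incr s t w)) -` A \<inter> space M |A. A \<in> sets borel})"
    using incr_indep[OF st] unfolding indep_set_def
    by (elim indep_sets_mono_sets) (simp split: bool.split)
  then show ?thesis unfolding indep_var_eq by simp
qed

lemma incr_distributed:
  assumes "0 \<le> s" "s < t"
  shows "distributed M lborel (incr s t) (\<lambda>x. ennreal (\<Prod>i\<in>UNIV. normal_density 0 (sqrt (t - s)) (x $ i)))"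
  using BM assms by (auto simp: standard_brownian_motion_def prod_ennreal)

lemma incr_moments:
  assumes st: "0 \<le> s" "s < t"
  shows "integrable M (\<lambda>w. incr s t w $ i * incr s t w $ j)" (is ?A)
    and "(\<integral>w. incr s t w $ i * incr s t w $ j \<partial>M) = (if i = j then t - s else 0)" (is ?B)
proof -
  let ?n = "normal_density 0 (sqrt (t - s))"
  define f where "f k x = ?n x * ((if k = i then x else 1) * (if k = j then x else 1))" for k x
  have s0: "0 < sqrt (t - s)" using st by simp
  have n1: "integrable lborel (\<lambda>x. ?n x * x)" and n2: "integrable lborel (\<lambda>x. ?n x * (x * x))"
    using integrable_normal_moment[OF s0, of 0 1] integrable_normal_moment[OF s0, of 0 2]
    by (simp_all add: power2_eq_square)
  have m1: "(\<integral>x. ?n x * x \<partial>lborel) = 0"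
    using normal_moment_odd[OF s0, of 0 0] by (simp add: has_bochner_integral_iff)
  have m2: "(\<integral>x. ?n x * (x * x) \<partial>lborel) = t - s"
    using normal_moment_even[OF s0, of 0 1] st
    by (simp add: has_bochner_integral_iff power2_eq_square field_simps)
  have fi: "integrable lborel (f k)" for k
    unfolding f_def[abs_def] using n1 n2 s0 by (cases "k = i"; cases "k = j") auto
  have I: "integral\<^sup>L lborel (f k) =
      (if k = i \<and> k = j then t - s else if k = i \<or> k = j then 0 else 1)" for k
    unfolding f_def[abs_def] using m1 m2 s0 by (cases "k = i"; cases "k = j") (auto simp: mult.commute)
  have pd: "(\<Prod>k\<in>UNIV. f k (x $ k)) = (\<Prod>k\<in>UNIV. ?n (x $ k)) * (x $ i * x $ j)" for x :: "real^'d"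
  proof -
    have "(\<Prod>k\<in>UNIV. f k (x $ k)) = (\<Prod>k\<in>UNIV. ?n (x $ k)) *
        ((\<Prod>k\<in>UNIV. (if k = i then x $ k else 1)) * (\<Prod>k\<in>UNIV. (if k = j then x $ k else 1)))"
      unfolding f_def by (simp add: prod.distrib)
    also have "\<dots> = (\<Prod>k\<in>UNIV. ?n (x $ k)) * (x $ i * x $ j)"
      by (simp add: prod.delta')
    finally show ?thesis .
  qed
  have nn: "0 \<le> (\<Prod>i\<in>UNIV. ?n (x $ i))" for x :: "real^'d" by (intro prod_nonneg) simp
  show ?A
    using distributed_integrable[OF incr_distributed[OF st], of "\<lambda>x. x $ i * x $ j"] nn
      lborel_integrable_prod_vec[of f, OF fi] by (simp add: pd)
  have "(\<integral>w. incr s t w $ i * incr s t w $ j \<partial>M) = (\<integral>x. (\<Prod>k\<in>UNIV. f k (x $ k)) \<partial>lborel)"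
    using distributed_integral[OF incr_distributed[OF st], of "\<lambda>x. x $ i * x $ j"] nn
    by (simp add: pd)
  also have "\<dots> = (\<Prod>k\<in>UNIV. if k = i \<and> k = j then t - s else if k = i \<or> k = j then 0 else 1)"
    by (subst lborel_integral_prod_vec[of f, OF fi]) (simp add: I)
  also have "\<dots> = (if i = j then t - s else 0)"
  proof (cases "i = j")
    case True
    then have "(\<Prod>k\<in>UNIV. if k = i \<and> k = j then t - s else if k = i \<or> k = j then 0 else 1)
      = (\<Prod>k\<in>UNIV. if k = i then t - s else 1)" by (intro prod.cong) auto
    with True show ?thesis by (simp add: prod.delta')
  next
    case False
    then have "(\<Prod>k\<in>UNIV. if k = i \<and> k = j then t - s else if k = i \<or> k = j then 0 else 1) = 0"
      by (intro prod_zero bexI[of _ i]) auto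
    with False show ?thesis by simp
  qed
  finally show ?B .
qed

text \<open>
  Given \<open>F s\<close>, the increment and its negative have the same law: the joint law with \<open>F s\<close> is a
  product measure by independence, and the Gaussian density is even.
\<close>

lemma incr_symmetric:
  assumes st: "0 \<le> s" "s < t" and G: "G \<in> borel_measurable (F s \<Otimes>\<^sub>M borel)"
  shows "(\<integral>w. G (w, incr s t w) \<partial>M) = (\<integral>w. G (w, - incr s t w) \<partial>M :: real)"
proof -
  note G[measurable]
  have m[measurable]: "incr s t \<in> borel_measurable M"
    using st by (intro borel_measurable_diff B_measurable) auto
  have id[measurable]: "(\<lambda>w. w) \<in> measurable M (F s)"
    using F_imp_M[of "\<lambda>w. w" s "F s"] by simp
  let ?f = "\<lambda>x::real^'d. \<Prod>i\<in>UNIV. normal_density 0 (sqrt (t - s)) (x $ i)"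
  have L: "distr lborel borel uminus = (lborel :: (real^'d) measure)"
    using lborel_affine[of "-1" "0::real^'d"] by (simp add: density_1)
  have feven: "?f (- x) = ?f x" for x by (simp add: normal_density_def)
  have D: "distr M borel (incr s t) = distr M borel (\<lambda>w. - incr s t w)"
  proof (rule measure_eqI)
    fix A :: "(real^'d) set" assume "A \<in> sets (distr M borel (incr s t))"
    then have [measurable]: "A \<in> sets borel" by simp
    have E: "emeasure (distr M borel Z) A = (\<integral>\<^sup>+w. indicator A (Z w) \<partial>M)"
      if [measurable]: "Z \<in> borel_measurable M" for Z
      by (simp add: nn_integral_indicator[symmetric] nn_integral_distr del: nn_integral_indicator)
    have "emeasure (distr M borel (incr s t)) A = (\<integral>\<^sup>+x. ennreal (?f x) * indicator A x \<partial>lborel)"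
      using distributed_nn_integral[OF incr_distributed[OF st], of "indicator A"] E[OF m] by simp
    also have "\<dots> = (\<integral>\<^sup>+x. ennreal (?f x) * indicator A x \<partial>distr lborel borel uminus)"
      by (simp add: L)
    also have "\<dots> = (\<integral>\<^sup>+x. ennreal (?f (- x)) * indicator A (- x) \<partial>lborel)"
      by (subst nn_integral_distr) auto
    also have "\<dots> = (\<integral>\<^sup>+w. indicator A (- incr s t w) \<partial>M)"
      using distributed_nn_integral[OF incr_distributed[OF st], of "\<lambda>x. indicator A (- x)"]
      unfolding feven by (simp del: minus_diff_eq)
    finally show "emeasure (distr M borel (incr s t)) A = emeasure (distr M borel (\<lambda>w. - incr s t w)) A"
      using E[of "\<lambda>w. - incr s t w"] by (simp del: minus_diff_eq)
  qed simp
  let ?R = "restr_to_subalg M (F s)"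
  interpret R: prob_space ?R by (rule prob_space_restr_to_subalg[OF subalg_F prob_space_axioms])
  have P: "?R \<Otimes>\<^sub>M distr M borel Z = distr M (F s \<Otimes>\<^sub>M borel) (\<lambda>w. (w, Z w))"
    if [measurable]: "Z \<in> borel_measurable M"
      and Z: "\<And>A. A \<in> sets borel \<Longrightarrow> Z -` A \<inter> space M \<in> {incr s t -` A \<inter> space M | A. A \<in> sets borel}"
    for Z :: "'w \<Rightarrow> real^'d"
  proof (rule pair_measure_eqI)
    show "sigma_finite_measure (distr M borel Z)"
      by (intro finite_measure.axioms(1) prob_space.finite_measure prob_space_distr) simp
    show "sets (?R \<Otimes>\<^sub>M distr M borel Z) = sets (distr M (F s \<Otimes>\<^sub>M borel) (\<lambda>w. (w, Z w)))"
      by (simp add: sets_restr_to_subalg[OF subalg_F] cong: sets_pair_measure_cong)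
    fix A C assume A: "A \<in> sets ?R" and "C \<in> sets (distr M borel Z)"
    then have [measurable]: "C \<in> sets borel" and A': "A \<in> sets (F s)"
      by (simp_all add: sets_restr_to_subalg[OF subalg_F])
    then have [measurable]: "A \<in> sets (F s)" "A \<in> sets M" using subalg_F by (auto simp: subalgebra_def)
    have "emeasure M (A \<inter> (Z -` C \<inter> space M)) = emeasure M A * emeasure M (Z -` C \<inter> space M)"
      using indep_setD[OF incr_indep[OF st] A' Z[of C]]
      by (simp add: emeasure_eq_measure ennreal_mult)
    moreover have "A \<inter> (Z -` C \<inter> space M) = (\<lambda>w. (w, Z w)) -` (A \<times> C) \<inter> space M"
      using sets.sets_into_space[OF \<open>A \<in> sets M\<close>] by auto
    ultimately show "emeasure ?R A * emeasure (distr M borel Z) C =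
        emeasure (distr M (F s \<Otimes>\<^sub>M borel) (\<lambda>w. (w, Z w))) (A \<times> C)"
      by (simp add: emeasure_restr_to_subalg[OF subalg_F] emeasure_distr)
  qed (rule R.sigma_finite_measure_axioms)
  have N: "(\<lambda>w. - incr s t w) -` A \<inter> space M \<in> {incr s t -` A \<inter> space M | A. A \<in> sets borel}"
    if "A \<in> sets borel" for A
  proof -
    have "(uminus :: real^'d \<Rightarrow> _) \<in> borel_measurable borel" by simp
    from measurable_sets[OF this that] have "uminus -` A \<in> sets (borel :: (real^'d) measure)" by simp
    then show ?thesis by (intro CollectI exI[of _ "uminus -` A"]) (auto simp del: minus_diff_eq)
  qed
  have J: "distr M (F s \<Otimes>\<^sub>M borel) (\<lambda>w. (w, incr s t w)) = distr M (F s \<Otimes>\<^sub>M borel) (\<lambda>w. (w, - incr s t w))"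
  proof -
    have "?R \<Otimes>\<^sub>M distr M borel (incr s t) = distr M (F s \<Otimes>\<^sub>M borel) (\<lambda>w. (w, incr s t w))"
      by (rule P[OF m]) blast
    moreover have "?R \<Otimes>\<^sub>M distr M borel (\<lambda>w. - incr s t w) =
        distr M (F s \<Otimes>\<^sub>M borel) (\<lambda>w. (w, - incr s t w))"
      using m by (intro P[OF borel_measurable_uminus] N)
    ultimately show ?thesis unfolding D by metis
  qed
  have m1: "(\<lambda>w. (w, incr s t w)) \<in> measurable M (F s \<Otimes>\<^sub>M borel)"
    and m2: "(\<lambda>w. (w, - incr s t w)) \<in> measurable M (F s \<Otimes>\<^sub>M borel)" by measurable
  show "(\<integral>w. G (w, incr s t w) \<partial>M) = (\<integral>w. G (w, - incr s t w) \<partial>M :: real)"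
    unfolding integral_distr[OF m1 G, symmetric] integral_distr[OF m2 G, symmetric] J ..
qed

section \<open>Square integrable random variables\<close>

definition sq_int :: "('w \<Rightarrow> real) \<Rightarrow> bool" where
  "sq_int X \<longleftrightarrow> X \<in> borel_measurable M \<and> integrable M (\<lambda>w. (X w)\<^sup>2)"

lemma sq_int_meas: "sq_int X \<Longrightarrow> X \<in> borel_measurable M" by (simp add: sq_int_def)

lemma sq_int_mult:
  assumes "sq_int X" "sq_int Y" shows "integrable M (\<lambda>w. X w * Y w)"
proof (rule Bochner_Integration.integrable_bound)
  show "integrable M (\<lambda>w. (X w)\<^sup>2 + (Y w)\<^sup>2)" using assms by (auto simp: sq_int_def)
  show "(\<lambda>w. X w * Y w) \<in> borel_measurable M" using assms by (auto simp: sq_int_def)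
  have "\<bar>x * y\<bar> \<le> x\<^sup>2 + y\<^sup>2" for x y :: real
  proof -
    have "2 * (\<bar>x\<bar> * \<bar>y\<bar>) \<le> x\<^sup>2 + y\<^sup>2" using sum_squares_bound[of "\<bar>x\<bar>" "\<bar>y\<bar>"] by simp
    moreover have "0 \<le> \<bar>x\<bar> * \<bar>y\<bar>" by simp
    ultimately show ?thesis unfolding abs_mult by linarith
  qed
  then show "AE w in M. norm (X w * Y w) \<le> norm ((X w)\<^sup>2 + (Y w)\<^sup>2)" by auto
qed

lemma sq_int_bound:
  assumes "sq_int X" "Y \<in> borel_measurable M" "\<And>w. w \<in> space M \<Longrightarrow> \<bar>Y w\<bar> \<le> C * \<bar>X w\<bar>"
  shows "sq_int Y"
  unfolding sq_int_def
proof
  show "integrable M (\<lambda>w. (Y w)\<^sup>2)"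
  proof (rule Bochner_Integration.integrable_bound)
    show "integrable M (\<lambda>w. C\<^sup>2 * (X w)\<^sup>2)" using assms by (auto simp: sq_int_def)
    show "AE w in M. norm ((Y w)\<^sup>2) \<le> norm (C\<^sup>2 * (X w)\<^sup>2)"
    proof (rule AE_I2)
      fix w assume "w \<in> space M"
      then have "\<bar>Y w\<bar>\<^sup>2 \<le> (C * \<bar>X w\<bar>)\<^sup>2" by (intro power_mono assms) auto
      then show "norm ((Y w)\<^sup>2) \<le> norm (C\<^sup>2 * (X w)\<^sup>2)" by (simp add: power_mult_distrib)
    qed
  qed (use assms in auto)
qed (use assms in auto)

lemma sq_int_add:
  assumes "sq_int X" "sq_int Y" shows "sq_int (\<lambda>w. X w + Y w)"
  using assms sq_int_mult[OF assms] by (auto simp: sq_int_def power2_sum mult.assoc)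

lemma sq_int_minus: "sq_int X \<Longrightarrow> sq_int (\<lambda>w. - X w)"
  by (auto simp: sq_int_def)

lemma sq_int_diff: "sq_int X \<Longrightarrow> sq_int Y \<Longrightarrow> sq_int (\<lambda>w. X w - Y w)"
  using sq_int_add[of X "\<lambda>w. - Y w"] sq_int_minus[of Y] by simp

lemma sq_int_const: "sq_int (\<lambda>_. c)"
  by (auto simp: sq_int_def)

lemma sq_int_sum: "(\<And>i. i \<in> A \<Longrightarrow> sq_int (X i)) \<Longrightarrow> sq_int (\<lambda>w. \<Sum>i\<in>A. X i w)"
  by (induction A rule: infinite_finite_induct) (auto intro: sq_int_add sq_int_const)

lemma sq_int_pos: "sq_int X \<Longrightarrow> sq_int (\<lambda>w. max 0 (X w))"
  by (rule sq_int_bound[where X=X and C=1]) (auto simp: sq_int_def)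

lemma sq_int_nn: "sq_int X \<Longrightarrow> (\<integral>\<^sup>+w. ennreal ((X w)\<^sup>2) \<partial>M) = ennreal (\<integral>w. (X w)\<^sup>2 \<partial>M)"
  by (intro nn_integral_eq_integral) (auto simp: sq_int_def)

lemma sq_intI: "X \<in> borel_measurable M \<Longrightarrow> (\<integral>\<^sup>+w. ennreal ((X w)\<^sup>2) \<partial>M) < \<infinity> \<Longrightarrow> sq_int X"
  by (auto simp: sq_int_def integrable_iff_bounded)

lemma incr_sq_int:
  assumes "0 \<le> s" "s \<le> t" shows "sq_int (\<lambda>w. incr s t w $ i)"
proof (cases "s = t")
  case True then show ?thesis using sq_int_const[of 0] by simp
next
  case False
  then have st: "s < t" using assms by simp
  have "incr s t \<in> borel_measurable M"
    using assms by (intro borel_measurable_diff B_measurable) auto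
  then have "(\<lambda>w. incr s t w $ i) \<in> borel_measurable M"
    by (rule measurable_compose[where g="\<lambda>x. x $ i"]) simp
  then show ?thesis using incr_moments(1)[OF assms(1) st, of i i]
    by (auto simp: sq_int_def power2_eq_square)
qed

section \<open>Elementary stochastic integrals\<close>

text \<open>
  The admissible values of a simple integrand from time \<open>s\<close> on.
\<close>

definition bdd_at :: "real \<Rightarrow> ('w \<Rightarrow> real^'d) \<Rightarrow> bool" where
  "bdd_at s H \<longleftrightarrow> H \<in> borel_measurable (F s) \<and> (\<exists>C. \<forall>w\<in>space M. norm (H w) \<le> C)"

lemma bdd_at_mono: "bdd_at s H \<Longrightarrow> s \<le> t \<Longrightarrow> bdd_at t H"
  by (auto simp: bdd_at_def intro: F_mono)

lemma bdd_at_meas: "bdd_at s H \<Longrightarrow> H \<in> borel_measurable M"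
  by (auto simp: bdd_at_def intro: F_imp_M)

lemma bdd_at_comp:
  assumes "bdd_at s H"
  shows "(\<lambda>w. H w $ i) \<in> borel_measurable (F s)" "\<exists>C. \<forall>w\<in>space M. \<bar>H w $ i\<bar> \<le> C"
proof -
  show "(\<lambda>w. H w $ i) \<in> borel_measurable (F s)"
    by (rule measurable_compose[where g="\<lambda>x. x $ i" and N=borel]) (use assms in \<open>auto simp: bdd_at_def\<close>)
  show "\<exists>C. \<forall>w\<in>space M. \<bar>H w $ i\<bar> \<le> C"
    using assms component_le_norm_cart[of "H _" i] unfolding bdd_at_def by (meson order_trans)
qed

lemma bdd_at_add: "bdd_at s H \<Longrightarrow> bdd_at s K \<Longrightarrow> bdd_at s (\<lambda>w. H w + K w)"
  by (auto simp: bdd_at_def) (metis add_mono norm_triangle_le)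

lemma bdd_at_zero: "bdd_at s (\<lambda>_. 0)"
  by (auto simp: bdd_at_def)

lemma bdd_at_minus: "bdd_at s H \<Longrightarrow> bdd_at s (\<lambda>w. - H w)"
  by (auto simp: bdd_at_def)

lemma bdd_at_sum: "(\<And>i. i \<in> A \<Longrightarrow> bdd_at s (H i)) \<Longrightarrow> bdd_at s (\<lambda>w. \<Sum>i\<in>A. H i w)"
  by (induction A rule: infinite_finite_induct) (auto intro: bdd_at_add bdd_at_zero)

lemma bdd_inner_integrable:
  assumes "bdd_at s H" "bdd_at t K"
  shows "integrable M (\<lambda>w. H w \<bullet> K w)"
proof -
  obtain C D where C: "\<forall>w\<in>space M. norm (H w) \<le> C" and D: "\<forall>w\<in>space M. norm (K w) \<le> D"
    using assms by (auto simp: bdd_at_def)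
  have [measurable]: "H \<in> borel_measurable M" "K \<in> borel_measurable M"
    using assms by (auto intro: bdd_at_meas)
  show ?thesis
  proof (rule integrable_const_bound[where B="C * D"])
    show "AE w in M. norm (H w \<bullet> K w) \<le> C * D"
    proof (rule AE_I2)
      fix w assume w: "w \<in> space M"
      have "norm (H w \<bullet> K w) \<le> norm (H w) * norm (K w)" using Cauchy_Schwarz_ineq2 by simp
      also have "\<dots> \<le> C * D" using C D w by (intro mult_mono) (auto intro: order_trans[OF norm_ge_zero])
      finally show "norm (H w \<bullet> K w) \<le> C * D" .
    qed
  qed measurable
qed

lemma bdd_mult_sq_int:
  assumes "bdd_at s H" "sq_int X"
  shows "sq_int (\<lambda>w. H w $ i * X w)"
proof -
  obtain C where C: "\<forall>w\<in>space M. \<bar>H w $ i\<bar> \<le> C" using bdd_at_comp(2)[OF assms(1)] by blast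
  have [measurable]: "(\<lambda>w. H w $ i) \<in> borel_measurable M" "X \<in> borel_measurable M"
    using F_imp_M[OF bdd_at_comp(1)[OF assms(1)]] sq_int_meas[OF assms(2)] by auto
  show ?thesis
    by (rule sq_int_bound[OF assms(2), where C=C]) (use C in \<open>auto simp: abs_mult intro: mult_right_mono\<close>)
qed

lemma bdd_incr_sq_int:
  assumes "0 \<le> s" "s \<le> t" "bdd_at r H"
  shows "sq_int (\<lambda>w. H w \<bullet> incr s t w)"
  unfolding inner_vec_def
  using bdd_mult_sq_int[OF assms(3) incr_sq_int[OF assms(1,2)]] by (auto intro!: sq_int_sum)

lemma bdd_incr_adapted:
  assumes "0 \<le> s" "s \<le> t" "t \<le> q" "r \<le> q" "bdd_at r H"
  shows "(\<lambda>w. H w \<bullet> incr s t w) \<in> borel_measurable (F q)"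
proof (rule borel_measurable_inner)
  show "H \<in> borel_measurable (F q)" using assms(4,5) F_mono unfolding bdd_at_def by blast
  show "incr s t \<in> borel_measurable (F q)" by (rule incr_F[OF assms(1-3)])
qed

text \<open>
  Changing the sign of the increment changes the sign of the integrand but not the expectation.
\<close>

lemma bdd_incr_orth:
  assumes st: "0 \<le> s" "s \<le> t" and H: "bdd_at s H" and X: "X \<in> borel_measurable (F s)"
  shows "(\<integral>w. X w * (H w \<bullet> incr s t w) \<partial>M) = (0::real)"
proof (cases "s = t")
  case False
  then have "s < t" using st by simp
  have [measurable]: "X \<in> borel_measurable (F s)" "H \<in> borel_measurable (F s)"
    using H X by (auto simp: bdd_at_def)
  have "(\<lambda>p. X (fst p) * (H (fst p) \<bullet> snd p)) \<in> borel_measurable (F s \<Otimes>\<^sub>M borel)" by measurable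
  from incr_symmetric[OF st(1) \<open>s < t\<close> this]
  have "(\<integral>w. X w * (H w \<bullet> incr s t w) \<partial>M) = (\<integral>w. - (X w * (H w \<bullet> incr s t w)) \<partial>M)"
    by (simp only: fst_conv snd_conv inner_minus_right mult_minus_right)
  then show ?thesis by simp
qed simp

lemma bdd_incr_inner_same:
  assumes st: "0 \<le> s" "s \<le> t" and H: "bdd_at s H" "bdd_at s K"
  shows "(\<integral>w. (H w \<bullet> incr s t w) * (K w \<bullet> incr s t w) \<partial>M) = (t - s) * (\<integral>w. H w \<bullet> K w \<partial>M)"
proof (cases "s = t")
  case False
  then have st': "s < t" using st by simp
  let ?D = "incr s t"
  have HK: "integrable M (\<lambda>w. H w $ i * K w $ j)" "(\<lambda>w. H w $ i * K w $ j) \<in> borel_measurable (F s)" for i j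
  proof -
    have "sq_int (\<lambda>w. H w $ i)" "sq_int (\<lambda>w. K w $ j)"
      using bdd_mult_sq_int[OF H(1) sq_int_const[of 1]] bdd_mult_sq_int[OF H(2) sq_int_const[of 1]]
      by auto
    then show "integrable M (\<lambda>w. H w $ i * K w $ j)" by (rule sq_int_mult)
    show "(\<lambda>w. H w $ i * K w $ j) \<in> borel_measurable (F s)"
      using bdd_at_comp(1)[OF H(1)] bdd_at_comp(1)[OF H(2)] by (intro borel_measurable_times)
  qed
  have iv: "indep_var borel (\<lambda>w. H w $ i * K w $ j) borel (\<lambda>w. ?D w $ i * ?D w $ j)" for i j
    by (rule incr_indep_var[OF st(1) st' HK(2), where g="\<lambda>x. x $ i * x $ j"]) simp
  have I: "integrable M (\<lambda>w. (H w $ i * K w $ j) * (?D w $ i * ?D w $ j))" for i j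
    by (rule indep_var_integrable[OF iv HK(1) incr_moments(1)[OF st(1) st']])
  have E: "(\<integral>w. (H w $ i * K w $ j) * (?D w $ i * ?D w $ j) \<partial>M) =
      (\<integral>w. H w $ i * K w $ j \<partial>M) * (if i = j then t - s else 0)" for i j
    unfolding incr_moments(2)[OF st(1) st', symmetric]
    by (rule indep_var_lebesgue_integral[OF iv HK(1) incr_moments(1)[OF st(1) st']])
  have "(H w \<bullet> ?D w) * (K w \<bullet> ?D w) = (\<Sum>i\<in>UNIV. \<Sum>j\<in>UNIV. (H w $ i * K w $ j) * (?D w $ i * ?D w $ j))" for w
    by (simp add: inner_vec_def sum_product ac_simps)
  then have "(\<integral>w. (H w \<bullet> ?D w) * (K w \<bullet> ?D w) \<partial>M) =
      (\<Sum>i\<in>UNIV. \<Sum>j\<in>UNIV. (\<integral>w. (H w $ i * K w $ j) * (?D w $ i * ?D w $ j) \<partial>M))"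
    using I by (simp add: Bochner_Integration.integral_sum)
  also have "\<dots> = (\<Sum>i\<in>UNIV. (\<integral>w. H w $ i * K w $ i \<partial>M) * (t - s))"
    unfolding E by (simp add: if_distrib[of "\<lambda>x. _ * x"] cong: if_cong)
  also have "\<dots> = (t - s) * (\<integral>w. H w \<bullet> K w \<partial>M)"
    using HK(1) by (simp add: inner_vec_def Bochner_Integration.integral_sum sum_distrib_left mult.commute)
  finally show ?thesis .
qed simp

text \<open>
  Cut the two time intervals at the left end of the later one and at the earlier right end. Products
  over disjoint pieces have expectation \<open>0\<close> by \<open>bdd_incr_orth\<close>; only the common piece, of length
  \<open>max 0 (min t t' - s')\<close>, contributes.
\<close>

lemma bdd_incr_inner_ordered:
  assumes st: "0 \<le> s" "s \<le> t" "s \<le> s'" "s' \<le> t'" and H: "bdd_at s H" "bdd_at s' K"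
  shows "(\<integral>w. (H w \<bullet> incr s t w) * (K w \<bullet> incr s' t' w) \<partial>M) =
    max 0 (min t t' - s') * (\<integral>w. H w \<bullet> K w \<partial>M)"
proof (cases "t \<le> s'")
  case True
  have "(\<integral>w. (H w \<bullet> incr s t w) * (K w \<bullet> incr s' t' w) \<partial>M) = 0"
    by (intro bdd_incr_orth bdd_incr_adapted) (use True st H in auto)
  with True show ?thesis by simp
next
  case False
  have H': "bdd_at s' H" using bdd_at_mono[OF H(1)] st by simp
  define q where "q = min t t'"
  have q: "s' \<le> q" "q \<le> t" "q \<le> t'" "q = t \<or> q = t'" using False st by (auto simp: q_def)
  let ?J = "\<lambda>H s t w. H w \<bullet> incr s t w"
  have i: "integrable M (\<lambda>w. ?J H a b w * ?J K c d w)" if "0 \<le> a" "a \<le> b" "0 \<le> c" "c \<le> d" for a b c d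
    by (intro sq_int_mult bdd_incr_sq_int) (use that H' H in auto)
  have z1: "(\<integral>w. ?J H s s' w * ?J K s' t' w \<partial>M) = 0"
    by (intro bdd_incr_orth bdd_incr_adapted) (use st H in auto)
  have z2: "(\<integral>w. ?J H s' q w * ?J K q t' w \<partial>M) = 0"
    by (intro bdd_incr_orth bdd_incr_adapted) (use q st H H' bdd_at_mono[OF H(2), of q] in auto)
  have z3: "(\<integral>w. ?J H q t w * ?J K s' q w \<partial>M) = 0"
    using bdd_incr_orth[of q t H "?J K s' q"] bdd_incr_adapted[of s' q q s' K] q st H H' bdd_at_mono[OF H', of q]
    by (auto simp: mult.commute)
  have z4: "(\<integral>w. ?J H q t w * ?J K q t' w \<partial>M) = 0" using q(4) by auto
  have "?J H s t w * ?J K s' t' w = ?J H s s' w * ?J K s' t' w + ?J H s' q w * ?J K s' q w +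
     ?J H s' q w * ?J K q t' w + ?J H q t w * ?J K s' q w + ?J H q t w * ?J K q t' w" for w
    by (simp add: inner_diff_right algebra_simps)
  then have "(\<integral>w. ?J H s t w * ?J K s' t' w \<partial>M) = (\<integral>w. ?J H s' q w * ?J K s' q w \<partial>M)"
    using st q z1 z2 z3 z4 by (simp add: i)
  also have "\<dots> = (q - s') * (\<integral>w. H w \<bullet> K w \<partial>M)"
    by (rule bdd_incr_inner_same) (use st q H H' in auto)
  finally show ?thesis using q(1) by (simp add: q_def)
qed

lemma indicator_overlap:
  assumes "s \<le> (s'::real)"
  shows "integrable lborel (\<lambda>r. indicator {s<..t} r * indicator {s'<..t'} r :: real)"
    and "(\<integral>r. indicator {s<..t} r * indicator {s'<..t'} r \<partial>lborel) = max 0 (min t t' - s')"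
proof -
  have e: "indicator {s<..t} r * indicator {s'<..t'} r = (indicator {s'<..min t t'} r :: real)" for r
    using assms by (auto simp: indicator_def)
  show "integrable lborel (\<lambda>r. indicator {s<..t} r * indicator {s'<..t'} r :: real)"
    unfolding e by (cases "s' \<le> min t t'") auto
  show "(\<integral>r. indicator {s<..t} r * indicator {s'<..t'} r \<partial>lborel) = max 0 (min t t' - s')"
    unfolding e by (cases "s' \<le> min t t'") auto
qed

lemma bdd_incr_isometry:
  assumes st: "0 \<le> s" "s \<le> t" "0 \<le> s'" "s' \<le> t'" and H: "bdd_at s H" "bdd_at s' K"
  shows "integrable lborel (\<lambda>r. indicator {s<..t} r * indicator {s'<..t'} r :: real)"
    and "(\<integral>w. (H w \<bullet> incr s t w) * (K w \<bullet> incr s' t' w) \<partial>M) =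
      (\<integral>r. indicator {s<..t} r * indicator {s'<..t'} r \<partial>lborel) * (\<integral>w. H w \<bullet> K w \<partial>M)"
proof -
  have "integrable lborel (\<lambda>r. indicator {s<..t} r * indicator {s'<..t'} r :: real) \<and>
    (\<integral>w. (H w \<bullet> incr s t w) * (K w \<bullet> incr s' t' w) \<partial>M) =
      (\<integral>r. indicator {s<..t} r * indicator {s'<..t'} r \<partial>lborel) * (\<integral>w. H w \<bullet> K w \<partial>M)"
  proof (cases "s \<le> s'")
    case True
    then show ?thesis using indicator_overlap[OF True, of t t'] bdd_incr_inner_ordered[OF st(1,2) True st(4) H] by simp
  next
    case False
    then have "s' \<le> s" by simp
    from indicator_overlap[OF this, of t' t] bdd_incr_inner_ordered[OF st(3,4) this st(2) H(2,1)]
    show ?thesis by (simp add: mult.commute inner_commute)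
  qed
  then show "integrable lborel (\<lambda>r. indicator {s<..t} r * indicator {s'<..t'} r :: real)"
    and "(\<integral>w. (H w \<bullet> incr s t w) * (K w \<bullet> incr s' t' w) \<partial>M) =
      (\<integral>r. indicator {s<..t} r * indicator {s'<..t'} r \<partial>lborel) * (\<integral>w. H w \<bullet> K w \<partial>M)"
    by auto
qed

text \<open>
  Pairs of a simple integrand and its stochastic integral. The intervals of the summands may overlap
  in any way, so that sums and differences need no common refinement of two grids.
\<close>

inductive elem :: "real \<Rightarrow> (real \<Rightarrow> 'w \<Rightarrow> real^'d) \<Rightarrow> ('w \<Rightarrow> real) \<Rightarrow> bool" for a where
  zero: "elem a (\<lambda>_ _. 0) (\<lambda>_. 0)"
| step: "elem a \<sigma> S \<Longrightarrow> a \<le> s \<Longrightarrow> s \<le> t \<Longrightarrow> bdd_at s H \<Longrightarrow>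
    elem a (\<lambda>r w. indicator {s<..t} r *\<^sub>R H w + \<sigma> r w) (\<lambda>w. H w \<bullet> incr s t w + S w)"

lemma elem_mono: "elem a \<sigma> S \<Longrightarrow> b \<le> a \<Longrightarrow> elem b \<sigma> S"
  by (induction rule: elem.induct) (auto intro!: elem.intros)

lemma elem_add: "elem a \<sigma> S \<Longrightarrow> elem a \<rho> R \<Longrightarrow> elem a (\<lambda>r w. \<sigma> r w + \<rho> r w) (\<lambda>w. S w + R w)"
proof (induction rule: elem.induct)
  case (step \<sigma> S s t H)
  from elem.step[OF step.IH[OF step.prems] step.hyps(2-4)] show ?case by (simp add: add.assoc)
qed simp

lemma elem_minus: "elem a \<sigma> S \<Longrightarrow> elem a (\<lambda>r w. - \<sigma> r w) (\<lambda>w. - S w)"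
proof (induction rule: elem.induct)
  case zero then show ?case using elem.zero by simp
next
  case (step \<sigma> S s t H)
  from elem.step[OF step.IH step.hyps(2,3) bdd_at_minus[OF step.hyps(4)]] show ?case
    by (simp add: algebra_simps)
qed

lemma elem_diff: "elem a \<sigma> S \<Longrightarrow> elem a \<rho> R \<Longrightarrow> elem a (\<lambda>r w. \<sigma> r w - \<rho> r w) (\<lambda>w. S w - R w)"
  using elem_add[OF _ elem_minus, of a \<sigma> S \<rho> R] by simp

lemma elem_sq_int: "elem a \<sigma> S \<Longrightarrow> 0 \<le> a \<Longrightarrow> sq_int S"
  by (induction rule: elem.induct) (auto intro!: sq_int_const sq_int_add bdd_incr_sq_int)

lemma elem_meas: "elem a \<sigma> S \<Longrightarrow> (\<lambda>p. \<sigma> (fst p) (snd p)) \<in> borel_measurable (borel \<Otimes>\<^sub>M M)"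
proof (induction rule: elem.induct)
  case (step \<sigma> S s t H)
  note [measurable] = bdd_at_meas[OF step.hyps(4)] step.IH
  show ?case by measurable
qed simp

lemma elem_slice: "elem a \<sigma> S \<Longrightarrow> \<exists>t. bdd_at t (\<sigma> r)"
proof (induction rule: elem.induct)
  case (step \<sigma> S s t H)
  then obtain q where q: "bdd_at q (\<sigma> r)" by blast
  have "bdd_at s (\<lambda>w. indicator {s<..t} r *\<^sub>R H w)"
    using step.hyps(4) bdd_at_zero by (cases "r \<in> {s<..t}") auto
  then have "bdd_at (max s q) (\<lambda>w. indicator {s<..t} r *\<^sub>R H w + \<sigma> r w)"
    using q by (intro bdd_at_add) (auto elim: bdd_at_mono)
  then show ?case by blast
qed (auto intro: bdd_at_zero)

lemma elem_inner_integrable: "elem a \<sigma> S \<Longrightarrow> elem b \<rho> R \<Longrightarrow> integrable M (\<lambda>w. \<sigma> r w \<bullet> \<rho> r w)"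
  using elem_slice[of a \<sigma> S r] elem_slice[of b \<rho> R r] by (auto intro: bdd_inner_integrable)

lemma elem_isometry_incr:
  assumes "elem a \<sigma> S" and a: "0 \<le> a" and H: "0 \<le> s" "s \<le> t" "bdd_at s H"
  shows "integrable lborel (\<lambda>r. indicator {s<..t} r * (\<integral>w. H w \<bullet> \<sigma> r w \<partial>M)) \<and>
    (\<integral>w. (H w \<bullet> incr s t w) * S w \<partial>M) = (\<integral>r. indicator {s<..t} r * (\<integral>w. H w \<bullet> \<sigma> r w \<partial>M) \<partial>lborel)"
  using assms(1)
proof (induction rule: elem.induct)
  case (step \<sigma> S s' t' K)
  have s': "0 \<le> s'" using a step by simp
  note iso = bdd_incr_isometry[OF H(1,2) s' step.hyps(3) H(3) step.hyps(4)]
  have "(\<integral>w. H w \<bullet> (indicator {s'<..t'} r *\<^sub>R K w + \<sigma> r w) \<partial>M) =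
      indicator {s'<..t'} r * (\<integral>w. H w \<bullet> K w \<partial>M) + (\<integral>w. H w \<bullet> \<sigma> r w \<partial>M)" for r
    using bdd_inner_integrable[OF H(3) step.hyps(4)] bdd_inner_integrable[OF H(3), of _ "\<sigma> r"]
      elem_slice[OF step.hyps(1), of r]
    by (auto simp: inner_add_right)
  then have eq: "indicator {s<..t} r * (\<integral>w. H w \<bullet> (indicator {s'<..t'} r *\<^sub>R K w + \<sigma> r w) \<partial>M) =
      (indicator {s<..t} r * indicator {s'<..t'} r) * (\<integral>w. H w \<bullet> K w \<partial>M) +
      indicator {s<..t} r * (\<integral>w. H w \<bullet> \<sigma> r w \<partial>M)" for r
    by (simp add: algebra_simps)
  have i: "integrable M (\<lambda>w. (H w \<bullet> incr s t w) * (K w \<bullet> incr s' t' w))"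
    "integrable M (\<lambda>w. (H w \<bullet> incr s t w) * S w)"
    using sq_int_mult[OF bdd_incr_sq_int[OF H] bdd_incr_sq_int[OF s' step.hyps(3,4)]]
      sq_int_mult[OF bdd_incr_sq_int[OF H] elem_sq_int[OF step.hyps(1) a]] by auto
  have "(\<integral>w. (H w \<bullet> incr s t w) * (K w \<bullet> incr s' t' w + S w) \<partial>M) =
      (\<integral>r. indicator {s<..t} r * indicator {s'<..t'} r \<partial>lborel) * (\<integral>w. H w \<bullet> K w \<partial>M) +
      (\<integral>r. indicator {s<..t} r * (\<integral>w. H w \<bullet> \<sigma> r w \<partial>M) \<partial>lborel)"
    using i step.IH by (simp add: distrib_left iso(2))
  with step.IH iso(1) show ?case unfolding eq by simp
qed simp

lemma elem_inner_isometry: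
  assumes "elem a \<sigma> S" and a: "0 \<le> a" and e: "elem b \<rho> R" and b: "0 \<le> b"
  shows "integrable lborel (\<lambda>r. (\<integral>w. \<sigma> r w \<bullet> \<rho> r w \<partial>M)) \<and>
    (\<integral>w. S w * R w \<partial>M) = (\<integral>r. (\<integral>w. \<sigma> r w \<bullet> \<rho> r w \<partial>M) \<partial>lborel)"
  using assms(1)
proof (induction rule: elem.induct)
  case (step \<sigma> S s t H)
  have s: "0 \<le> s" using a step by simp
  note iso = elem_isometry_incr[OF e b s step.hyps(3,4)]
  have eq: "(\<integral>w. (indicator {s<..t} r *\<^sub>R H w + \<sigma> r w) \<bullet> \<rho> r w \<partial>M) =
      indicator {s<..t} r * (\<integral>w. H w \<bullet> \<rho> r w \<partial>M) + (\<integral>w. \<sigma> r w \<bullet> \<rho> r w \<partial>M)" for r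
    using bdd_inner_integrable[OF step.hyps(4), of _ "\<rho> r"] elem_slice[OF e, of r]
      elem_inner_integrable[OF step.hyps(1) e]
    by (auto simp: inner_add_left)
  have "integrable M (\<lambda>w. (H w \<bullet> incr s t w) * R w)" "integrable M (\<lambda>w. S w * R w)"
    using sq_int_mult[OF bdd_incr_sq_int[OF s step.hyps(3,4)] elem_sq_int[OF e b]]
      sq_int_mult[OF elem_sq_int[OF step.hyps(1) a] elem_sq_int[OF e b]] by auto
  with step.IH iso show ?case unfolding eq by (simp add: distrib_right)
qed simp

text \<open>
  The squared norm in \<open>L\<^sup>2(dr \<otimes> dP)\<close>.
\<close>

definition energy :: "(real \<Rightarrow> 'w \<Rightarrow> real^'d) \<Rightarrow> ennreal" where
  "energy W = (\<integral>\<^sup>+r. mean_sq (W r) \<partial>lborel)"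

text \<open>
  By bilinearity the isometry reduces to two single summands, that is to \<open>bdd_incr_isometry\<close>.
\<close>

lemma elem_isometry:
  assumes e: "elem a \<sigma> S" and a: "0 \<le> a"
  shows "(\<integral>\<^sup>+w. ennreal ((S w)\<^sup>2) \<partial>M) = energy \<sigma>"
proof -
  have "(\<integral>\<^sup>+w. ennreal ((S w)\<^sup>2) \<partial>M) = ennreal (\<integral>r. (\<integral>w. \<sigma> r w \<bullet> \<sigma> r w \<partial>M) \<partial>lborel)"
    using elem_inner_isometry[OF e a e a] sq_int_nn[OF elem_sq_int[OF e a]] by (simp add: power2_eq_square)
  also have "\<dots> = (\<integral>\<^sup>+r. ennreal (\<integral>w. \<sigma> r w \<bullet> \<sigma> r w \<partial>M) \<partial>lborel)"
    using elem_inner_isometry[OF e a e a] by (intro nn_integral_eq_integral[symmetric]) auto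
  also have "\<dots> = energy \<sigma>"
    unfolding energy_def power2_norm_eq_inner
    by (intro nn_integral_cong nn_integral_eq_integral[symmetric] elem_inner_integrable[OF e e]) auto
  finally show ?thesis .
qed

lemma elem_orth:
  assumes "elem a \<sigma> S" "0 \<le> a" "sq_int X" "X \<in> borel_measurable (F a)"
  shows "(\<integral>w. X w * S w \<partial>M) = 0"
  using assms
proof (induction rule: elem.induct)
  case (step \<sigma> S s t H)
  have s: "0 \<le> s" using step by simp
  have "integrable M (\<lambda>w. X w * (H w \<bullet> incr s t w))" "integrable M (\<lambda>w. X w * S w)"
    using sq_int_mult[OF step.prems(2) bdd_incr_sq_int[OF s step.hyps(3,4)]]
      sq_int_mult[OF step.prems(2) elem_sq_int[OF step.hyps(1) step.prems(1)]] by auto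
  moreover have "(\<integral>w. X w * (H w \<bullet> incr s t w) \<partial>M) = 0"
    by (intro bdd_incr_orth s step.hyps F_mono[OF step.prems(3)])
  ultimately show ?case using step.IH[OF step.prems] by (simp add: distrib_left)
qed simp

end

text \<open>
  Clamping the time to \<open>{a..b}\<close> turns measurability on the interval into measurability on the whole
  line without changing the values on \<open>A\<close>.
\<close>

lemma measurable_on_interval:
  fixes f :: "real \<Rightarrow> 'a \<Rightarrow> 'b::euclidean_space"
  assumes f: "(\<lambda>(r, w). f r w) \<in> borel_measurable (restrict_space borel {a..b} \<Otimes>\<^sub>M G)"
    and ab: "a \<le> b" and A: "A \<in> sets borel" "A \<subseteq> {a..b}"
  shows "(\<lambda>p. indicator A (fst p) *\<^sub>R f (fst p) (snd p)) \<in> borel_measurable (borel \<Otimes>\<^sub>M G)"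
proof -
  have "(\<lambda>p. (max a (min b (fst p)), snd p)) \<in> measurable (borel \<Otimes>\<^sub>M G) (restrict_space borel {a..b} \<Otimes>\<^sub>M G)"
    using ab by (intro measurable_Pair measurable_restrict_space2) (auto simp: space_pair_measure)
  from measurable_compose[OF this f]
  have [measurable]: "(\<lambda>p. f (max a (min b (fst p))) (snd p)) \<in> borel_measurable (borel \<Otimes>\<^sub>M G)" by simp
  note A(1)[measurable]
  have "(\<lambda>p. indicator A (fst p) *\<^sub>R f (max a (min b (fst p))) (snd p)) \<in> borel_measurable (borel \<Otimes>\<^sub>M G)"
    by measurable
  moreover have "indicator A r *\<^sub>R f (max a (min b r)) w = indicator A r *\<^sub>R f r w" for r w
    using A(2) by (cases "r \<in> A") (auto simp: max_def min_def dest!: subsetD)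
  ultimately show ?thesis by simp
qed

lemma tendsto_0_le_ennreal:
  fixes f g :: "nat \<Rightarrow> ennreal"
  assumes "g \<longlonglongrightarrow> 0" "\<And>n. f n \<le> g n" shows "f \<longlonglongrightarrow> 0"
  by (rule tendsto_sandwich[OF _ _ tendsto_const assms(1)]) (simp_all add: assms(2))

lemma tendsto_0_double_ennreal:
  fixes f g :: "nat \<Rightarrow> ennreal"
  assumes "f \<longlonglongrightarrow> 0" "g \<longlonglongrightarrow> 0"
  shows "(\<lambda>n. 2 * f n + 2 * g n) \<longlonglongrightarrow> 0"
  using tendsto_add[OF ennreal_tendsto_cmult[OF _ assms(1), of 2] ennreal_tendsto_cmult[OF _ assms(2), of 2]]
  by simp

lemma norm_add_square_le:
  fixes x y :: "'b::real_normed_vector"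
  shows "(norm (x + y))\<^sup>2 \<le> 2 * (norm x)\<^sup>2 + 2 * (norm y)\<^sup>2"
proof -
  have "(norm (x + y))\<^sup>2 \<le> (norm x + norm y)\<^sup>2" by (intro power_mono norm_triangle_ineq) simp
  also have "\<dots> \<le> 2 * (norm x)\<^sup>2 + 2 * (norm y)\<^sup>2"
    using sum_squares_bound[of "norm x" "norm y"] by (simp add: power2_sum)
  finally show ?thesis .
qed

context brownian
begin

section \<open>The Ito integral as a limit of elementary integrals\<close>

lemma nn_norm_add_square_le:
  fixes X Y :: "'w \<Rightarrow> 'b::euclidean_space"
  assumes [measurable]: "X \<in> borel_measurable M" "Y \<in> borel_measurable M"
  shows "mean_sq (\<lambda>w. X w + Y w) \<le>
    2 * mean_sq X + 2 * mean_sq Y"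
proof -
  have "ennreal ((norm (X w + Y w))\<^sup>2) \<le> 2 * ennreal ((norm (X w))\<^sup>2) + 2 * ennreal ((norm (Y w))\<^sup>2)" for w
    using norm_add_square_le[of "X w" "Y w"]
    by (simp add: ennreal_mult''[symmetric] ennreal_plus[symmetric] flip: ennreal_numeral del: ennreal_plus)
  then have "mean_sq (\<lambda>w. X w + Y w) \<le>
    (\<integral>\<^sup>+w. 2 * ennreal ((norm (X w))\<^sup>2) + 2 * ennreal ((norm (Y w))\<^sup>2) \<partial>M)"
    by (intro nn_integral_mono)
  also have "\<dots> = 2 * mean_sq X + 2 * mean_sq Y"
    by (simp add: nn_integral_add nn_integral_cmult)
  finally show ?thesis .
qed

definition jointly_meas :: "(real \<Rightarrow> 'w \<Rightarrow> 'b::euclidean_space) \<Rightarrow> bool" where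
  "jointly_meas W \<longleftrightarrow> (\<lambda>p. W (fst p) (snd p)) \<in> borel_measurable (borel \<Otimes>\<^sub>M M)"

lemma jointly_meas_slice: "jointly_meas W \<Longrightarrow> W r \<in> borel_measurable M"
  unfolding jointly_meas_def using measurable_compose[of "\<lambda>w. (r, w)" M "borel \<Otimes>\<^sub>M M" "\<lambda>p. W (fst p) (snd p)" borel]
  by simp

lemma jointly_meas_section: "jointly_meas W \<Longrightarrow> w \<in> space M \<Longrightarrow> (\<lambda>r. W r w) \<in> borel_measurable borel"
  unfolding jointly_meas_def
  using measurable_compose[of "\<lambda>r. (r, w)" borel "borel \<Otimes>\<^sub>M M" "\<lambda>p. W (fst p) (snd p)" borel] by simp

lemma jointly_meas_diff: "jointly_meas V \<Longrightarrow> jointly_meas W \<Longrightarrow> jointly_meas (\<lambda>r w. V r w - W r w)"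
  unfolding jointly_meas_def by simp

lemma jointly_meas_elem: "elem a \<sigma> S \<Longrightarrow> jointly_meas \<sigma>"
  unfolding jointly_meas_def by (rule elem_meas)

lemma jointly_meas_nn [measurable]:
  assumes "jointly_meas W"
  shows "(\<lambda>r. mean_sq (W r)) \<in> borel_measurable borel"
proof -
  have [measurable]: "(\<lambda>p. W (fst p) (snd p)) \<in> borel_measurable (borel \<Otimes>\<^sub>M M)"
    using assms by (simp add: jointly_meas_def)
  have "(\<lambda>p. ennreal ((norm (W (fst p) (snd p)))\<^sup>2)) \<in> borel_measurable (borel \<Otimes>\<^sub>M M)" by measurable
  then show ?thesis
    using borel_measurable_nn_integral[of "\<lambda>r w. ennreal ((norm (W r w))\<^sup>2)" borel]
    by (simp add: case_prod_beta)
qed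

lemma energy_add_le:
  assumes "jointly_meas V" "jointly_meas W"
  shows "energy (\<lambda>r w. V r w + W r w) \<le> 2 * energy V + 2 * energy W"
proof -
  have "energy (\<lambda>r w. V r w + W r w) \<le> (\<integral>\<^sup>+r. 2 * mean_sq (V r) +
      2 * mean_sq (W r) \<partial>lborel)"
    unfolding energy_def by (intro nn_integral_mono nn_norm_add_square_le jointly_meas_slice assms)
  also have "\<dots> = 2 * energy V + 2 * energy W"
    unfolding energy_def using assms by (simp add: nn_integral_add nn_integral_cmult)
  finally show ?thesis .
qed

lemma energy_minus: "energy (\<lambda>r w. - W r w) = energy W"
  by (simp add: energy_def)

lemma jointly_meas_minus: "jointly_meas W \<Longrightarrow> jointly_meas (\<lambda>r w. - W r w)"
  by (simp add: jointly_meas_def)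

lemma energy_diff_le:
  assumes "jointly_meas V" "jointly_meas W"
  shows "energy (\<lambda>r w. V r w - W r w) \<le> 2 * energy V + 2 * energy W"
  using energy_add_le[OF assms(1) jointly_meas_minus[OF assms(2)]] by (simp add: energy_minus)

text \<open>
  The parameter \<open>a\<close> records that the approximating integrands start no earlier than \<open>a\<close>; this is what
  makes the integral orthogonal to \<open>F a\<close>.
\<close>

definition ito :: "real \<Rightarrow> (real \<Rightarrow> 'w \<Rightarrow> real^'d) \<Rightarrow> ('w \<Rightarrow> real) \<Rightarrow> bool" where
  "ito a W I \<longleftrightarrow> jointly_meas W \<and> I \<in> borel_measurable M \<and>
     (\<exists>\<sigma> S. (\<forall>m::nat. elem a (\<sigma> m) (S m)) \<and>
        (\<lambda>m. energy (\<lambda>r w. W r w - \<sigma> m r w)) \<longlonglongrightarrow> 0 \<and>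
        (\<lambda>m. mean_sq (\<lambda>w. I w - S m w)) \<longlonglongrightarrow> 0)"

lemma ito_elem:
  assumes "elem a \<sigma> S" "0 \<le> a" shows "ito a \<sigma> S"
  using jointly_meas_elem[OF assms(1)] sq_int_meas[OF elem_sq_int[OF assms]] assms(1)
  unfolding ito_def energy_def by (auto intro!: exI[of _ "\<lambda>_. \<sigma>"] exI[of _ "\<lambda>_. S"])

lemma ito_mono: "ito a W I \<Longrightarrow> b \<le> a \<Longrightarrow> ito b W I"
  unfolding ito_def using elem_mono by blast

lemma ito_diff:
  assumes "ito a V I" "ito a W J" "0 \<le> a"
  shows "ito a (\<lambda>r w. V r w - W r w) (\<lambda>w. I w - J w)"
proof -
  obtain \<sigma> S \<rho> R where e: "\<And>m. elem a (\<sigma> m) (S m)" "\<And>m. elem a (\<rho> m) (R m)"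
    and c: "(\<lambda>m. energy (\<lambda>r w. V r w - \<sigma> m r w)) \<longlonglongrightarrow> 0"
      "(\<lambda>m. energy (\<lambda>r w. W r w - \<rho> m r w)) \<longlonglongrightarrow> 0"
      "(\<lambda>m. mean_sq (\<lambda>w. I w - S m w)) \<longlonglongrightarrow> 0"
      "(\<lambda>m. mean_sq (\<lambda>w. J w - R m w)) \<longlonglongrightarrow> 0"
    and m: "jointly_meas V" "jointly_meas W" "I \<in> borel_measurable M" "J \<in> borel_measurable M"
    using assms(1,2) unfolding ito_def by blast
  have SR: "S m \<in> borel_measurable M" "R m \<in> borel_measurable M" for m
    using e assms(3) by (blast intro: sq_int_meas elem_sq_int)+
  have "energy (\<lambda>r w. (V r w - W r w) - (\<sigma> m r w - \<rho> m r w)) \<le>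
      2 * energy (\<lambda>r w. V r w - \<sigma> m r w) + 2 * energy (\<lambda>r w. W r w - \<rho> m r w)" for m
  proof -
    have "(\<lambda>r w. (V r w - W r w) - (\<sigma> m r w - \<rho> m r w)) =
        (\<lambda>r w. (V r w - \<sigma> m r w) - (W r w - \<rho> m r w))" by (auto simp: fun_eq_iff)
    then show ?thesis
      using energy_diff_le[OF jointly_meas_diff[OF m(1) jointly_meas_elem[OF e(1)]]
        jointly_meas_diff[OF m(2) jointly_meas_elem[OF e(2)]]] by simp
  qed
  then have c1: "(\<lambda>m. energy (\<lambda>r w. (V r w - W r w) - (\<sigma> m r w - \<rho> m r w))) \<longlonglongrightarrow> 0"
    by (rule tendsto_0_le_ennreal[OF tendsto_0_double_ennreal[OF c(1,2)]])
  have "mean_sq (\<lambda>w. (I w - J w) - (S m w - R m w)) \<le>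
      2 * mean_sq (\<lambda>w. I w - S m w) + 2 * mean_sq (\<lambda>w. J w - R m w)" for m
  proof -
    have [measurable]: "I \<in> borel_measurable M" "J \<in> borel_measurable M" "S m \<in> borel_measurable M" "R m \<in> borel_measurable M"
      using m SR by auto
    have eq: "(I w - J w) - (S m w - R m w) = (I w - S m w) + (R m w - J w)" for w by simp
    show ?thesis
      using nn_norm_add_square_le[of "\<lambda>w. I w - S m w" "\<lambda>w. R m w - J w"]
      unfolding eq norm_minus_commute[of "R m _"] by simp
  qed
  then have c2: "(\<lambda>m. mean_sq (\<lambda>w. (I w - J w) - (S m w - R m w))) \<longlonglongrightarrow> 0"
    by (rule tendsto_0_le_ennreal[OF tendsto_0_double_ennreal[OF c(3,4)]])
  show ?thesis
    unfolding ito_def using m c1 c2 elem_diff[OF e]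
    by (intro conjI jointly_meas_diff exI[of _ "\<lambda>m r w. \<sigma> m r w - \<rho> m r w"] exI[of _ "\<lambda>m w. S m w - R m w"]) auto
qed

text \<open>
  The isometry for elementary integrals, with a factor lost in passing to the limit through
  \<open>(x + y)\<^sup>2 \<le> 2 x\<^sup>2 + 2 y\<^sup>2\<close>; the constant is immaterial because the bound is used for small errors.
\<close>

lemma ito_second_moment:
  assumes "ito a W I" "0 \<le> a"
  shows "(\<integral>\<^sup>+w. ennreal ((I w)\<^sup>2) \<partial>M) \<le> 4 * energy W"
proof -
  obtain \<sigma> S where e: "\<And>m. elem a (\<sigma> m) (S m)"
    and c: "(\<lambda>m. energy (\<lambda>r w. W r w - \<sigma> m r w)) \<longlonglongrightarrow> 0"
      "(\<lambda>m. mean_sq (\<lambda>w. I w - S m w)) \<longlonglongrightarrow> 0"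
    and W: "jointly_meas W" and I[measurable]: "I \<in> borel_measurable M"
    using assms(1) unfolding ito_def by blast
  let ?d = "\<lambda>m. mean_sq (\<lambda>w. I w - S m w)"
  have le: "(\<integral>\<^sup>+w. ennreal ((I w)\<^sup>2) \<partial>M) \<le> 2 * ?d m + 4 * energy (\<lambda>r w. W r w - \<sigma> m r w) + 4 * energy W" for m
  proof -
    have [measurable]: "S m \<in> borel_measurable M"
      using e assms(2) by (blast intro: sq_int_meas elem_sq_int)
    have "(\<integral>\<^sup>+w. ennreal ((I w)\<^sup>2) \<partial>M) \<le> 2 * ?d m + 2 * energy (\<sigma> m)"
      using nn_norm_add_square_le[of "\<lambda>w. I w - S m w" "S m"] elem_isometry[OF e assms(2), of m] by simp
    moreover have "energy (\<sigma> m) \<le> 2 * energy W + 2 * energy (\<lambda>r w. W r w - \<sigma> m r w)"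
      using energy_diff_le[OF W jointly_meas_diff[OF W jointly_meas_elem[OF e]], of m] by simp
    ultimately have "(\<integral>\<^sup>+w. ennreal ((I w)\<^sup>2) \<partial>M) \<le>
        2 * ?d m + 2 * (2 * energy W + 2 * energy (\<lambda>r w. W r w - \<sigma> m r w))"
      by (meson add_left_mono mult_left_mono order_trans zero_le)
    also have "\<dots> = 2 * ?d m + 4 * energy (\<lambda>r w. W r w - \<sigma> m r w) + 4 * energy W"
      by (simp add: distrib_left mult.assoc[symmetric] ac_simps)
    finally show ?thesis .
  qed
  have "(\<lambda>m. 2 * ?d m + 4 * energy (\<lambda>r w. W r w - \<sigma> m r w) + 4 * energy W) \<longlonglongrightarrow> 2 * 0 + 4 * 0 + 4 * energy W"
    by (intro tendsto_add ennreal_tendsto_cmult c tendsto_const) auto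
  then show ?thesis
    using LIMSEQ_le_const[of _ "4 * energy W"] le by simp
qed

text \<open>
  Orthogonality passes from the elementary integrals to their limit by the Cauchy-Schwarz inequality.
\<close>

lemma ito_orth:
  assumes "ito a W I" "0 \<le> a" and fin: "energy W < \<infinity>"
    and X: "sq_int X" "X \<in> borel_measurable (F a)"
  shows "sq_int I" "(\<integral>w. X w * I w \<partial>M) = 0"
proof -
  obtain \<sigma> S where e: "\<And>m. elem a (\<sigma> m) (S m)"
    and c: "(\<lambda>m. mean_sq (\<lambda>w. I w - S m w)) \<longlonglongrightarrow> 0"
    and I[measurable]: "I \<in> borel_measurable M"
    using assms(1) unfolding ito_def by blast
  note [measurable] = sq_int_meas[OF X(1)]
  have "(\<integral>\<^sup>+w. ennreal ((I w)\<^sup>2) \<partial>M) < \<infinity>"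
    using ito_second_moment[OF assms(1,2)] fin by (auto simp: ennreal_mult_less_top intro: le_less_trans)
  then show I2: "sq_int I" by (intro sq_intI) auto
  have le: "(ennreal \<bar>\<integral>w. X w * I w \<partial>M\<bar>)\<^sup>2 \<le>
      (\<integral>\<^sup>+w. ennreal ((X w)\<^sup>2) \<partial>M) * mean_sq (\<lambda>w. I w - S m w)" for m
  proof -
    have S: "sq_int (S m)" using e assms(2) by (blast intro: elem_sq_int)
    note [measurable] = sq_int_meas[OF S]
    have "(\<integral>w. X w * I w \<partial>M) = (\<integral>w. X w * (I w - S m w) \<partial>M)"
      using elem_orth[OF e assms(2) X, of m] sq_int_mult[OF X(1) I2] sq_int_mult[OF X(1) S]
      by (simp add: right_diff_distrib)
    then have "ennreal \<bar>\<integral>w. X w * I w \<partial>M\<bar> \<le> (\<integral>\<^sup>+w. ennreal \<bar>X w * (I w - S m w)\<bar> \<partial>M)"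
      using integral_norm_bound_ennreal[OF sq_int_mult[OF X(1) sq_int_diff[OF I2 S]]] by simp
    also have "\<dots> = (\<integral>\<^sup>+w. ennreal \<bar>X w\<bar> * ennreal \<bar>I w - S m w\<bar> \<partial>M)"
      by (simp add: abs_mult ennreal_mult)
    finally have "(ennreal \<bar>\<integral>w. X w * I w \<partial>M\<bar>)\<^sup>2 \<le> (\<integral>\<^sup>+w. ennreal \<bar>X w\<bar> * ennreal \<bar>I w - S m w\<bar> \<partial>M)\<^sup>2"
      by (intro power_mono) auto
    also have "\<dots> \<le> (\<integral>\<^sup>+w. (ennreal \<bar>X w\<bar>)\<^sup>2 \<partial>M) * (\<integral>\<^sup>+w. (ennreal \<bar>I w - S m w\<bar>)\<^sup>2 \<partial>M)"
      by (rule Cauchy_Schwarz_nn_integral) auto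
    finally show ?thesis by (simp add: ennreal_power)
  qed
  have "(\<integral>\<^sup>+w. ennreal ((X w)\<^sup>2) \<partial>M) < top" using sq_int_nn[OF X(1)] by simp
  from ennreal_tendsto_cmult[OF this c]
  have lim: "(\<lambda>m. (\<integral>\<^sup>+w. ennreal ((X w)\<^sup>2) \<partial>M) * mean_sq (\<lambda>w. I w - S m w)) \<longlonglongrightarrow> 0"
    by simp
  have "(ennreal \<bar>\<integral>w. X w * I w \<partial>M\<bar>)\<^sup>2 \<le> 0"
    using LIMSEQ_le_const[OF lim] le by blast
  then show "(\<integral>w. X w * I w \<partial>M) = 0" by simp
qed

lemma simple_integrand_grid_mono:
  assumes "simple_integrand M B a b n \<tau> H" "i \<le> j" "j \<le> n" shows "\<tau> i \<le> \<tau> j"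
  using assms(2,3)
proof (induction rule: dec_induct)
  case (step k)
  then have "\<tau> k \<le> \<tau> (Suc k)" using assms(1) by (auto simp: simple_integrand_def)
  with step show ?case by simp
qed simp

lemma simple_integrand_grid:
  assumes "simple_integrand M B a b n \<tau> H" "i \<le> n" shows "a \<le> \<tau> i" "\<tau> i \<le> b"
  using simple_integrand_grid_mono[OF assms(1), of 0 i] simple_integrand_grid_mono[OF assms(1), of i n] assms
  by (auto simp: simple_integrand_def)

lemma simple_integrand_bdd_at: "simple_integrand M B a b n \<tau> H \<Longrightarrow> k < n \<Longrightarrow> bdd_at (\<tau> k) (H k)"
  by (auto simp: simple_integrand_def bdd_at_def)

lemma simple_elem:
  assumes s: "simple_integrand M B a b n \<tau> H"
  shows "elem a (simple_value n \<tau> H) (simple_integral B n \<tau> H)"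
proof -
  have "elem a (simple_value k \<tau> H) (simple_integral B k \<tau> H)" if "k \<le> n" for k
    using that
  proof (induction k)
    case 0
    have "simple_value 0 \<tau> H = (\<lambda>_ _. 0)" "simple_integral B 0 \<tau> H = (\<lambda>_. 0)"
      by (auto simp: simple_value_def simple_integral_def fun_eq_iff)
    then show ?case using elem.zero by simp
  next
    case (Suc k)
    have "elem a (\<lambda>r w. indicator {\<tau> k<..\<tau> (Suc k)} r *\<^sub>R H k w + simple_value k \<tau> H r w)
        (\<lambda>w. H k w \<bullet> incr (\<tau> k) (\<tau> (Suc k)) w + simple_integral B k \<tau> H w)"
      using Suc s simple_integrand_grid(1)[OF s, of k] simple_integrand_bdd_at[OF s, of k]
      by (intro elem.step) (auto simp: simple_integrand_def)
    moreover have "simple_value (Suc k) \<tau> H = (\<lambda>r w. indicator {\<tau> k<..\<tau> (Suc k)} r *\<^sub>R H k w + simple_value k \<tau> H r w)"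
      "simple_integral B (Suc k) \<tau> H = (\<lambda>w. H k w \<bullet> incr (\<tau> k) (\<tau> (Suc k)) w + simple_integral B k \<tau> H w)"
      by (auto simp: simple_value_def simple_integral_def fun_eq_iff)
    ultimately show ?case by simp
  qed
  then show ?thesis by simp
qed

lemma simple_value_support:
  assumes s: "simple_integrand M B a b n \<tau> H" and r: "r \<notin> {a<..b}"
  shows "simple_value n \<tau> H r w = 0"
  unfolding simple_value_def
proof (rule sum.neutral, safe)
  fix k assume "k < n"
  then have "a \<le> \<tau> k" "\<tau> (Suc k) \<le> b" using simple_integrand_grid[OF s] by auto
  then have "r \<notin> {\<tau> k<..\<tau> (Suc k)}" using r by auto
  then show "indicator {\<tau> k<..\<tau> (Suc k)} r *\<^sub>R H k w = 0" by simp
qed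

lemma prog_jointly_meas:
  assumes "prog_measurable M B a b Z" "a \<le> b" "A \<in> sets borel" "A \<subseteq> {a..b}"
  shows "jointly_meas (on A Z)"
proof -
  have m: "(\<lambda>p. indicator A (fst p) *\<^sub>R Z (fst p) (snd p)) \<in> borel_measurable (borel \<Otimes>\<^sub>M F b)"
    using assms by (intro measurable_on_interval[of _ a b]) (auto simp: prog_measurable_def)
  have "(\<lambda>w. w) \<in> measurable M (F b)"
    using F_imp_M[of "\<lambda>w. w" b "F b"] by simp
  then have "(\<lambda>p. (fst p, snd p)) \<in> measurable (borel \<Otimes>\<^sub>M M) (borel \<Otimes>\<^sub>M F b)"
    by (intro measurable_Pair measurable_fst measurable_compose[OF measurable_snd])
  from measurable_compose[OF this m] show ?thesis unfolding jointly_meas_def by simp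
qed

lemma energy_swap:
  assumes "jointly_meas W"
  shows "energy W = (\<integral>\<^sup>+w. (\<integral>\<^sup>+r. ennreal ((norm (W r w))\<^sup>2) \<partial>lborel) \<partial>M)"
proof -
  have [measurable]: "(\<lambda>p. W (fst p) (snd p)) \<in> borel_measurable (borel \<Otimes>\<^sub>M M)"
    using assms by (simp add: jointly_meas_def)
  interpret P: pair_sigma_finite "lborel :: real measure" M ..
  have "(\<lambda>p. ennreal ((norm (W (fst p) (snd p)))\<^sup>2)) \<in> borel_measurable (lborel \<Otimes>\<^sub>M M)" by measurable
  from P.Fubini[OF this] show ?thesis unfolding energy_def by simp
qed

lemma has_ito_integral_ito:
  assumes h: "has_ito_integral M B a b Z I" and ab: "0 \<le> a" "a \<le> b"
  shows "ito a (on {a<..b} Z) I"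
    and "\<exists>n \<tau> H. (\<forall>m::nat. simple_integrand M B a b (n m) (\<tau> m) (H m)) \<and>
      (\<lambda>m. energy (\<lambda>r w. indicator {a<..b} r *\<^sub>R Z r w - simple_value (n m) (\<tau> m) (H m) r w)) \<longlonglongrightarrow> 0"
proof -
  obtain n \<tau> H where s: "\<And>m. simple_integrand M B a b (n m) (\<tau> m) (H m)"
    and c: "(\<lambda>m. \<integral>\<^sup>+ w. (\<integral>\<^sup>+ r\<in>{a..b}.
           ennreal ((norm (Z r w - simple_value (n m) (\<tau> m) (H m) r w))\<^sup>2) \<partial>lborel) \<partial>M) \<longlonglongrightarrow> 0"
      "(\<lambda>m. \<integral>\<^sup>+ w. ennreal ((I w - simple_integral B (n m) (\<tau> m) (H m) w)\<^sup>2) \<partial>M) \<longlonglongrightarrow> 0"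
    and Z: "prog_measurable M B a b Z" and I: "I \<in> borel_measurable M"
    using h unfolding has_ito_integral_def L2_proc_def by blast
  let ?\<sigma> = "\<lambda>m. simple_value (n m) (\<tau> m) (H m)"
  let ?W = "\<lambda>r w. indicator {a<..b} r *\<^sub>R Z r w"
  have W: "jointly_meas ?W" using ab by (intro prog_jointly_meas[OF Z]) auto
  have "energy (\<lambda>r w. ?W r w - ?\<sigma> m r w) \<le> (\<integral>\<^sup>+ w. (\<integral>\<^sup>+ r\<in>{a..b}.
           ennreal ((norm (Z r w - ?\<sigma> m r w))\<^sup>2) \<partial>lborel) \<partial>M)" for m
    unfolding energy_swap[OF jointly_meas_diff[OF W jointly_meas_elem[OF simple_elem[OF s]]]]
    by (intro nn_integral_mono)
       (auto simp: indicator_def simple_value_support[OF s])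
  then have E: "(\<lambda>m. energy (\<lambda>r w. ?W r w - ?\<sigma> m r w)) \<longlonglongrightarrow> 0"
    by (rule tendsto_0_le_ennreal[OF c(1)])
  show "ito a ?W I"
    unfolding ito_def using W I E c(2) simple_elem[OF s]
    by (intro conjI exI[of _ ?\<sigma>] exI[of _ "\<lambda>m. simple_integral B (n m) (\<tau> m) (H m)"]) auto
  show "\<exists>n \<tau> H. (\<forall>m::nat. simple_integrand M B a b (n m) (\<tau> m) (H m)) \<and>
      (\<lambda>m. energy (\<lambda>r w. ?W r w - simple_value (n m) (\<tau> m) (H m) r w)) \<longlonglongrightarrow> 0"
    using s E by (intro exI conjI allI)
qed

end

section \<open>One step of the backward inequality\<close>

text \<open>
  On average over both signs, a perturbation of \<open>x > 0\<close> adds at least half of its square to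
  \<open>(x\<^sup>+)\<^sup>2\<close>, even when it is large enough to push \<open>x\<close> below \<open>0\<close>.
\<close>

lemma pos_part_symmetric_square:
  fixes x m :: real
  shows "2 * (max 0 x)\<^sup>2 + (if 0 < x then m\<^sup>2 else 0) \<le> (max 0 (x + m))\<^sup>2 + (max 0 (x - m))\<^sup>2"
proof (cases "0 < x")
  case True
  have *: "2 * x\<^sup>2 + m\<^sup>2 \<le> (max 0 (x + m))\<^sup>2 + (max 0 (x - m))\<^sup>2" if "0 \<le> m" for m
  proof (cases "m \<le> x")
    case True
    then show ?thesis using that \<open>0 < x\<close> by (simp add: power2_sum power2_diff)
  next
    case False
    then have "x * x \<le> x * m" using \<open>0 < x\<close> by (intro mult_left_mono) auto
    then show ?thesis using False that \<open>0 < x\<close> by (simp add: power2_sum power2_eq_square algebra_simps)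
  qed
  then show ?thesis using True *[of m] *[of "- m"] by (cases "0 \<le> m") auto
qed auto

text \<open>
  Convexity of \<open>(x\<^sup>+)\<^sup>2\<close> at \<open>x + m\<close>, and then \<open>(x + m)\<^sup>+\<close> is replaced by \<open>x\<^sup>+\<close> at the cost of \<open>\<bar>m\<bar>\<close>. The
  term \<open>x\<^sup>+ e\<close> is kept with its sign since its expectation vanishes in the application.
\<close>

lemma pos_part_square_step:
  fixes x m e f y :: real
  assumes y: "x + m + e - f \<le> y" and f: "0 \<le> f"
  shows "(max 0 (x + m))\<^sup>2 + 2 * (max 0 x * e) \<le>
    (max 0 y)\<^sup>2 + 2 * (max 0 x * f) + 2 * (\<bar>m\<bar> * \<bar>e\<bar>) + 2 * (\<bar>m\<bar> * f)"
proof -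
  define u where "u = max 0 (x + m)"
  have "u\<^sup>2 + 2 * u * (e - f) \<le> (max 0 (x + m + e - f))\<^sup>2"
  proof -
    define v where "v = max 0 (x + m + e - f)"
    have "u * (x + m) = u\<^sup>2" by (auto simp: u_def max_def power2_eq_square)
    moreover have "u * (x + m + (e - f)) \<le> u * v" by (intro mult_left_mono) (auto simp: v_def u_def)
    ultimately have "u\<^sup>2 + u * (e - f) \<le> u * v" by (simp add: distrib_left)
    moreover have "2 * (u * v) \<le> u\<^sup>2 + v\<^sup>2" using sum_squares_bound[of u v] by simp
    ultimately show ?thesis by (simp add: v_def[symmetric])
  qed
  also have "\<dots> \<le> (max 0 y)\<^sup>2" using y by (intro power_mono) auto
  finally have 1: "u\<^sup>2 + 2 * u * (e - f) \<le> (max 0 y)\<^sup>2" .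
  have ux: "\<bar>u - max 0 x\<bar> \<le> \<bar>m\<bar>" by (auto simp: u_def max_def abs_if)
  have "\<bar>(u - max 0 x) * e\<bar> \<le> \<bar>m\<bar> * \<bar>e\<bar>" unfolding abs_mult using ux by (intro mult_right_mono) auto
  then have 2: "max 0 x * e \<le> u * e + \<bar>m\<bar> * \<bar>e\<bar>" by (auto simp: left_diff_distrib abs_le_iff)
  have "(u - max 0 x) * f \<le> \<bar>m\<bar> * f" using ux f by (intro mult_right_mono) auto
  then have 3: "u * f \<le> max 0 x * f + \<bar>m\<bar> * f" by (simp add: left_diff_distrib)
  have "2 * u * (e - f) = 2 * (u * e) - 2 * (u * f)" by (simp add: algebra_simps)
  with 1 2 3 show ?thesis unfolding u_def[symmetric] by linarith
qed

context brownian
begin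

lemma bdd_at_indicator:
  assumes "bdd_at p h" "x \<in> borel_measurable (F p)"
  shows "bdd_at p (\<lambda>w. (if 0 < (x w :: real) then h w else 0))"
proof -
  obtain C where C: "\<forall>w\<in>space M. norm (h w) \<le> C" and [measurable]: "h \<in> borel_measurable (F p)"
    using assms by (auto simp: bdd_at_def)
  note assms(2)[measurable]
  have "norm (if 0 < x w then h w else 0) \<le> C" if "w \<in> space M" for w
    using C that order_trans[OF norm_ge_zero[of "h w"]] by auto
  then have "\<exists>C. \<forall>w\<in>space M. norm (if 0 < x w then h w else 0) \<le> C" by blast
  then show ?thesis unfolding bdd_at_def by simp
qed

text \<open>
  This inequality takes the place of the second-order term of the Ito formula for \<open>(x\<^sup>+)\<^sup>2\<close>.
\<close>

lemma symmetric_square_expectation: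
  assumes pq: "0 \<le> p" "p < q" and h: "bdd_at p h" and x: "sq_int x" "x \<in> borel_measurable (F p)"
  shows "(\<integral>w. (max 0 (x w))\<^sup>2 \<partial>M) + (q - p) / 2 * (\<integral>w. (if 0 < x w then (norm (h w))\<^sup>2 else 0) \<partial>M)
    \<le> (\<integral>w. (max 0 (x w + h w \<bullet> incr p q w))\<^sup>2 \<partial>M)"
proof -
  have pq': "p \<le> q" using pq by simp
  let ?m = "\<lambda>w. h w \<bullet> incr p q w"
  let ?h = "\<lambda>w. (if 0 < x w then h w else 0)"
  have h': "bdd_at p ?h" by (rule bdd_at_indicator[OF h x(2)])
  have m: "sq_int ?m" by (rule bdd_incr_sq_int[OF pq(1) pq' h])
  have m': "sq_int (\<lambda>w. ?h w \<bullet> incr p q w)" by (rule bdd_incr_sq_int[OF pq(1) pq' h'])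
  have [measurable]: "h \<in> borel_measurable (F p)" "x \<in> borel_measurable (F p)"
    using h x by (auto simp: bdd_at_def)
  have "(\<lambda>z. (max 0 (x (fst z) + h (fst z) \<bullet> snd z))\<^sup>2) \<in> borel_measurable (F p \<Otimes>\<^sub>M borel)" by measurable
  from incr_symmetric[OF pq this]
  have sym: "(\<integral>w. (max 0 (x w + ?m w))\<^sup>2 \<partial>M) = (\<integral>w. (max 0 (x w - ?m w))\<^sup>2 \<partial>M)"
    by (simp only: fst_conv snd_conv inner_minus_right add_uminus_conv_diff)
  have ind: "(\<integral>w. (if 0 < x w then (?m w)\<^sup>2 else 0) \<partial>M) =
      (q - p) * (\<integral>w. (if 0 < x w then (norm (h w))\<^sup>2 else 0) \<partial>M)"
  proof -
    have "(if 0 < x w then (?m w)\<^sup>2 else 0) = (?h w \<bullet> incr p q w) * (h w \<bullet> incr p q w)"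
      "(if 0 < x w then (norm (h w))\<^sup>2 else 0) = ?h w \<bullet> h w" for w
      by (auto simp: power2_eq_square power2_norm_eq_inner[unfolded power2_eq_square])
    then show ?thesis using bdd_incr_inner_same[OF pq(1) pq' h' h] by simp
  qed
  have ii: "integrable M (\<lambda>w. if 0 < x w then (?m w)\<^sup>2 else 0)"
  proof -
    have "(if 0 < x w then (?m w)\<^sup>2 else 0) = (?h w \<bullet> incr p q w) * (?m w)" for w
      by (auto simp: power2_eq_square)
    then show ?thesis using sq_int_mult[OF m' m] by simp
  qed
  have i: "integrable M (\<lambda>w. (max 0 (x w))\<^sup>2)" "integrable M (\<lambda>w. (max 0 (x w + ?m w))\<^sup>2)"
      "integrable M (\<lambda>w. (max 0 (x w - ?m w))\<^sup>2)"
    using sq_int_pos[OF x(1)] sq_int_pos[OF sq_int_add[OF x(1) m]] sq_int_pos[OF sq_int_diff[OF x(1) m]]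
    by (simp_all add: sq_int_def)
  have "(\<integral>w. 2 * (max 0 (x w))\<^sup>2 + (if 0 < x w then (?m w)\<^sup>2 else 0) \<partial>M) \<le>
      (\<integral>w. (max 0 (x w + ?m w))\<^sup>2 + (max 0 (x w - ?m w))\<^sup>2 \<partial>M)"
    by (intro integral_mono Bochner_Integration.integrable_add integrable_mult_right i ii
        pos_part_symmetric_square)
  then show ?thesis using i ii sym ind by simp
qed

text \<open>
  Here \<open>x\<close> and \<open>y\<close> are the values of the difference process at the two ends of the step, \<open>f\<close> bounds
  the drift over the step and \<open>e\<close> is the error of the discretised stochastic integral. With
  \<open>m = h \<bullet> incr p q\<close>, the products \<open>\<bar>m\<bar> \<bar>e\<bar>\<close> and \<open>\<bar>m\<bar> f\<close> are split by Young's inequality with parameter \<open>\<kappa>\<close>, so that they become small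
  once \<open>\<kappa>\<close> is small and the other two factors are small compared with \<open>\<kappa>\<close>.
\<close>

lemma one_step:
  assumes pq: "0 \<le> p" "p < q" and h: "bdd_at p h" and x: "sq_int x" "x \<in> borel_measurable (F p)"
    and e: "sq_int e" "(\<integral>w. max 0 (x w) * e w \<partial>M) = 0"
    and f: "sq_int f" "\<And>w. 0 \<le> f w" and y: "sq_int y"
    and le: "AE w in M. x w + h w \<bullet> incr p q w + e w - f w \<le> y w"
    and k: "0 < \<kappa>"
  shows "(\<integral>w. (max 0 (x w))\<^sup>2 \<partial>M) + (q - p) / 2 * (\<integral>w. (if 0 < x w then (norm (h w))\<^sup>2 else 0) \<partial>M)
    \<le> (\<integral>w. (max 0 (y w))\<^sup>2 \<partial>M) + 2 * (\<integral>w. max 0 (x w) * f w \<partial>M)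
      + 2 * \<kappa> * (q - p) * (\<integral>w. (norm (h w))\<^sup>2 \<partial>M) + (\<integral>w. (e w)\<^sup>2 \<partial>M) / \<kappa> + (\<integral>w. (f w)\<^sup>2 \<partial>M) / \<kappa>"
proof -
  have pq': "p \<le> q" using pq by simp
  let ?m = "\<lambda>w. h w \<bullet> incr p q w"
  have m: "sq_int ?m" by (rule bdd_incr_sq_int[OF pq(1) pq' h])
  have young: "2 * (\<bar>a\<bar> * \<bar>b\<bar>) \<le> \<kappa> * a\<^sup>2 + b\<^sup>2 / \<kappa>" for a b :: real
  proof -
    have "2 * (sqrt \<kappa> * \<bar>a\<bar>) * (\<bar>b\<bar> / sqrt \<kappa>) \<le> (sqrt \<kappa> * \<bar>a\<bar>)\<^sup>2 + (\<bar>b\<bar> / sqrt \<kappa>)\<^sup>2"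
      by (rule sum_squares_bound)
    then show ?thesis using k by (simp add: power_mult_distrib power_divide)
  qed
  have ae: "AE w in M. (max 0 (x w + ?m w))\<^sup>2 + 2 * (max 0 (x w) * e w) \<le>
      (max 0 (y w))\<^sup>2 + 2 * (max 0 (x w) * f w) + 2 * \<kappa> * (?m w)\<^sup>2 + (e w)\<^sup>2 / \<kappa> + (f w)\<^sup>2 / \<kappa>"
    using le
  proof eventually_elim
    case (elim w)
    show ?case
      using pos_part_square_step[OF elim f(2)] young[of "?m w" "e w"] young[of "?m w" "f w"] f(2)[of w]
      by simp
  qed
  note xp = sq_int_pos[OF x(1)]
  have i: "integrable M (\<lambda>w. (max 0 (x w + ?m w))\<^sup>2)" "integrable M (\<lambda>w. (max 0 (y w))\<^sup>2)"
    "integrable M (\<lambda>w. (e w)\<^sup>2)" "integrable M (\<lambda>w. (f w)\<^sup>2)" "integrable M (\<lambda>w. (?m w)\<^sup>2)"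
    "integrable M (\<lambda>w. max 0 (x w) * e w)" "integrable M (\<lambda>w. max 0 (x w) * f w)"
    using sq_int_pos[OF sq_int_add[OF x(1) m]] sq_int_pos[OF y] e(1) f(1) m
      sq_int_mult[OF xp e(1)] sq_int_mult[OF xp f(1)]
    by (simp_all add: sq_int_def)
  have "(\<integral>w. (max 0 (x w + ?m w))\<^sup>2 + 2 * (max 0 (x w) * e w) \<partial>M) \<le>
      (\<integral>w. (max 0 (y w))\<^sup>2 + 2 * (max 0 (x w) * f w) + 2 * \<kappa> * (?m w)\<^sup>2 + (e w)\<^sup>2 / \<kappa> + (f w)\<^sup>2 / \<kappa> \<partial>M)"
    by (intro integral_mono_AE ae) (use i in auto)
  also have "\<dots> = (\<integral>w. (max 0 (y w))\<^sup>2 \<partial>M) + 2 * (\<integral>w. max 0 (x w) * f w \<partial>M)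
      + 2 * \<kappa> * (\<integral>w. (?m w)\<^sup>2 \<partial>M) + (\<integral>w. (e w)\<^sup>2 \<partial>M) / \<kappa> + (\<integral>w. (f w)\<^sup>2 \<partial>M) / \<kappa>"
    using i by simp
  also have "(\<integral>w. (?m w)\<^sup>2 \<partial>M) = (q - p) * (\<integral>w. (norm (h w))\<^sup>2 \<partial>M)"
    using bdd_incr_inner_same[OF pq(1) pq' h h] by (simp add: power2_norm_eq_inner power2_eq_square[of "_ \<bullet> _"])
  finally show ?thesis
    using symmetric_square_expectation[OF pq h x] i e(2) by simp
qed

end

lemma ennreal_young: "2 * (a * b) \<le> a\<^sup>2 + (b::ennreal)\<^sup>2"
proof (cases "a = top \<or> b = top")
  case True
  then show ?thesis by (auto simp: power2_eq_square)
next
  case False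
  then obtain x y where "a = ennreal x" "b = ennreal y" "0 \<le> x" "0 \<le> y"
    by (metis ennreal_cases)
  then show ?thesis
    using sum_squares_bound[of x y]
    by (simp add: ennreal_mult[symmetric] ennreal_power ennreal_plus[symmetric] mult.assoc
        flip: ennreal_numeral del: ennreal_plus)
qed

lemma ennreal_integral_le_nn:
  fixes f :: "'a \<Rightarrow> real"
  assumes "\<And>x. 0 \<le> f x"
  shows "ennreal (integral\<^sup>L M f) \<le> (\<integral>\<^sup>+x. ennreal (f x) \<partial>M)"
proof (cases "integrable M f")
  case True then show ?thesis using nn_integral_eq_integral[OF True] assms by simp
qed (simp add: not_integrable_integral_eq)

context brownian
begin

text \<open>
  The contribution of \<open>K x\<^sup>+ |\<zeta>|\<close> is split so that its main part is at most half of
  \<open>1\<^sub>{\<^sub>x\<^sub>>\<^sub>0\<^sub>} |h|\<^sup>2\<close>, which is what the left-hand side of \<open>one_step\<close> gains per unit of time.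
\<close>

lemma pos_drift_le:
  assumes x: "x \<in> borel_measurable M" and \<zeta>: "\<zeta> \<in> borel_measurable M" and h: "h \<in> borel_measurable M"
    and X: "X \<in> borel_measurable M" "(\<integral>\<^sup>+w. (X w)\<^sup>2 \<partial>M) \<le> G"
    and f: "drift_le K \<phi> X \<zeta> x"
    and k: "0 < \<kappa>" and K: "0 \<le> K"
  shows "2 * pos_dot x \<phi> \<le>
    (\<integral>\<^sup>+w. ennreal (if 0 < x w then (norm (h w))\<^sup>2 else 0) \<partial>M) / 2 +
    (ennreal (K + 2 * K\<^sup>2 + \<kappa>) * pos_sq x + ennreal K * G +
     ennreal (K\<^sup>2 / \<kappa>) * mean_sq (\<lambda>w. \<zeta> w - h w))"
proof -
  note [measurable] = x \<zeta> h X(1)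
  let ?V = "pos_sq x"
  let ?H = "\<integral>\<^sup>+w. ennreal (if 0 < x w then (norm (h w))\<^sup>2 else 0) \<partial>M"
  let ?d = "mean_sq (\<lambda>w. \<zeta> w - h w)"
  have "2 * pos_dot x X = (\<integral>\<^sup>+w. 2 * (ennreal (max 0 (x w)) * X w) \<partial>M)"
    by (simp add: nn_integral_cmult)
  also have "\<dots> \<le> (\<integral>\<^sup>+w. (ennreal (max 0 (x w)))\<^sup>2 + (X w)\<^sup>2 \<partial>M)"
    by (intro nn_integral_mono ennreal_young)
  also have "\<dots> = ?V + (\<integral>\<^sup>+w. (X w)\<^sup>2 \<partial>M)"
  proof -
    have "(ennreal (max 0 a))\<^sup>2 = ennreal ((max 0 a)\<^sup>2)" for a :: real by (rule ennreal_power) simp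
    then show ?thesis using nn_integral_add[of "\<lambda>w. ennreal ((max 0 (x w))\<^sup>2)" M "\<lambda>w. (X w)\<^sup>2"] by simp
  qed
  also have "\<dots> \<le> ?V + G" using X(2) by (intro add_left_mono)
  finally have 1: "2 * pos_dot x X \<le> ?V + G" .
  have pt: "2 * K * (max 0 a * norm z) \<le>
     (if 0 < a then (norm b)\<^sup>2 else 0) / 2 + (2 * K\<^sup>2 + \<kappa>) * (max 0 a)\<^sup>2 + K\<^sup>2 / \<kappa> * (norm (z - b))\<^sup>2"
    for a and z b :: "real^'d"
  proof (cases "0 < a")
    case True
    have "norm z \<le> norm b + norm (z - b)" using norm_triangle_ineq[of b "z - b"] by simp
    then have "2 * K * (a * norm z) \<le> 2 * K * (a * (norm b + norm (z - b)))"
      using K True by (intro mult_left_mono) auto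
    moreover have "2 * (2 * K * a) * norm b \<le> (2 * K * a)\<^sup>2 + (norm b)\<^sup>2" by (rule sum_squares_bound)
    moreover have "2 * (sqrt \<kappa> * a) * (K * norm (z - b) / sqrt \<kappa>) \<le>
        (sqrt \<kappa> * a)\<^sup>2 + (K * norm (z - b) / sqrt \<kappa>)\<^sup>2" by (rule sum_squares_bound)
    ultimately show ?thesis using True k
      by (simp add: power_mult_distrib power_divide algebra_simps)
  next
    case False
    then show ?thesis using k by simp
  qed
  have "2 * (ennreal K * pos_dot x (\<lambda>w. ennreal (norm (\<zeta> w)))) =
      (\<integral>\<^sup>+w. ennreal (2 * K * (max 0 (x w) * norm (\<zeta> w))) \<partial>M)"
    using K by (simp add: ennreal_mult nn_integral_cmult mult.assoc)
  also have "\<dots> \<le> (\<integral>\<^sup>+w. ennreal ((if 0 < x w then (norm (h w))\<^sup>2 else 0) / 2 +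
      (2 * K\<^sup>2 + \<kappa>) * (max 0 (x w))\<^sup>2 + K\<^sup>2 / \<kappa> * (norm (\<zeta> w - h w))\<^sup>2) \<partial>M)"
    by (intro nn_integral_mono ennreal_leI pt)
  also have "\<dots> = (\<integral>\<^sup>+w. ennreal (if 0 < x w then (norm (h w))\<^sup>2 else 0) / 2 +
      ennreal (2 * K\<^sup>2 + \<kappa>) * ennreal ((max 0 (x w))\<^sup>2) + ennreal (K\<^sup>2 / \<kappa>) * ennreal ((norm (\<zeta> w - h w))\<^sup>2) \<partial>M)"
  proof (rule nn_integral_cong)
    have gen: "ennreal (a / 2 + c * b + c' * b') = ennreal a / 2 + ennreal c * ennreal b + ennreal c' * ennreal b'"
      if "0 \<le> a" "0 \<le> b" "0 \<le> b'" "0 \<le> c" "0 \<le> c'" for a b b' c c' :: real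
      using that by (simp add: ennreal_mult ennreal_divide_numeral)
    fix w
    show "ennreal ((if 0 < x w then (norm (h w))\<^sup>2 else 0) / 2 +
      (2 * K\<^sup>2 + \<kappa>) * (max 0 (x w))\<^sup>2 + K\<^sup>2 / \<kappa> * (norm (\<zeta> w - h w))\<^sup>2) =
      ennreal (if 0 < x w then (norm (h w))\<^sup>2 else 0) / 2 +
      ennreal (2 * K\<^sup>2 + \<kappa>) * ennreal ((max 0 (x w))\<^sup>2) + ennreal (K\<^sup>2 / \<kappa>) * ennreal ((norm (\<zeta> w - h w))\<^sup>2)"
      using k by (intro gen) auto
  qed
  also have "\<dots> = ?H / 2 + ennreal (2 * K\<^sup>2 + \<kappa>) * ?V + ennreal (K\<^sup>2 / \<kappa>) * ?d"
    by (simp add: nn_integral_add nn_integral_cmult nn_integral_divide)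
  finally have 2: "2 * (ennreal K * pos_dot x (\<lambda>w. ennreal (norm (\<zeta> w)))) \<le>
     ?H / 2 + ennreal (2 * K\<^sup>2 + \<kappa>) * ?V + ennreal (K\<^sup>2 / \<kappa>) * ?d" .
  have "2 * pos_dot x \<phi> \<le>
      2 * (ennreal K * (pos_dot x X +
          pos_dot x (\<lambda>w. ennreal (norm (\<zeta> w)))))"
    by (intro mult_left_mono f) simp
  also have "\<dots> = ennreal K * (2 * pos_dot x X) +
      2 * (ennreal K * pos_dot x (\<lambda>w. ennreal (norm (\<zeta> w))))"
    by (simp add: distrib_left mult.assoc mult.left_commute)
  also have "\<dots> \<le> ennreal K * (?V + G) + (?H / 2 + ennreal (2 * K\<^sup>2 + \<kappa>) * ?V + ennreal (K\<^sup>2 / \<kappa>) * ?d)"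
    by (intro add_mono mult_left_mono 1 2) simp
  also have "\<dots> = ?H / 2 + ((ennreal K + ennreal (2 * K\<^sup>2 + \<kappa>)) * ?V + ennreal K * G + ennreal (K\<^sup>2 / \<kappa>) * ?d)"
    by (simp add: distrib_left distrib_right ac_simps)
  also have "ennreal K + ennreal (2 * K\<^sup>2 + \<kappa>) = ennreal (K + 2 * K\<^sup>2 + \<kappa>)"
    using K k by (subst ennreal_plus[symmetric]) (auto simp: add.assoc)
  finally show ?thesis .
qed

text \<open>
  All error terms of \<open>one_step\<close> are rewritten as integrals over the step, so that the estimates of
  consecutive steps can be added. The term \<open>E (1\<^sub>{\<^sub>x\<^sub>>\<^sub>0\<^sub>} |h|\<^sup>2) (q - p) / 2\<close> appears on both sides and,
  being finite, cancels.
\<close>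

lemma step_estimate:
  fixes \<zeta> :: "real \<Rightarrow> 'w \<Rightarrow> real^'d" and \<phi> :: "real \<Rightarrow> 'w \<Rightarrow> real" and G :: "real \<Rightarrow> ennreal"
  defines "z \<equiv> \<lambda>s. mean_sq (\<zeta> s)"
  assumes pq: "0 \<le> p" "p < q" and h: "bdd_at p h" and x: "sq_int x" "x \<in> borel_measurable (F p)"
    and \<zeta>: "jointly_meas \<zeta>" and G: "G \<in> borel_measurable borel"
    and e: "sq_int e" "(\<integral>w. max 0 (x w) * e w \<partial>M) = 0"
      "(\<integral>\<^sup>+w. ennreal ((e w)\<^sup>2) \<partial>M) \<le> 4 * (\<integral>\<^sup>+s\<in>{p<..q}. mean_sq (\<lambda>w. \<zeta> s w - h w) \<partial>lborel)"
    and \<phi>: "jointly_meas \<phi>" "\<And>s w. 0 \<le> \<phi> s w"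
    and y: "sq_int y"
    and le: "AE w in M. x w + h w \<bullet> incr p q w + e w - (LINT s:{p<..q}|lborel. \<phi> s w) \<le> y w"
    and X: "\<And>s. X s \<in> borel_measurable M" "\<And>s. (\<integral>\<^sup>+w. (X s w)\<^sup>2 \<partial>M) \<le> G s"
    and drift: "AE s in lborel. s \<in> {p<..q} \<longrightarrow> drift_le K (\<lambda>w. ennreal (\<phi> s w)) (X s) (\<zeta> s) x"
    and drift2: "AE s in lborel. s \<in> {p<..q} \<longrightarrow> (\<integral>\<^sup>+w. ennreal ((\<phi> s w)\<^sup>2) \<partial>M) \<le> ennreal (2 * K\<^sup>2) * (G s + z s)"
    and fin: "(\<integral>\<^sup>+s\<in>{p<..q}. (G s + z s) \<partial>lborel) < \<infinity>"
    and k: "0 < \<kappa>" and K: "0 \<le> K"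
  shows "pos_sq x \<le> pos_sq y +
    (\<integral>\<^sup>+s\<in>{p<..q}.
      ennreal (K + 2 * K\<^sup>2 + \<kappa>) * pos_sq x + ennreal K * G s +
      ennreal (K\<^sup>2 / \<kappa> + 4 * \<kappa> + 4 / \<kappa>) * mean_sq (\<lambda>w. \<zeta> s w - h w) +
      ennreal (4 * \<kappa> + (q - p) / \<kappa> * (2 * K\<^sup>2)) * (G s + z s) \<partial>lborel)"
proof -
  let ?R = "restrict_space lborel {p<..q}"
  let ?V = "pos_sq x"
  let ?H = "\<integral>\<^sup>+w. ennreal (if 0 < x w then (norm (h w))\<^sup>2 else 0) \<partial>M"
  define d where "d = (\<lambda>s. mean_sq (\<lambda>w. \<zeta> s w - h w))"
  define f where "f = (\<lambda>w. LINT s:{p<..q}|lborel. \<phi> s w)"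
  let ?w1 = "\<lambda>s. ennreal (K + 2 * K\<^sup>2 + \<kappa>) * ?V + ennreal K * G s + ennreal (K\<^sup>2 / \<kappa>) * d s"
  let ?w2 = "\<lambda>s. ?w1 s +
       ennreal (2 * \<kappa>) * (2 * z s + 2 * d s) + ennreal (1 / \<kappa>) * (4 * d s) +
       ennreal (1 / \<kappa>) * (ennreal ((q - p) * (2 * K\<^sup>2)) * (G s + z s))"
  let ?w3 = "\<lambda>s. ennreal (K + 2 * K\<^sup>2 + \<kappa>) * ?V + ennreal K * G s +
      ennreal (K\<^sup>2 / \<kappa> + 4 * \<kappa> + 4 / \<kappa>) * d s +
      ennreal (4 * \<kappa> + (q - p) / \<kappa> * (2 * K\<^sup>2)) * (G s + z s)"
  have R: "(\<integral>\<^sup>+s\<in>{p<..q}. g s \<partial>lborel) = (\<integral>\<^sup>+s. g s \<partial>?R)" for g :: "real \<Rightarrow> ennreal"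
    by (simp add: nn_integral_restrict_space)
  have Rc: "(\<integral>\<^sup>+s. c \<partial>?R) = ennreal (q - p) * c" for c
    using pq by (simp add: emeasure_restrict_space mult.commute)
  have RAE: "AE s in ?R. P s" if "AE s in lborel. s \<in> {p<..q} \<longrightarrow> P s" for P
    using that by (simp add: AE_restrict_space_iff)
  note hM = bdd_at_meas[OF h]
  note [measurable] = hM sq_int_meas[OF x(1)] sq_int_meas[OF y] sq_int_meas[OF e(1)] G
  have [measurable]: "(\<lambda>p. \<phi> (fst p) (snd p)) \<in> borel_measurable (borel \<Otimes>\<^sub>M M)"
    "(\<lambda>p. \<zeta> (fst p) (snd p)) \<in> borel_measurable (borel \<Otimes>\<^sub>M M)"
    using \<phi>(1) \<zeta> by (auto simp: jointly_meas_def)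
  have [measurable]: "(\<lambda>p. \<phi> (snd p) (fst p)) \<in> borel_measurable (M \<Otimes>\<^sub>M borel)"
  proof -
    have "(\<lambda>p. (snd p, fst p)) \<in> measurable (M \<Otimes>\<^sub>M borel) (borel \<Otimes>\<^sub>M M)" by measurable
    from measurable_compose[OF this \<phi>(1)[unfolded jointly_meas_def]] show ?thesis by simp
  qed
  have dm: "d \<in> borel_measurable borel"
    unfolding d_def by (rule jointly_meas_nn) (simp add: jointly_meas_def)
  have zm: "z \<in> borel_measurable borel"
    unfolding z_def by (rule jointly_meas_nn[OF \<zeta>])
  have dm': "d \<in> borel_measurable ?R" and zm': "z \<in> borel_measurable ?R" and Gm': "G \<in> borel_measurable ?R"
    using dm zm G by (auto intro!: measurable_restrict_space1)
  note [measurable] = dm' zm' Gm'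
  interpret P: pair_sigma_finite "lborel :: real measure" M ..
  have f0: "0 \<le> f w" for w
    unfolding f_def set_lebesgue_integral_def using \<phi>(2) by (intro integral_nonneg_AE) auto
  have f_nn: "ennreal (f w) \<le> (\<integral>\<^sup>+s. ennreal (\<phi> s w) * indicator {p<..q} s \<partial>lborel)" for w
  proof -
    have "ennreal (f w) \<le> (\<integral>\<^sup>+s. ennreal (indicator {p<..q} s *\<^sub>R \<phi> s w) \<partial>lborel)"
      unfolding f_def set_lebesgue_integral_def using \<phi>(2) by (intro ennreal_integral_le_nn) auto
    also have "\<dots> = (\<integral>\<^sup>+s. ennreal (\<phi> s w) * indicator {p<..q} s \<partial>lborel)"
      by (intro nn_integral_cong) (auto simp: indicator_def)
    finally show ?thesis .
  qed
  have fm[measurable]: "f \<in> borel_measurable M"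
    unfolding f_def set_lebesgue_integral_def
    by (rule lborel.borel_measurable_lebesgue_integral) measurable
  \<comment> \<open>Cauchy-Schwarz in time gains the factor \<open>q - p\<close>, which beats \<open>1 / \<kappa>\<close> on a fine grid.\<close>
  have f2: "(\<integral>\<^sup>+w. ennreal ((f w)\<^sup>2) \<partial>M) \<le> ennreal (q - p) * (\<integral>\<^sup>+s. ennreal (2 * K\<^sup>2) * (G s + z s) \<partial>?R)"
  proof -
    have "(\<integral>\<^sup>+w. ennreal ((f w)\<^sup>2) \<partial>M) \<le>
        (\<integral>\<^sup>+w. ennreal (q - p) * (\<integral>\<^sup>+s. ennreal ((\<phi> s w)\<^sup>2) * indicator {p<..q} s \<partial>lborel) \<partial>M)"
    proof (rule nn_integral_mono)
      fix w assume w: "w \<in> space M"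
      note [measurable] = jointly_meas_section[OF \<phi>(1) w]
      have "ennreal ((f w)\<^sup>2) = (ennreal (f w))\<^sup>2" using f0 by (simp add: ennreal_power)
      also have "\<dots> \<le> (\<integral>\<^sup>+s. indicator {p<..q} s * (ennreal (\<phi> s w) * indicator {p<..q} s) \<partial>lborel)\<^sup>2"
        using f_nn[of w] by (intro power_mono) (auto simp: indicator_def intro!: order_trans[OF f_nn] nn_integral_mono)
      also have "\<dots> \<le> (\<integral>\<^sup>+s. (indicator {p<..q} s)\<^sup>2 \<partial>lborel) *
          (\<integral>\<^sup>+s. (ennreal (\<phi> s w) * indicator {p<..q} s)\<^sup>2 \<partial>lborel)"
        by (rule Cauchy_Schwarz_nn_integral) auto
      also have "(\<integral>\<^sup>+s. (indicator {p<..q} s)\<^sup>2 \<partial>lborel) = (\<integral>\<^sup>+s. indicator {p<..q} s \<partial>lborel)"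
        by (intro nn_integral_cong) (auto simp: indicator_def)
      also have "\<dots> = ennreal (q - p)" using pq by simp
      also have "(\<integral>\<^sup>+s. (ennreal (\<phi> s w) * indicator {p<..q} s)\<^sup>2 \<partial>lborel) =
          (\<integral>\<^sup>+s. ennreal ((\<phi> s w)\<^sup>2) * indicator {p<..q} s \<partial>lborel)"
        by (intro nn_integral_cong) (auto simp: indicator_def ennreal_power \<phi>(2))
      finally show "ennreal ((f w)\<^sup>2) \<le> ennreal (q - p) * (\<integral>\<^sup>+s. ennreal ((\<phi> s w)\<^sup>2) * indicator {p<..q} s \<partial>lborel)" .
    qed
    also have "\<dots> = ennreal (q - p) * (\<integral>\<^sup>+w. (\<integral>\<^sup>+s. ennreal ((\<phi> s w)\<^sup>2) * indicator {p<..q} s \<partial>lborel) \<partial>M)"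
      by (intro nn_integral_cmult) measurable
    also have "(\<integral>\<^sup>+w. (\<integral>\<^sup>+s. ennreal ((\<phi> s w)\<^sup>2) * indicator {p<..q} s \<partial>lborel) \<partial>M) =
        (\<integral>\<^sup>+s. (\<integral>\<^sup>+w. ennreal ((\<phi> s w)\<^sup>2) * indicator {p<..q} s \<partial>M) \<partial>lborel)"
      using P.Fubini[of "\<lambda>p'. ennreal ((\<phi> (fst p') (snd p'))\<^sup>2) * indicator {p<..q} (fst p')"] by simp
    also have "\<dots> = (\<integral>\<^sup>+s. (\<integral>\<^sup>+w. ennreal ((\<phi> s w)\<^sup>2) \<partial>M) \<partial>?R)"
      unfolding R[symmetric] by (intro nn_integral_cong) (auto simp: indicator_def)
    also have "\<dots> \<le> (\<integral>\<^sup>+s. ennreal (2 * K\<^sup>2) * (G s + z s) \<partial>?R)"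
      by (intro nn_integral_mono_AE RAE drift2)
    finally show ?thesis by (simp add: mult_left_mono)
  qed
  also have "\<dots> = ennreal ((q - p) * (2 * K\<^sup>2)) * (\<integral>\<^sup>+s. (G s + z s) \<partial>?R)"
    using pq by (simp add: nn_integral_cmult ennreal_mult mult.assoc)
  finally have f2'': "(\<integral>\<^sup>+w. ennreal ((f w)\<^sup>2) \<partial>M) \<le> ennreal ((q - p) * (2 * K\<^sup>2)) * (\<integral>\<^sup>+s. (G s + z s) \<partial>?R)" .
  have fsq: "sq_int f"
  proof (rule sq_intI[OF fm])
    have "ennreal ((q - p) * (2 * K\<^sup>2)) * (\<integral>\<^sup>+s. (G s + z s) \<partial>?R) < \<infinity>"
      using fin unfolding R by (simp add: ennreal_mult_less_top)
    with f2'' show "(\<integral>\<^sup>+w. ennreal ((f w)\<^sup>2) \<partial>M) < \<infinity>" by (rule le_less_trans)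
  qed
  \<comment> \<open>The summand with \<open>?H\<close> is the one to be cancelled at the end.\<close>
  have A: "2 * (\<integral>\<^sup>+w. ennreal (max 0 (x w) * f w) \<partial>M) \<le> ennreal (q - p) * (?H / 2) +
     (\<integral>\<^sup>+s. ?w1 s \<partial>?R)"
  proof -
    have "(\<integral>\<^sup>+w. ennreal (max 0 (x w) * f w) \<partial>M) \<le>
        (\<integral>\<^sup>+w. (\<integral>\<^sup>+s. ennreal (max 0 (x w)) * ennreal (\<phi> s w) * indicator {p<..q} s \<partial>lborel) \<partial>M)"
    proof (rule nn_integral_mono)
      fix w assume w: "w \<in> space M"
      note [measurable] = jointly_meas_section[OF \<phi>(1) w]
      have "ennreal (max 0 (x w) * f w) = ennreal (max 0 (x w)) * ennreal (f w)"
        using f0 by (simp add: ennreal_mult)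
      also have "\<dots> \<le> ennreal (max 0 (x w)) * (\<integral>\<^sup>+s. ennreal (\<phi> s w) * indicator {p<..q} s \<partial>lborel)"
        by (intro mult_left_mono f_nn) simp
      also have "\<dots> = (\<integral>\<^sup>+s. ennreal (max 0 (x w)) * ennreal (\<phi> s w) * indicator {p<..q} s \<partial>lborel)"
        by (simp add: nn_integral_cmult mult.assoc)
      finally show "ennreal (max 0 (x w) * f w) \<le> \<dots>" .
    qed
    also have "\<dots> = (\<integral>\<^sup>+s. (\<integral>\<^sup>+w. ennreal (max 0 (x w)) * ennreal (\<phi> s w) * indicator {p<..q} s \<partial>M) \<partial>lborel)"
      using P.Fubini[of "\<lambda>p'. ennreal (max 0 (x (snd p'))) * ennreal (\<phi> (fst p') (snd p')) * indicator {p<..q} (fst p')"]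
      by simp
    also have "\<dots> = (\<integral>\<^sup>+s. pos_dot x (\<lambda>w. ennreal (\<phi> s w)) \<partial>?R)"
      unfolding R[symmetric] by (intro nn_integral_cong) (auto simp: indicator_def)
    finally have "2 * (\<integral>\<^sup>+w. ennreal (max 0 (x w) * f w) \<partial>M) \<le>
        2 * (\<integral>\<^sup>+s. pos_dot x (\<lambda>w. ennreal (\<phi> s w)) \<partial>?R)"
      by (intro mult_left_mono) auto
    also have "\<dots> = (\<integral>\<^sup>+s. 2 * pos_dot x (\<lambda>w. ennreal (\<phi> s w)) \<partial>?R)"
      by (intro nn_integral_cmult[symmetric] measurable_restrict_space1) (simp, measurable)
    also have "\<dots> \<le> (\<integral>\<^sup>+s. ?H / 2 + (?w1 s) \<partial>?R)"
    proof (rule nn_integral_mono_AE, rule eventually_mono[OF RAE[OF drift]])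
      fix s assume d: "drift_le K (\<lambda>w. ennreal (\<phi> s w)) (X s) (\<zeta> s) x"
      show "2 * pos_dot x (\<lambda>w. ennreal (\<phi> s w)) \<le>
         ?H / 2 + (?w1 s)"
        unfolding d_def
        by (rule pos_drift_le[OF sq_int_meas[OF x(1)] jointly_meas_slice[OF \<zeta>] hM X d k K])
    qed
    also have "\<dots> = ennreal (q - p) * (?H / 2) +
      (\<integral>\<^sup>+s. ?w1 s \<partial>?R)"
      unfolding Rc[symmetric] by (intro nn_integral_add) measurable
    finally show ?thesis .
  qed
  have Bq: "ennreal (q - p) * mean_sq h \<le> (\<integral>\<^sup>+s. 2 * z s + 2 * d s \<partial>?R)"
    unfolding Rc[symmetric]
  proof (rule nn_integral_mono)
    fix s
    have [measurable]: "\<zeta> s \<in> borel_measurable M" by (rule jointly_meas_slice[OF \<zeta>])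
    show "mean_sq h \<le> 2 * z s + 2 * d s"
      using nn_norm_add_square_le[of "\<zeta> s" "\<lambda>w. h w - \<zeta> s w"]
      unfolding z_def d_def norm_minus_commute[of "h _"] by simp
  qed
  have hsq: "integrable M (\<lambda>w. (norm (h w))\<^sup>2)"
    using bdd_inner_integrable[OF h h] by (simp add: power2_norm_eq_inner)
  have hsq': "integrable M (\<lambda>w. if 0 < x w then (norm (h w))\<^sup>2 else 0)"
  proof (rule Bochner_Integration.integrable_bound[OF hsq])
    show "(\<lambda>w. if 0 < x w then (norm (h w))\<^sup>2 else 0) \<in> borel_measurable M" by measurable
  qed auto
  have H: "?H = ennreal (\<integral>w. (if 0 < x w then (norm (h w))\<^sup>2 else 0) \<partial>M)" (is "_ = ennreal ?Hr")
    by (rule nn_integral_eq_integral[OF hsq']) auto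
  have "0 \<le> ?Hr" by (intro integral_nonneg_AE) auto
  then have Hfin: "ennreal (q - p) * (?H / 2) < top"
    unfolding H by (simp add: ennreal_mult_less_top ennreal_divide_numeral)
  have Vx: "?V = ennreal (\<integral>w. (max 0 (x w))\<^sup>2 \<partial>M)" by (rule sq_int_nn[OF sq_int_pos[OF x(1)]])
  have Vy: "pos_sq y = ennreal (\<integral>w. (max 0 (y w))\<^sup>2 \<partial>M)"
    by (rule sq_int_nn[OF sq_int_pos[OF y]])
  have xf: "(\<integral>\<^sup>+w. ennreal (max 0 (x w) * f w) \<partial>M) = ennreal (\<integral>w. max 0 (x w) * f w \<partial>M)"
    using f0 by (intro nn_integral_eq_integral sq_int_mult sq_int_pos x fsq) auto
  have hh: "mean_sq h = ennreal (\<integral>w. (norm (h w))\<^sup>2 \<partial>M)"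
    by (rule nn_integral_eq_integral[OF hsq]) auto
  have nn: "0 \<le> (\<integral>w. max 0 (x w) * f w \<partial>M)" "0 \<le> ?Hr" using f0 by (auto intro!: integral_nonneg_AE)
  have "?V + ennreal (q - p) * (?H / 2) = ennreal ((\<integral>w. (max 0 (x w))\<^sup>2 \<partial>M) + (q - p) / 2 * ?Hr)"
    unfolding Vx H using pq nn by (simp add: ennreal_divide_numeral ennreal_mult[symmetric] ennreal_plus[symmetric] del: ennreal_plus)
  also have "\<dots> \<le> ennreal ((\<integral>w. (max 0 (y w))\<^sup>2 \<partial>M) + 2 * (\<integral>w. max 0 (x w) * f w \<partial>M)
      + 2 * \<kappa> * (q - p) * (\<integral>w. (norm (h w))\<^sup>2 \<partial>M) + (\<integral>w. (e w)\<^sup>2 \<partial>M) / \<kappa> + (\<integral>w. (f w)\<^sup>2 \<partial>M) / \<kappa>)"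
    using le by (intro ennreal_leI one_step[OF pq h x e(1,2) fsq f0 y _ k]) (simp add: f_def)
  also have "\<dots> = pos_sq y + 2 * (\<integral>\<^sup>+w. ennreal (max 0 (x w) * f w) \<partial>M)
      + ennreal (2 * \<kappa>) * (ennreal (q - p) * mean_sq h)
      + ennreal (1 / \<kappa>) * (\<integral>\<^sup>+w. ennreal ((e w)\<^sup>2) \<partial>M) + ennreal (1 / \<kappa>) * (\<integral>\<^sup>+w. ennreal ((f w)\<^sup>2) \<partial>M)"
    unfolding Vy xf hh sq_int_nn[OF e(1)] sq_int_nn[OF fsq]
    using pq k nn by (simp add: ennreal_mult[symmetric] ennreal_plus[symmetric] mult.assoc del: ennreal_plus flip: ennreal_numeral)
  also have "\<dots> \<le> pos_sq y + (ennreal (q - p) * (?H / 2) +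
     (\<integral>\<^sup>+s. ?w1 s \<partial>?R))
      + ennreal (2 * \<kappa>) * (\<integral>\<^sup>+s. 2 * z s + 2 * d s \<partial>?R)
      + ennreal (1 / \<kappa>) * (4 * (\<integral>\<^sup>+s. d s \<partial>?R))
      + ennreal (1 / \<kappa>) * (ennreal ((q - p) * (2 * K\<^sup>2)) * (\<integral>\<^sup>+s. (G s + z s) \<partial>?R))"
    using e(3) unfolding R d_def[symmetric]
    by (intro add_mono mult_left_mono A Bq f2'' order_refl) auto
  also have "\<dots> = ennreal (q - p) * (?H / 2) + (pos_sq y +
     (\<integral>\<^sup>+s. ?w2 s \<partial>?R))"
    by (simp add: nn_integral_add nn_integral_cmult add.assoc add.left_commute)
  finally have main: "?V + ennreal (q - p) * (?H / 2) \<le> \<dots>" .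
  have "?V \<le> pos_sq y +
     (\<integral>\<^sup>+s. ?w2 s \<partial>?R)"
    using main less_imp_neq[OF Hfin] by (simp add: add.commute[of ?V] ennreal_add_left_cancel_le)
  also have "\<dots> \<le> pos_sq y + (\<integral>\<^sup>+s. ?w3 s \<partial>?R)"
  proof (intro add_left_mono nn_integral_mono)
    fix s
    have c1: "ennreal (K\<^sup>2 / \<kappa> + 4 * \<kappa> + 4 / \<kappa>) = ennreal (K\<^sup>2 / \<kappa>) + ennreal (2 * \<kappa>) * 2 + ennreal (1 / \<kappa>) * 4"
      using k by (simp add: ennreal_mult[symmetric] ennreal_plus[symmetric] del: ennreal_plus flip: ennreal_numeral)
    have c2: "ennreal (4 * \<kappa> + (q - p) / \<kappa> * (2 * K\<^sup>2)) = ennreal (2 * \<kappa>) * 2 + ennreal (1 / \<kappa>) * ennreal ((q - p) * (2 * K\<^sup>2))"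
      using k pq by (simp add: ennreal_mult[symmetric] ennreal_plus[symmetric] del: ennreal_plus flip: ennreal_numeral)
    have "ennreal (2 * \<kappa>) * 2 * z s \<le> ennreal (2 * \<kappa>) * 2 * (G s + z s)"
      by (intro mult_left_mono) auto
    then have "(?w1 s) +
        (ennreal (2 * \<kappa>) * 2 * z s + ennreal (2 * \<kappa>) * 2 * d s) + ennreal (1 / \<kappa>) * 4 * d s +
        ennreal (1 / \<kappa>) * ennreal ((q - p) * (2 * K\<^sup>2)) * (G s + z s) \<le>
        (?w1 s) +
        (ennreal (2 * \<kappa>) * 2 * (G s + z s) + ennreal (2 * \<kappa>) * 2 * d s) + ennreal (1 / \<kappa>) * 4 * d s +
        ennreal (1 / \<kappa>) * ennreal ((q - p) * (2 * K\<^sup>2)) * (G s + z s)"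
      by (intro add_mono order_refl)
    then show "?w2 s \<le> ?w3 s"
      unfolding c1 c2 distrib_left distrib_right by (simp add: mult.assoc ac_simps)
  qed
  finally show ?thesis unfolding R d_def .
qed

end

section \<open>The backward inequality along a grid\<close>

lemma grid_chain:
  fixes V rate :: "real \<Rightarrow> ennreal"
  assumes fin: "finite A" and T: "T \<in> A" and rate[measurable]: "rate \<in> borel_measurable borel"
    and step: "\<And>p q. p \<in> A \<Longrightarrow> q \<in> A \<Longrightarrow> p < q \<Longrightarrow> q \<le> T \<Longrightarrow> A \<inter> {p<..<q} = {} \<Longrightarrow>
      V p \<le> V q + (\<integral>\<^sup>+s\<in>{p<..q}. rate s \<partial>lborel)"
  shows "p \<in> A \<Longrightarrow> p \<le> T \<Longrightarrow> V p \<le> V T + (\<integral>\<^sup>+s\<in>{p<..T}. rate s \<partial>lborel)"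
proof (induction "card (A \<inter> {p<..T})" arbitrary: p rule: less_induct)
  case less
  show ?case
  proof (cases "p = T")
    case False
    let ?S = "A \<inter> {p<..T}"
    define q where "q = Min ?S"
    have ne: "finite ?S" "?S \<noteq> {}" using fin T False less.prems by auto
    then have q: "q \<in> ?S" unfolding q_def by (rule Min_in)
    have "A \<inter> {p<..<q} = {}"
    proof (rule equals0I)
      fix r assume r: "r \<in> A \<inter> {p<..<q}"
      then have "r \<in> ?S" using q by auto
      then have "q \<le> r" unfolding q_def using ne by (intro Min_le)
      with r show False by auto
    qed
    then have 1: "V p \<le> V q + (\<integral>\<^sup>+s\<in>{p<..q}. rate s \<partial>lborel)" using less.prems q by (intro step) auto
    have "A \<inter> {q<..T} \<subset> ?S" using q by auto
    then have "card (A \<inter> {q<..T}) < card ?S" using ne by (intro psubset_card_mono)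
    then have 2: "V q \<le> V T + (\<integral>\<^sup>+s\<in>{q<..T}. rate s \<partial>lborel)" using q by (intro less.hyps) auto
    have "(\<integral>\<^sup>+s\<in>{p<..T}. rate s \<partial>lborel) =
        (\<integral>\<^sup>+s. rate s * indicator {q<..T} s + rate s * indicator {p<..q} s \<partial>lborel)"
      using q by (intro nn_integral_cong) (auto simp: indicator_def)
    also have "\<dots> = (\<integral>\<^sup>+s\<in>{q<..T}. rate s \<partial>lborel) + (\<integral>\<^sup>+s\<in>{p<..q}. rate s \<partial>lborel)"
      by (intro nn_integral_add) auto
    finally show ?thesis using order_trans[OF 1 add_right_mono[OF 2]] by (simp add: add.assoc)
  qed simp
qed

lemma fine_grid:
  fixes a T \<delta> :: real
  assumes "0 < \<delta>" "a < T"
  obtains A where "finite A" "a \<in> A" "T \<in> A"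
    "\<And>p q. a \<le> p \<Longrightarrow> p < q \<Longrightarrow> q \<le> T \<Longrightarrow> A \<inter> {p<..<q} = {} \<Longrightarrow> q - p \<le> \<delta>"
proof -
  define n where "n = nat \<lceil>(T - a) / \<delta>\<rceil>"
  define A where "A = insert T ((\<lambda>i. a + real i * \<delta>) ` {..n})"
  have "a \<in> A" unfolding A_def by (auto intro!: image_eqI[of _ _ 0])
  moreover have "q - p \<le> \<delta>" if *: "a \<le> p" "p < q" "q \<le> T" "A \<inter> {p<..<q} = {}" for p q
  proof (rule ccontr)
    assume big: "\<not> q - p \<le> \<delta>"
    define i where "i = Suc (nat \<lfloor>(p - a) / \<delta>\<rfloor>)"
    have fl: "0 \<le> (p - a) / \<delta>" using * assms by simp
    have i: "real i = of_int \<lfloor>(p - a) / \<delta>\<rfloor> + 1" using fl by (simp add: i_def)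
    have "(p - a) / \<delta> < real i" "real i \<le> (p - a) / \<delta> + 1" unfolding i by linarith+
    then have r: "p < a + real i * \<delta>" "a + real i * \<delta> \<le> p + \<delta>" using assms by (auto simp: field_simps)
    have "real i * \<delta> \<le> T - a" using r big * by linarith
    then have "real i \<le> (T - a) / \<delta>" using assms by (simp add: field_simps)
    then have "i \<le> n" unfolding n_def by linarith
    then have "a + real i * \<delta> \<in> A \<inter> {p<..<q}" using r big by (auto simp: A_def)
    with * show False by blast
  qed
  ultimately show ?thesis using that[of A] by (auto simp: A_def)
qed

lemma nn_integral_exp_tail:
  fixes \<beta> a T :: real assumes "0 < \<beta>"
  shows "(\<integral>\<^sup>+s\<in>{a<..T}. ennreal (exp (- \<beta> * s)) \<partial>lborel) \<le> ennreal (exp (- \<beta> * a) / \<beta>)"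
proof -
  have "(\<integral>\<^sup>+s\<in>{a<..T}. ennreal (exp (- \<beta> * s)) \<partial>lborel) \<le> (\<integral>\<^sup>+s. ennreal (exp (- \<beta> * s)) * indicator {a..} s \<partial>lborel)"
    by (intro nn_integral_mono) (auto simp: indicator_def)
  also have "\<dots> = ennreal (0 - (- exp (- \<beta> * a) / \<beta>))"
  proof (rule nn_integral_FTC_atLeast)
    show "((\<lambda>s. - exp (- \<beta> * s) / \<beta>) \<longlongrightarrow> 0) at_top" using assms by real_asymp
    show "DERIV (\<lambda>s. - exp (- \<beta> * s) / \<beta>) x :> exp (- \<beta> * x)" for x
      using assms by (auto intro!: derivative_eq_intros)
  qed auto
  finally show ?thesis by simp
qed

context brownian
begin

text \<open>
  Away from the finite set \<open>P\<close> the process is constant in time, with a value known at the left end of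
  each interval; a finer grid is allowed, so that \<open>P\<close> can be enlarged to a grid of small mesh.
\<close>

definition step_process :: "real \<Rightarrow> real \<Rightarrow> real set \<Rightarrow> (real \<Rightarrow> 'w \<Rightarrow> real^'d) \<Rightarrow> bool" where
  "step_process a T P \<sigma> \<longleftrightarrow> finite P \<and> jointly_meas \<sigma> \<and>
     (\<forall>p q. a \<le> p \<longrightarrow> p < q \<longrightarrow> q \<le> T \<longrightarrow> P \<inter> {p<..<q} = {} \<longrightarrow>
        (\<exists>h. bdd_at p h \<and> (\<forall>r\<in>{p<..q}. \<sigma> r = h)))"

lemma simple_step_process:
  assumes s: "simple_integrand M B a T n \<tau> H"
  shows "step_process a T (\<tau> ` {..n}) (simple_value n \<tau> H)"
proof -
  have "\<exists>h. bdd_at p h \<and> (\<forall>r\<in>{p<..q}. simple_value n \<tau> H r = h)"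
    if pq: "p < q" "\<tau> ` {..n} \<inter> {p<..<q} = {}" for p q
  proof -
    define S where "S = {k. k < n \<and> \<tau> k \<le> p \<and> q \<le> \<tau> (Suc k)}"
    have out: "\<tau> k \<le> p \<or> q \<le> \<tau> k" if "k \<le> n" for k using pq that by force
    have "bdd_at p (\<lambda>w. \<Sum>k\<in>S. H k w)"
      by (intro bdd_at_sum bdd_at_mono[OF simple_integrand_bdd_at[OF s]]) (auto simp: S_def)
    moreover have "simple_value n \<tau> H r w = (\<Sum>k\<in>S. H k w)" if r: "r \<in> {p<..q}" for r w
    proof -
      have "indicator {\<tau> k<..\<tau> (Suc k)} r = (if k \<in> S then 1 else 0 :: real)" if "k < n" for k
        using out[of k] out[of "Suc k"] that r by (auto simp: S_def indicator_def)
      then have "simple_value n \<tau> H r w = (\<Sum>k<n. if k \<in> S then H k w else 0)"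
        unfolding simple_value_def by (intro sum.cong) auto
      also have "\<dots> = (\<Sum>k\<in>{..<n} \<inter> S. H k w)" by (simp add: sum.inter_restrict)
      also have "{..<n} \<inter> S = S" by (auto simp: S_def)
      finally show ?thesis .
    qed
    ultimately show ?thesis by (intro exI[of _ "\<lambda>w. \<Sum>k\<in>S. H k w"]) auto
  qed
  then show ?thesis
    unfolding step_process_def using jointly_meas_elem[OF simple_elem[OF s]] by auto
qed

lemma step_process_diff:
  assumes "step_process a T P \<sigma>" "step_process a T Q \<rho>"
  shows "step_process a T (P \<union> Q) (\<lambda>r w. \<sigma> r w - \<rho> r w)"
proof -
  have "\<exists>h. bdd_at p h \<and> (\<forall>r\<in>{p<..q}. (\<lambda>w. \<sigma> r w - \<rho> r w) = h)"
    if pq: "a \<le> p" "p < q" "q \<le> T" "(P \<union> Q) \<inter> {p<..<q} = {}" for p q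
  proof -
    have "P \<inter> {p<..<q} = {}" "Q \<inter> {p<..<q} = {}" using pq by auto
    then obtain h k where "bdd_at p h" "\<forall>r\<in>{p<..q}. \<sigma> r = h" "bdd_at p k" "\<forall>r\<in>{p<..q}. \<rho> r = k"
      using assms pq unfolding step_process_def by meson
    then show ?thesis
      using bdd_at_add[OF _ bdd_at_minus[of p k], of h] by (intro exI[of _ "\<lambda>w. h w - k w"]) auto
  qed
  then show ?thesis using assms jointly_meas_diff unfolding step_process_def by auto
qed

text \<open>
  For a parameter \<open>\<kappa>\<close>, take a grid of mesh at most \<open>\<kappa>\<^sup>2\<close> and an approximation of the integrand with
  error \<open>\<kappa>\<close> divided by the constant that multiplies it in \<open>step_estimate\<close>. The sum over the grid then has
  total error of order \<open>\<kappa>\<close>, and \<open>V p\<close> at the left end of a step is bounded by the weight at the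
  running time \<open>s\<close> up to the factor \<open>exp (\<beta> \<kappa>\<^sup>2)\<close>. Finally \<open>\<kappa>\<close> tends to \<open>0\<close>.
\<close>

lemma backward_inequality:
  fixes \<zeta> :: "real \<Rightarrow> 'w \<Rightarrow> real^'d" and \<phi> D J :: "real \<Rightarrow> 'w \<Rightarrow> real" and G :: "real \<Rightarrow> ennreal"
  defines "z \<equiv> \<lambda>s. mean_sq (\<zeta> s)"
    and "V \<equiv> \<lambda>t. pos_sq (D t)"
  assumes aT: "0 \<le> a" "a < T"
    and D: "\<And>t. a \<le> t \<Longrightarrow> t \<le> T \<Longrightarrow> sq_int (D t)" "\<And>t. a \<le> t \<Longrightarrow> t \<le> T \<Longrightarrow> D t \<in> borel_measurable (F t)"
    and \<zeta>: "jointly_meas \<zeta>" and \<phi>: "jointly_meas \<phi>" "\<And>s w. 0 \<le> \<phi> s w"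
    and J: "\<And>t. a \<le> t \<Longrightarrow> t \<le> T \<Longrightarrow> ito t (on {t<..T} \<zeta>) (J t)"
    and eq: "\<And>p q. a \<le> p \<Longrightarrow> p < q \<Longrightarrow> q \<le> T \<Longrightarrow>
      AE w in M. D p w + (J p w - J q w) - (LINT s:{p<..q}|lborel. \<phi> s w) \<le> D q w"
    and X: "\<And>s. X s \<in> borel_measurable M" "\<And>s. (\<integral>\<^sup>+w. (X s w)\<^sup>2 \<partial>M) \<le> G s"
    and drift: "AE s in lborel. s \<in> {a<..T} \<longrightarrow> (\<forall>x\<in>borel_measurable (F s).
        drift_le K (\<lambda>w. ennreal (\<phi> s w)) (X s) (\<zeta> s) x)"
    and drift2: "AE s in lborel. s \<in> {a<..T} \<longrightarrow> (\<integral>\<^sup>+w. ennreal ((\<phi> s w)\<^sup>2) \<partial>M) \<le> ennreal (2 * K\<^sup>2) * (G s + z s)"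
    and fin: "(\<integral>\<^sup>+s\<in>{a<..T}. (G s + z s) \<partial>lborel) < \<infinity>"
    and approx: "\<And>\<epsilon>. 0 < \<epsilon> \<Longrightarrow> \<exists>P \<sigma>. step_process a T P \<sigma> \<and>
       energy (\<lambda>r w. indicator {a<..T} r *\<^sub>R \<zeta> r w - \<sigma> r w) \<le> ennreal \<epsilon>"
    and VT: "V T = 0"
    and VN: "\<And>t. a \<le> t \<Longrightarrow> t \<le> T \<Longrightarrow> V t \<le> ennreal (N * exp (- \<beta> * t))"
    and G: "G = (\<lambda>s. ennreal (c * (N * exp (- \<beta> * s))))"
    and pos: "0 < \<beta>" "0 \<le> K" "0 \<le> c" "0 \<le> N"
  shows "V a \<le> ennreal (N * (K + 2 * K\<^sup>2 + K * c) / \<beta> * exp (- \<beta> * a))"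
proof -
  define Q where "Q = (\<integral>\<^sup>+s\<in>{a<..T}. (G s + z s) \<partial>lborel)"
  obtain Qr where Qr: "Q = ennreal Qr" "0 \<le> Qr" using fin unfolding Q_def by (cases Q) (auto simp: Q_def)
  have Gm[measurable]: "G \<in> borel_measurable borel" unfolding G by measurable
  have zm[measurable]: "z \<in> borel_measurable borel" unfolding z_def by (rule jointly_meas_nn[OF \<zeta>])
  define g where "g = (\<lambda>\<kappa>. N * ((K + 2 * K\<^sup>2 + \<kappa>) * exp (\<beta> * \<kappa>\<^sup>2) + K * c) * (exp (- \<beta> * a) / \<beta>) +
      \<kappa> + \<kappa> * (4 + 2 * K\<^sup>2) * Qr)"
  have step: "V a \<le> ennreal (g \<kappa>)" if k: "0 < \<kappa>" for \<kappa>
  proof -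
    \<comment> \<open>The factor of the approximation error in \<open>step_estimate\<close>.\<close>
    define C where "C = K\<^sup>2 / \<kappa> + 4 * \<kappa> + 4 / \<kappa>"
    have C: "0 < C" unfolding C_def using k pos by (intro add_nonneg_pos add_nonneg_nonneg) auto
    obtain P \<sigma> where sp: "step_process a T P \<sigma>"
      and en: "energy (\<lambda>r w. indicator {a<..T} r *\<^sub>R \<zeta> r w - \<sigma> r w) \<le> ennreal (\<kappa> / C)"
      using approx[of "\<kappa> / C"] k C by auto
    define d where "d = (\<lambda>s. mean_sq (\<lambda>w. indicator {a<..T} s *\<^sub>R \<zeta> s w - \<sigma> s w))"
    have \<sigma>m: "jointly_meas \<sigma>" using sp by (simp add: step_process_def)
    have \<zeta>ind: "jointly_meas (on {a<..T} \<zeta>)" for a T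
      using \<zeta> by (simp add: jointly_meas_def)
    have dm[measurable]: "d \<in> borel_measurable borel"
      unfolding d_def by (rule jointly_meas_nn[OF jointly_meas_diff[OF \<zeta>ind \<sigma>m]])
    obtain A0 where A0: "finite A0" "a \<in> A0" "T \<in> A0"
      and mesh: "\<And>p q. a \<le> p \<Longrightarrow> p < q \<Longrightarrow> q \<le> T \<Longrightarrow> A0 \<inter> {p<..<q} = {} \<Longrightarrow> q - p \<le> \<kappa>\<^sup>2"
      using fine_grid[of "\<kappa>\<^sup>2" a T] k aT by (metis zero_less_power)
    define A where "A = (A0 \<union> P) \<inter> {a..T}"
    define rate where "rate = (\<lambda>s. ennreal (N * ((K + 2 * K\<^sup>2 + \<kappa>) * exp (\<beta> * \<kappa>\<^sup>2) + K * c)) * ennreal (exp (- \<beta> * s)) +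
        ennreal C * d s + ennreal (\<kappa> * (4 + 2 * K\<^sup>2)) * (G s + z s))"
    have "V a \<le> V T + (\<integral>\<^sup>+s\<in>{a<..T}. rate s \<partial>lborel)"
    proof (rule grid_chain[where A=A])
      show "finite A" "T \<in> A" "a \<in> A" "a \<le> T" using A0 sp aT by (auto simp: A_def step_process_def)
      show "rate \<in> borel_measurable borel" unfolding rate_def by measurable
      fix p q assume pq: "p \<in> A" "q \<in> A" "p < q" "q \<le> T" and none: "A \<inter> {p<..<q} = {}"
      have p: "a \<le> p" "p \<le> T" "0 \<le> p" and q: "a \<le> q" using pq aT by (auto simp: A_def)
      have none': "A0 \<inter> {p<..<q} = {}" "P \<inter> {p<..<q} = {}" using none p pq by (auto simp: A_def)
      have len: "q - p \<le> \<kappa>\<^sup>2" using mesh p pq none' by auto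
      obtain h where h: "bdd_at p h" and \<sigma>h: "\<And>r. r \<in> {p<..q} \<Longrightarrow> \<sigma> r = h"
        using sp p pq none' unfolding step_process_def by meson
      \<comment> \<open>The stochastic integral over \<open>(p, q]\<close> minus its discretisation; its integrand is \<open>W\<close>.\<close>
      define e where "e = (\<lambda>w. (J p w - J q w) - h w \<bullet> incr p q w)"
      define W where "W = (\<lambda>r w. indicator {p<..q} r *\<^sub>R (\<zeta> r w - h w))"
      have el: "elem p (\<lambda>r w. indicator {p<..q} r *\<^sub>R h w) (\<lambda>w. h w \<bullet> incr p q w)"
        using elem.step[OF elem.zero order_refl _ h, of q] pq by simp
      have "ito p (\<lambda>r w. (indicator {p<..T} r *\<^sub>R \<zeta> r w - indicator {q<..T} r *\<^sub>R \<zeta> r w) - indicator {p<..q} r *\<^sub>R h w) e"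
        unfolding e_def using p q pq
        by (intro ito_diff J ito_mono[OF J[of q]] ito_elem[OF el]) auto
      also have "(\<lambda>r w. (indicator {p<..T} r *\<^sub>R \<zeta> r w - indicator {q<..T} r *\<^sub>R \<zeta> r w) - indicator {p<..q} r *\<^sub>R h w) = W"
        using pq by (auto simp: W_def fun_eq_iff indicator_def)
      finally have itoW: "ito p W e" .
      have enW: "energy W = (\<integral>\<^sup>+s\<in>{p<..q}. mean_sq (\<lambda>w. \<zeta> s w - h w) \<partial>lborel)"
        unfolding energy_def W_def by (intro nn_integral_cong) (auto simp: indicator_def)
      have dh: "d s = mean_sq (\<lambda>w. \<zeta> s w - h w)" if "s \<in> {p<..q}" for s
        using that p pq \<sigma>h[OF that] unfolding d_def by auto
      have "energy W \<le> (\<integral>\<^sup>+s. d s \<partial>lborel)"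
        unfolding enW using dh by (intro nn_integral_mono) (auto simp: indicator_def)
      also have "\<dots> \<le> ennreal (\<kappa> / C)" using en unfolding d_def energy_def .
      finally have "energy W < \<infinity>" by (rule le_less_trans) simp
      note orth = ito_orth[OF itoW p(3) this sq_int_pos[OF D(1)[OF p(1,2)]]]
      have xm: "(\<lambda>w. max 0 (D p w)) \<in> borel_measurable (F p)" using D(2)[OF p(1,2)] by measurable
      have "V p \<le> V q + (\<integral>\<^sup>+s\<in>{p<..q}.
        ennreal (K + 2 * K\<^sup>2 + \<kappa>) * V p + ennreal K * G s +
        ennreal (K\<^sup>2 / \<kappa> + 4 * \<kappa> + 4 / \<kappa>) * mean_sq (\<lambda>w. \<zeta> s w - h w) +
        ennreal (4 * \<kappa> + (q - p) / \<kappa> * (2 * K\<^sup>2)) * (G s + z s) \<partial>lborel)"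
        unfolding V_def z_def
      proof (rule step_estimate[OF p(3) pq(3) h D(1)[OF p(1,2)] D(2)[OF p(1,2)] \<zeta> Gm _ _ _ \<phi> D(1)[OF q pq(4)] _ X _ _ _ k pos(2)])
        show "sq_int e" by (rule orth(1)[OF xm])
        show "(\<integral>w. max 0 (D p w) * e w \<partial>M) = 0" by (rule orth(2)[OF xm])
        show "(\<integral>\<^sup>+w. ennreal ((e w)\<^sup>2) \<partial>M) \<le> 4 * (\<integral>\<^sup>+s\<in>{p<..q}. mean_sq (\<lambda>w. \<zeta> s w - h w) \<partial>lborel)"
          using ito_second_moment[OF itoW p(3)] unfolding enW .
        show "AE w in M. D p w + h w \<bullet> incr p q w + e w - (LINT s:{p<..q}|lborel. \<phi> s w) \<le> D q w"
          using eq[OF p(1) pq(3,4)] by (simp add: e_def)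
        show "AE s in lborel. s \<in> {p<..q} \<longrightarrow> drift_le K (\<lambda>w. ennreal (\<phi> s w)) (X s) (\<zeta> s) (D p)"
          using drift
        proof eventually_elim
          case (elim s)
          show ?case
          proof
            assume s: "s \<in> {p<..q}"
            then have "D p \<in> borel_measurable (F s)" by (intro F_mono[OF D(2)[OF p(1,2)]]) auto
            with elim s p pq show "drift_le K (\<lambda>w. ennreal (\<phi> s w)) (X s) (\<zeta> s) (D p)" by auto
          qed
        qed
        show "AE s in lborel. s \<in> {p<..q} \<longrightarrow> (\<integral>\<^sup>+w. ennreal ((\<phi> s w)\<^sup>2) \<partial>M) \<le>
            ennreal (2 * K\<^sup>2) * (G s + mean_sq (\<zeta> s))"
          using drift2 by eventually_elim (use p pq in \<open>auto simp: z_def\<close>)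
        have "(\<integral>\<^sup>+s\<in>{p<..q}. (G s + z s) \<partial>lborel) \<le> (\<integral>\<^sup>+s\<in>{a<..T}. (G s + z s) \<partial>lborel)"
          using p pq by (intro nn_integral_mono) (auto simp: indicator_def)
        with fin show "(\<integral>\<^sup>+s\<in>{p<..q}. (G s + mean_sq (\<zeta> s)) \<partial>lborel) < \<infinity>"
          unfolding z_def by (rule le_less_trans[rotated])
      qed
      also have "\<dots> \<le> V q + (\<integral>\<^sup>+s\<in>{p<..q}. rate s \<partial>lborel)"
      proof (intro add_left_mono nn_integral_mono)
        fix s
        show "(ennreal (K + 2 * K\<^sup>2 + \<kappa>) * V p + ennreal K * G s +
          ennreal (K\<^sup>2 / \<kappa> + 4 * \<kappa> + 4 / \<kappa>) * mean_sq (\<lambda>w. \<zeta> s w - h w) +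
          ennreal (4 * \<kappa> + (q - p) / \<kappa> * (2 * K\<^sup>2)) * (G s + z s)) * indicator {p<..q} s
          \<le> rate s * indicator {p<..q} s"
        proof (cases "s \<in> {p<..q}")
          case True
          have "exp (- \<beta> * p) \<le> exp (\<beta> * \<kappa>\<^sup>2) * exp (- \<beta> * s)"
          proof -
            have "\<beta> * (s - p) \<le> \<beta> * \<kappa>\<^sup>2" using True len pos by (intro mult_left_mono) auto
            then show ?thesis by (simp add: exp_add[symmetric] algebra_simps)
          qed
          then have "N * exp (- \<beta> * p) \<le> N * (exp (\<beta> * \<kappa>\<^sup>2) * exp (- \<beta> * s))"
            using pos by (intro mult_left_mono)
          then have "V p \<le> ennreal (N * (exp (\<beta> * \<kappa>\<^sup>2) * exp (- \<beta> * s)))"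
            using VN[OF p(1,2)] by (meson ennreal_leI order_trans)
          then have "ennreal (K + 2 * K\<^sup>2 + \<kappa>) * V p + ennreal K * G s \<le>
              ennreal (K + 2 * K\<^sup>2 + \<kappa>) * ennreal (N * (exp (\<beta> * \<kappa>\<^sup>2) * exp (- \<beta> * s))) + ennreal K * G s"
            by (intro add_right_mono mult_left_mono) auto
          also have "\<dots> = ennreal (N * ((K + 2 * K\<^sup>2 + \<kappa>) * exp (\<beta> * \<kappa>\<^sup>2) + K * c)) * ennreal (exp (- \<beta> * s))"
            unfolding G using pos k
            by (simp add: ennreal_mult[symmetric] ennreal_plus[symmetric] del: ennreal_plus) (simp add: algebra_simps)
          finally have 1: "ennreal (K + 2 * K\<^sup>2 + \<kappa>) * V p + ennreal K * G s \<le> \<dots>" .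
          have "(q - p) / \<kappa> \<le> \<kappa>" using len k by (simp add: field_simps power2_eq_square)
          then have "4 * \<kappa> + (q - p) / \<kappa> * (2 * K\<^sup>2) \<le> 4 * \<kappa> + \<kappa> * (2 * K\<^sup>2)"
            by (intro add_left_mono mult_right_mono) auto
          then have "4 * \<kappa> + (q - p) / \<kappa> * (2 * K\<^sup>2) \<le> \<kappa> * (4 + 2 * K\<^sup>2)"
            by (simp add: algebra_simps)
          then have 2: "ennreal (4 * \<kappa> + (q - p) / \<kappa> * (2 * K\<^sup>2)) * (G s + z s) \<le> ennreal (\<kappa> * (4 + 2 * K\<^sup>2)) * (G s + z s)"
            by (intro mult_right_mono ennreal_leI) auto
          show ?thesis using True 1 2 dh[OF True, symmetric] unfolding rate_def C_def[symmetric]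
            by (simp add: add_mono)
        qed simp
      qed
      finally show "V p \<le> V q + (\<integral>\<^sup>+s\<in>{p<..q}. rate s \<partial>lborel)" .
    qed
    also have "\<dots> = (\<integral>\<^sup>+s\<in>{a<..T}. rate s \<partial>lborel)" using VT by simp
    also have "\<dots> = (\<integral>\<^sup>+s. ennreal (N * ((K + 2 * K\<^sup>2 + \<kappa>) * exp (\<beta> * \<kappa>\<^sup>2) + K * c)) * (ennreal (exp (- \<beta> * s)) * indicator {a<..T} s) +
        ennreal C * (d s * indicator {a<..T} s) + ennreal (\<kappa> * (4 + 2 * K\<^sup>2)) * ((G s + z s) * indicator {a<..T} s) \<partial>lborel)"
      unfolding rate_def by (intro nn_integral_cong) (auto simp: indicator_def)
    also have "\<dots> = ennreal (N * ((K + 2 * K\<^sup>2 + \<kappa>) * exp (\<beta> * \<kappa>\<^sup>2) + K * c)) * (\<integral>\<^sup>+s\<in>{a<..T}. ennreal (exp (- \<beta> * s)) \<partial>lborel) +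
        ennreal C * (\<integral>\<^sup>+s\<in>{a<..T}. d s \<partial>lborel) + ennreal (\<kappa> * (4 + 2 * K\<^sup>2)) * Q"
      unfolding Q_def by (simp add: nn_integral_add nn_integral_cmult)
    also have "\<dots> \<le> ennreal (N * ((K + 2 * K\<^sup>2 + \<kappa>) * exp (\<beta> * \<kappa>\<^sup>2) + K * c)) * ennreal (exp (- \<beta> * a) / \<beta>) +
        ennreal C * ennreal (\<kappa> / C) + ennreal (\<kappa> * (4 + 2 * K\<^sup>2)) * ennreal Qr"
    proof -
      have "(\<integral>\<^sup>+s\<in>{a<..T}. d s \<partial>lborel) \<le> (\<integral>\<^sup>+s. d s \<partial>lborel)"
        by (intro nn_integral_mono) (auto simp: indicator_def)
      also have "\<dots> \<le> ennreal (\<kappa> / C)" using en unfolding d_def energy_def .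
      finally show ?thesis unfolding Qr
        by (intro add_mono mult_left_mono nn_integral_exp_tail pos order_refl) auto
    qed
    also have "\<dots> = ennreal (g \<kappa>)"
      unfolding g_def using k pos Qr(2) C
      by (simp add: ennreal_mult[symmetric] ennreal_plus[symmetric] del: ennreal_plus)
    finally show ?thesis .
  qed
  obtain v where v: "V a = ennreal v" "0 \<le> v"
    using VN[of a] aT by (cases "V a") (auto simp: top_unique)
  have "g \<kappa> \<ge> v" if "0 < \<kappa>" for \<kappa>
  proof -
    have "0 \<le> g \<kappa>" unfolding g_def using that pos Qr(2) by (intro add_nonneg_nonneg mult_nonneg_nonneg) auto
    then show ?thesis using step[OF that] v by simp
  qed
  moreover have "(g \<longlongrightarrow> g 0) (at_right 0)"
    unfolding g_def using pos by (auto intro!: tendsto_eq_intros)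
  ultimately have "v \<le> g 0"
    by (intro tendsto_lowerbound[of g "g 0" "at_right 0"]) (auto simp: eventually_at_filter)
  then show ?thesis unfolding v g_def by (intro ennreal_leI) (simp add: field_simps)
qed

section \<open>Square integrable processes and conditional expectations\<close>

lemma prog_slice:
  assumes "prog_measurable M B a b \<psi>" "t \<in> {a..b}"
  shows "\<psi> t \<in> borel_measurable (F t)"
proof -
  have m: "(\<lambda>(r, w). \<psi> r w) \<in> borel_measurable (restrict_space borel {a..t} \<Otimes>\<^sub>M F t)"
    using assms by (auto simp: prog_measurable_def)
  have "(\<lambda>w. (t, w)) \<in> measurable (F t) (restrict_space borel {a..t} \<Otimes>\<^sub>M F t)"
    using assms(2) by (intro measurable_Pair1') (auto simp: space_restrict_space)
  from measurable_compose[OF this m] show ?thesis by simp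
qed

lemma L2_proc_prog: "\<psi> \<in> L2_proc M B a b \<Longrightarrow> prog_measurable M B a b \<psi>"
  by (simp add: L2_proc_def)

lemma L2_proc_dominated:
  fixes \<psi>1 \<psi>2 \<psi> :: "real \<Rightarrow> 'w \<Rightarrow> 'b::euclidean_space"
  assumes 1: "\<psi>1 \<in> L2_proc M B a b" and 2: "\<psi>2 \<in> L2_proc M B a b" and ab: "a \<le> b"
    and p: "prog_measurable M B a b \<psi>"
    and le: "\<And>r w. r \<in> {a..b} \<Longrightarrow> (norm (\<psi> r w))\<^sup>2 \<le> (norm (\<psi>1 r w))\<^sup>2 + (norm (\<psi>2 r w))\<^sup>2"
  shows "\<psi> \<in> L2_proc M B a b"
proof -
  let ?n = "\<lambda>\<psi> r w. (norm (indicator {a..b} r *\<^sub>R \<psi> r w))\<^sup>2"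
  have m: "jointly_meas (on {a..b} \<theta>)" if "\<theta> \<in> L2_proc M B a b" for \<theta> :: "real \<Rightarrow> 'w \<Rightarrow> 'b"
    by (rule prog_jointly_meas[OF L2_proc_prog[OF that] ab]) auto
  have sw: "(\<lambda>p. (snd p, fst p)) \<in> measurable (M \<Otimes>\<^sub>M borel) ((borel :: real measure) \<Otimes>\<^sub>M M)" by measurable
  have m': "(\<lambda>p. indicator {a..b} (snd p) *\<^sub>R \<theta> (snd p) (fst p)) \<in> borel_measurable (M \<Otimes>\<^sub>M borel)"
    if "\<theta> \<in> L2_proc M B a b" for \<theta> :: "real \<Rightarrow> 'w \<Rightarrow> 'b"
    using measurable_compose[OF sw m[OF that, unfolded jointly_meas_def]] by simp
  note [measurable] = m'[OF 1] m'[OF 2]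
  have sl: "(\<lambda>r. indicator {a..b} r *\<^sub>R \<theta> r w) \<in> borel_measurable borel"
    if "\<theta> \<in> L2_proc M B a b" "w \<in> space M" for \<theta> :: "real \<Rightarrow> 'w \<Rightarrow> 'b" and w
    using measurable_compose[OF measurable_Pair1'[OF that(2)] m'[OF that(1)]] by simp
  have eq: "(\<integral>\<^sup>+ w. (\<integral>\<^sup>+ r\<in>{a..b}. ennreal ((norm (\<theta> r w))\<^sup>2) \<partial>lborel) \<partial>M) =
      (\<integral>\<^sup>+ w. (\<integral>\<^sup>+ r. ennreal (?n \<theta> r w) \<partial>lborel) \<partial>M)" for \<theta> :: "real \<Rightarrow> 'w \<Rightarrow> 'b"
    by (intro nn_integral_cong) (auto simp: indicator_def)
  have "(\<integral>\<^sup>+ w. (\<integral>\<^sup>+ r. ennreal (?n \<psi> r w) \<partial>lborel) \<partial>M) \<le>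
      (\<integral>\<^sup>+ w. (\<integral>\<^sup>+ r. ennreal (?n \<psi>1 r w) + ennreal (?n \<psi>2 r w) \<partial>lborel) \<partial>M)"
    using le by (intro nn_integral_mono) (auto simp: indicator_def ennreal_plus[symmetric] simp del: ennreal_plus)
  also have "\<dots> = (\<integral>\<^sup>+ w. (\<integral>\<^sup>+ r. ennreal (?n \<psi>1 r w) \<partial>lborel) + (\<integral>\<^sup>+ r. ennreal (?n \<psi>2 r w) \<partial>lborel) \<partial>M)"
  proof (intro nn_integral_cong nn_integral_add)
    fix w assume "w \<in> space M"
    note [measurable] = sl[OF 1 this] sl[OF 2 this]
    show "(\<lambda>r. ennreal (?n \<psi>1 r w)) \<in> borel_measurable lborel"
      "(\<lambda>r. ennreal (?n \<psi>2 r w)) \<in> borel_measurable lborel" by measurable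
  qed
  also have "\<dots> = (\<integral>\<^sup>+ w. (\<integral>\<^sup>+ r. ennreal (?n \<psi>1 r w) \<partial>lborel) \<partial>M) + (\<integral>\<^sup>+ w. (\<integral>\<^sup>+ r. ennreal (?n \<psi>2 r w) \<partial>lborel) \<partial>M)"
    by (intro nn_integral_add) measurable
  also have "\<dots> < \<infinity>" using 1 2 unfolding L2_proc_def mem_Collect_eq eq by simp
  finally show ?thesis using p unfolding L2_proc_def mem_Collect_eq eq by simp
qed

lemma L2_proc_energy:
  assumes Z: "Z \<in> L2_proc M B a b" and ab: "a \<le> b"
  shows "energy (on {a..b} Z) < \<infinity>"
proof -
  have "energy (on {a..b} Z) =
      (\<integral>\<^sup>+ w. (\<integral>\<^sup>+ r\<in>{a..b}. ennreal ((norm (Z r w))\<^sup>2) \<partial>lborel) \<partial>M)"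
    unfolding energy_swap[OF prog_jointly_meas[OF L2_proc_prog[OF Z] ab, of "{a..b}", simplified]]
    by (intro nn_integral_cong) (auto simp: indicator_def)
  then show ?thesis using Z by (simp add: L2_proc_def)
qed

lemma L2_proc_AE_L2_rv:
  assumes Z: "Z \<in> L2_proc M B a b" and ab: "a \<le> b"
  shows "AE s in lborel. s \<in> {a..b} \<longrightarrow> (Z s :: 'w \<Rightarrow> real^'d) \<in> L2_rv M B s"
proof -
  let ?W = "\<lambda>r w. indicator {a..b} r *\<^sub>R Z r w"
  have jm: "jointly_meas ?W" by (rule prog_jointly_meas[OF L2_proc_prog[OF Z] ab]) auto
  have "AE s in lborel. mean_sq (?W s) \<noteq> \<infinity>"
    using L2_proc_energy[OF Z ab] jointly_meas_nn[OF jm] unfolding energy_def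
    by (intro nn_integral_noteq_infinite) (simp_all del: norm_scaleR)
  then show ?thesis
    by eventually_elim (auto simp: L2_rv_def less_top intro: prog_slice[OF L2_proc_prog[OF Z]])
qed

text \<open>
  For \<open>A\<close> the conditional expectation and \<open>A\<^sub>n = min A n\<close>, the defining property gives
  \<open>2 E (A\<^sub>n A) = 2 E (A\<^sub>n X) \<le> E A\<^sub>n\<^sup>2 + E X\<^sup>2 \<le> E (A\<^sub>n A) + E X\<^sup>2\<close>. The truncation makes \<open>E (A\<^sub>n A)\<close> finite,
  so that it can be cancelled.
\<close>

lemma nn_cond_exp_square_le:
  assumes X[measurable]: "X \<in> borel_measurable M"
  shows "(\<integral>\<^sup>+w. (nn_cond_exp M (F t) X w)\<^sup>2 \<partial>M) \<le> (\<integral>\<^sup>+w. (X w)\<^sup>2 \<partial>M)"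
proof (cases "(\<integral>\<^sup>+w. (X w)\<^sup>2 \<partial>M) = \<infinity>")
  case False
  interpret S: sigma_finite_subalgebra M "F t" by (rule sigma_finite_F)
  let ?A = "nn_cond_exp M (F t) X"
  have AF[measurable]: "?A \<in> borel_measurable (F t)" by simp
  have [measurable]: "?A \<in> borel_measurable M" by simp
  have X1: "(\<integral>\<^sup>+w. X w \<partial>M) < \<infinity>"
  proof -
    have "(\<integral>\<^sup>+w. X w \<partial>M) \<le> (\<integral>\<^sup>+w. 1 + (X w)\<^sup>2 \<partial>M)"
    proof (rule nn_integral_mono)
      fix w
      show "X w \<le> 1 + (X w)\<^sup>2"
      proof (cases "X w \<le> 1")
        case False
        then have "X w * 1 \<le> X w * X w" by (intro mult_left_mono) auto
        also have "\<dots> \<le> 1 + (X w)\<^sup>2" by (simp add: power2_eq_square)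
        finally show ?thesis by simp
      qed (auto intro: add_increasing2)
    qed
    also have "\<dots> = 1 + (\<integral>\<^sup>+w. (X w)\<^sup>2 \<partial>M)" by (simp add: nn_integral_add emeasure_space_1)
    also have "\<dots> < \<infinity>" using False by (simp add: less_top)
    finally show ?thesis .
  qed
  have A1: "(\<integral>\<^sup>+w. ?A w \<partial>M) < \<infinity>"
    using S.nn_cond_exp_intg[of "\<lambda>_. 1" X] X1 by simp
  have trunc: "(\<integral>\<^sup>+w. min (?A w) (of_nat n) * ?A w \<partial>M) \<le> (\<integral>\<^sup>+w. (X w)\<^sup>2 \<partial>M)" for n :: nat
  proof -
    let ?m = "\<lambda>w. min (?A w) (of_nat n)"
    let ?E = "\<integral>\<^sup>+w. ?m w * ?A w \<partial>M"
    have "?E \<le> (\<integral>\<^sup>+w. of_nat n * ?A w \<partial>M)" by (intro nn_integral_mono mult_right_mono) auto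
    also have "\<dots> < \<infinity>" using A1 by (simp add: nn_integral_cmult ennreal_mult_less_top of_nat_less_top)
    finally have fin: "?E < \<infinity>" .
    have "(\<lambda>w. ?m w) \<in> borel_measurable (F t)" by measurable
    then have E: "?E = (\<integral>\<^sup>+w. ?m w * X w \<partial>M)" by (rule S.nn_cond_exp_intg) simp
    have "?E + ?E = 2 * (\<integral>\<^sup>+w. ?m w * X w \<partial>M)" unfolding E by (simp add: mult_2)
    also have "\<dots> = (\<integral>\<^sup>+w. 2 * (?m w * X w) \<partial>M)" by (simp add: nn_integral_cmult)
    also have "\<dots> \<le> (\<integral>\<^sup>+w. (?m w)\<^sup>2 + (X w)\<^sup>2 \<partial>M)" by (intro nn_integral_mono ennreal_young)
    also have "\<dots> = (\<integral>\<^sup>+w. (?m w)\<^sup>2 \<partial>M) + (\<integral>\<^sup>+w. (X w)\<^sup>2 \<partial>M)" by (simp add: nn_integral_add)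
    also have "\<dots> \<le> ?E + (\<integral>\<^sup>+w. (X w)\<^sup>2 \<partial>M)"
      by (intro add_right_mono nn_integral_mono) (auto simp: power2_eq_square intro!: mult_left_mono)
    finally show ?thesis using fin by (simp add: ennreal_add_left_cancel_le less_top[symmetric])
  qed
  have "(\<integral>\<^sup>+w. (?A w)\<^sup>2 \<partial>M) = (\<integral>\<^sup>+w. (SUP n::nat. min (?A w) (of_nat n) * ?A w) \<partial>M)"
  proof (rule nn_integral_cong)
    fix w
    have "(SUP n::nat. min (?A w) (of_nat n)) = ?A w"
    proof (rule antisym)
      show "(SUP n::nat. min (?A w) (of_nat n)) \<le> ?A w" by (intro SUP_least) auto
      show "?A w \<le> (SUP n::nat. min (?A w) (of_nat n))"
        by (simp add: inf_min[symmetric] inf_SUP[symmetric] ennreal_SUP_of_nat_eq_top)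
    qed
    then have "(?A w)\<^sup>2 = (SUP n::nat. min (?A w) (of_nat n)) * ?A w"
      by (simp only: power2_eq_square)
    also have "\<dots> = (SUP n::nat. min (?A w) (of_nat n) * ?A w)"
      by (rule SUP_mult_right_ennreal)
    finally show "(?A w)\<^sup>2 = (SUP n::nat. min (?A w) (of_nat n) * ?A w)" .
  qed
  also have "\<dots> = (SUP n::nat. \<integral>\<^sup>+w. min (?A w) (of_nat n) * ?A w \<partial>M)"
    by (intro nn_integral_monotone_convergence_SUP)
       (auto simp: incseq_def le_fun_def intro!: mult_right_mono min.mono)
  also have "\<dots> \<le> (\<integral>\<^sup>+w. (X w)\<^sup>2 \<partial>M)" by (intro SUP_least trunc)
  finally show ?thesis .
qed simp

text \<open>
  The process with which the monotonicity of the generator is exploited. On \<open>[-l, 0)\<close> it agrees with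
  \<open>Y\<close>, so only the single time \<open>0\<close> matters for being deterministic there.
\<close>

lemma L2_bar_max:
  assumes Y: "Y \<in> L2_bar M B l (T + u)" and Y': "Y' \<in> L2_bar M B l (T + u)"
    and pos: "0 \<le> l" "0 \<le> u" "0 < T"
  shows "(\<lambda>r w. if 0 \<le> r \<and> r \<le> T then max (Y r w) (Y' r w) else Y r w :: real) \<in> L2_bar M B l (T + u)" (is "?y \<in> _")
proof -
  obtain f where f: "f \<in> borel_measurable (lebesgue_on {-l..0})"
      "(\<integral>\<^sup>+ r\<in>{-l..0}. ennreal ((norm (f r))\<^sup>2) \<partial>lebesgue) < \<infinity>"
      "AE w in M. \<forall>r\<in>{-l..0}. Y r w = f r"
    using Y unfolding L2_bar_def by blast
  obtain f' where f': "f' \<in> borel_measurable (lebesgue_on {-l..0})"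
      "AE w in M. \<forall>r\<in>{-l..0}. Y' r w = f' r"
    using Y' unfolding L2_bar_def by blast
  let ?f = "\<lambda>r. if r < 0 then f r else max (f r) (f' r)"
  have YL: "Y \<in> L2_proc M B 0 (T + u)" "Y' \<in> L2_proc M B 0 (T + u)"
    using Y Y' by (auto simp: L2_bar_def)
  have pm: "prog_measurable M B 0 (T + u) ?y"
    unfolding prog_measurable_def
  proof
    fix t assume t: "t \<in> {0..T + u}"
    let ?S = "restrict_space borel {0..t} \<Otimes>\<^sub>M F t"
    have [measurable]: "(\<lambda>p. Y (fst p) (snd p)) \<in> borel_measurable ?S" "(\<lambda>p. Y' (fst p) (snd p)) \<in> borel_measurable ?S"
      using YL t unfolding L2_proc_def prog_measurable_def case_prod_beta by blast+
    have "(\<lambda>r. r) \<in> borel_measurable (restrict_space borel {0..t})" by (intro measurable_restrict_space1) simp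
    from measurable_compose[OF measurable_fst[of "restrict_space borel {0..t}" "F t"] this]
    have [measurable]: "fst \<in> borel_measurable ?S" by simp
    have "(\<lambda>p. if 0 \<le> fst p \<and> fst p \<le> T then max (Y (fst p) (snd p)) (Y' (fst p) (snd p)) else Y (fst p) (snd p))
        \<in> borel_measurable ?S" by measurable
    then show "(\<lambda>(r, w). ?y r w) \<in> borel_measurable ?S" by (simp add: case_prod_beta)
  qed
  have le: "(norm (?y r w))\<^sup>2 \<le> (norm (Y r w))\<^sup>2 + (norm (Y' r w))\<^sup>2" for r w
    by (auto simp: max_def)
  have "?y \<in> L2_proc M B 0 (T + u)"
    using pos by (intro L2_proc_dominated[OF YL _ pm le]) simp
  moreover have "?f \<in> borel_measurable (lebesgue_on {-l..0})"
  proof -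
    have "(\<lambda>r::real. r) \<in> borel_measurable (lebesgue_on {-l..0})"
      by (intro measurable_restrict_space1 measurable_completion) simp
    note [measurable] = this f(1) f'(1)
    show ?thesis by measurable
  qed
  moreover have "(\<integral>\<^sup>+ r\<in>{-l..0}. ennreal ((norm (?f r))\<^sup>2) \<partial>lebesgue) < \<infinity>"
  proof -
    have "AE r in lebesgue. r \<noteq> (0::real)" by (intro AE_completion AE_lborel_singleton)
    then have "(\<integral>\<^sup>+ r\<in>{-l..0}. ennreal ((norm (?f r))\<^sup>2) \<partial>lebesgue) = (\<integral>\<^sup>+ r\<in>{-l..0}. ennreal ((norm (f r))\<^sup>2) \<partial>lebesgue)"
      by (intro nn_integral_cong_AE, elim eventually_mono) (auto simp: indicator_def)
    with f(2) show ?thesis by simp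
  qed
  moreover have "AE w in M. \<forall>r\<in>{-l..0}. ?y r w = ?f r"
    using f(3) f'(2) by eventually_elim (use pos in auto)
  ultimately show ?thesis unfolding L2_bar_def by blast
qed

section \<open>Comparison of two solutions\<close>

text \<open>
  At \<open>T\<close>, where the integral equation is not prescribed, the terminal condition takes its place and
  the stochastic integral is \<open>0\<close>.
\<close>

lemma solution_equation:
  assumes T: "0 < T" and u: "0 \<le> u" and sol: "bsde_solution M B l T u g \<xi> \<eta> Y Z"
  shows "\<exists>I. \<forall>t\<in>{0..T}. ito t (on {t<..T} Z) (I t) \<and>
    (AE w in M. set_integrable lborel {t..T} (\<lambda>s. g s Y (Z s) w) \<and>
      Y t w = \<xi> T w + (LINT s:{t..T}|lborel. g s Y (Z s) w) - I t w)"
proof (rule bchoice, rule ballI)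
  fix t assume t: "t \<in> {0..T}"
  show "\<exists>I. ito t (on {t<..T} Z) I \<and>
    (AE w in M. set_integrable lborel {t..T} (\<lambda>s. g s Y (Z s) w) \<and>
      Y t w = \<xi> T w + (LINT s:{t..T}|lborel. g s Y (Z s) w) - I w)"
  proof (cases "t < T")
    case True
    then obtain I where I: "has_ito_integral M B t T Z I"
      and eq: "AE w in M. set_integrable lborel {t..T} (\<lambda>s. g s Y (Z s) w) \<and>
        Y t w = \<xi> T w + (LINT s:{t..T}|lborel. g s Y (Z s) w) - I w"
      using sol t unfolding bsde_solution_def by fastforce
    show ?thesis using has_ito_integral_ito(1)[OF I] t eq by auto
  next
    case False
    then have [simp]: "t = T" using t by simp
    have "set_integrable lborel {T..T} h \<and> (LINT s:{T..T}|lborel. h s) = 0" for h :: "real \<Rightarrow> real"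
    proof -
      have "(\<lambda>s. indicat_real {T..T} s *\<^sub>R h s) = (\<lambda>s. indicator {T} s *\<^sub>R h T)"
        by (auto simp: indicator_def fun_eq_iff)
      then show ?thesis unfolding set_integrable_def set_lebesgue_integral_def by simp
    qed
    moreover have "AE w in M. Y T w = \<xi> T w"
      using sol u unfolding bsde_solution_def by (auto dest!: bspec[of "{T..T+u}" _ T] elim: eventually_mono)
    moreover have "on {t<..T} Z = (\<lambda>_ _. 0)" by (auto simp: fun_eq_iff)
    ultimately show ?thesis
      using ito_elem[OF elem.zero, of T] T by (intro exI[of _ "\<lambda>_. 0"]) auto
  qed
qed

lemma solution_approx:
  assumes sol: "bsde_solution M B l T u g \<xi> \<eta> Y Z" and a: "0 \<le> a" "a < T" and \<epsilon>: "0 < \<epsilon>"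
  shows "\<exists>P \<sigma>. step_process a T P \<sigma> \<and> energy (\<lambda>r w. on {a<..T} Z r w - \<sigma> r w) < ennreal \<epsilon>"
proof -
  obtain I where I: "has_ito_integral M B a T Z I"
    using sol a unfolding bsde_solution_def by fastforce
  obtain n \<tau> H where S: "\<And>m::nat. simple_integrand M B a T (n m) (\<tau> m) (H m)"
    and c: "(\<lambda>m. energy (\<lambda>r w. on {a<..T} Z r w - simple_value (n m) (\<tau> m) (H m) r w)) \<longlonglongrightarrow> 0"
    using has_ito_integral_ito(2)[OF I a(1) less_imp_le[OF a(2)]] by blast
  have "eventually (\<lambda>m. energy (\<lambda>r w. on {a<..T} Z r w - simple_value (n m) (\<tau> m) (H m) r w) < ennreal \<epsilon>) sequentially"
    by (rule order_tendstoD(2)[OF c]) (use \<epsilon> in simp)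
  then obtain m where "energy (\<lambda>r w. on {a<..T} Z r w - simple_value (n m) (\<tau> m) (H m) r w) < ennreal \<epsilon>"
    using eventually_happens'[OF sequentially_bot] by blast
  with simple_step_process[OF S] show ?thesis by blast
qed

text \<open>
  The equations at two times \<open>p < q\<close> are subtracted, which removes the terminal value; bounding the
  drift by its positive part leaves an inequality.
\<close>

lemma solution_differences:
  assumes T: "0 < T" and u: "0 \<le> u"
    and s: "bsde_solution M B l T u g \<xi> \<eta> Y Z" and s': "bsde_solution M B l T u g' \<xi>' \<eta>' Y' Z'"
  defines "f \<equiv> \<lambda>s w. g' s Y' (Z' s) w - g s Y (Z s) w"
    and "\<zeta> \<equiv> on {0..T} (\<lambda>r w. Z' r w - Z r w)"
  shows "\<exists>J. (\<forall>t\<in>{0..T}. ito t (on {t<..T} \<zeta>) (J t)) \<and>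
      (\<forall>p q. 0 \<le> p \<longrightarrow> p < q \<longrightarrow> q \<le> T \<longrightarrow> (AE w in M. (Y' p w - Y p w) + (J p w - J q w) -
        (LINT s:{p<..q}|lborel. indicator {0..T} s * max 0 (f s w)) \<le> Y' q w - Y q w))" (is ?eq)
    and "0 \<le> a \<Longrightarrow> a < T \<Longrightarrow> 0 < \<epsilon> \<Longrightarrow> \<exists>P \<sigma>. step_process a T P \<sigma> \<and>
       energy (\<lambda>r w. on {a<..T} \<zeta> r w - \<sigma> r w) \<le> ennreal \<epsilon>" (is "_ \<Longrightarrow> _ \<Longrightarrow> _ \<Longrightarrow> ?approx")
proof -
  have \<zeta>eq: "on {t<..T} \<zeta> = (\<lambda>r w. on {t<..T} Z' r w - on {t<..T} Z r w)" if "0 \<le> t" for t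
    using that unfolding \<zeta>_def by (auto simp: fun_eq_iff indicator_def)
  from solution_equation[OF T u s] obtain I where
    I: "\<forall>t\<in>{0..T}. ito t (on {t<..T} Z) (I t) \<and>
      (AE w in M. set_integrable lborel {t..T} (\<lambda>s. g s Y (Z s) w) \<and>
        Y t w = \<xi> T w + (LINT s:{t..T}|lborel. g s Y (Z s) w) - I t w)" ..
  from solution_equation[OF T u s'] obtain I' where
    I': "\<forall>t\<in>{0..T}. ito t (on {t<..T} Z') (I' t) \<and>
      (AE w in M. set_integrable lborel {t..T} (\<lambda>s. g' s Y' (Z' s) w) \<and>
        Y' t w = \<xi>' T w + (LINT s:{t..T}|lborel. g' s Y' (Z' s) w) - I' t w)" ..
  define J where "J = (\<lambda>t w. I' t w - I t w)"
  have D: "AE w in M. set_integrable lborel {t..T} (\<lambda>s. f s w) \<and>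
     Y' t w - Y t w = (\<xi>' T w - \<xi> T w) + (LINT s:{t..T}|lborel. f s w) - J t w"
    if t: "t \<in> {0..T}" for t
    using I[rule_format, OF t, THEN conjunct2] I'[rule_format, OF t, THEN conjunct2]
  proof eventually_elim
    case (elim w)
    then have "set_integrable lborel {t..T} (\<lambda>s. f s w)"
      and "(LINT s:{t..T}|lborel. f s w) =
        (LINT s:{t..T}|lborel. g' s Y' (Z' s) w) - (LINT s:{t..T}|lborel. g s Y (Z s) w)"
      unfolding f_def by (auto intro: set_integral_diff)
    with elim show ?case by (simp add: J_def)
  qed
  have "ito t (on {t<..T} \<zeta>) (J t)" if t: "t \<in> {0..T}" for t
  proof -
    have "0 \<le> t" using t by simp
    then show ?thesis
      unfolding \<zeta>eq[OF \<open>0 \<le> t\<close>] J_def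
      by (intro ito_diff I[rule_format, OF t, THEN conjunct1] I'[rule_format, OF t, THEN conjunct1])
  qed
  moreover have "AE w in M. (Y' p w - Y p w) + (J p w - J q w) -
        (LINT s:{p<..q}|lborel. indicator {0..T} s * max 0 (f s w)) \<le> Y' q w - Y q w"
    if pq: "0 \<le> p" "p < q" "q \<le> T" for p q
  proof -
    have "p \<in> {0..T}" "q \<in> {0..T}" using pq by auto
    from D[OF this(1)] D[OF this(2)] show ?thesis
    proof eventually_elim
      case (elim w)
      have fi: "set_integrable lborel A (\<lambda>s. f s w)" if "A \<subseteq> {p..T}" "A \<in> sets borel" for A
        using elim that by (auto intro: set_integrable_subset)
      have "(LINT s:{p..T}|lborel. f s w) = (LINT s:({p..<q} \<union> {q..T})|lborel. f s w)"
        using pq by (intro arg_cong[where f="\<lambda>A. LINT s:A|lborel. f s w"]) auto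
      also have "\<dots> = (LINT s:{p..<q}|lborel. f s w) + (LINT s:{q..T}|lborel. f s w)"
        using pq by (intro set_integral_Un fi) auto
      finally have split: "(LINT s:{p..T}|lborel. f s w) = \<dots>" .
      have "(LINT s:{p..<q}|lborel. f s w) \<le> (LINT s:{p<..q}|lborel. indicator {0..T} s * max 0 (f s w))"
        unfolding set_lebesgue_integral_def
      proof (rule integral_mono_AE)
        show "integrable lborel (\<lambda>s. indicat_real {p..<q} s *\<^sub>R f s w)"
        proof -
          have "{p..<q} \<subseteq> {p..T}" using pq by auto
          from fi[OF this] show ?thesis by (simp add: set_integrable_def)
        qed
        have "integrable lborel (\<lambda>s. max 0 (indicat_real {p<..q} s *\<^sub>R f s w))"
        proof -
          have "{p<..q} \<subseteq> {p..T}" using pq by auto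
          from fi[OF this] show ?thesis by (intro integrable_max) (simp_all add: set_integrable_def)
        qed
        also have "(\<lambda>s. max 0 (indicat_real {p<..q} s *\<^sub>R f s w)) =
            (\<lambda>s. indicat_real {p<..q} s *\<^sub>R (indicat_real {0..T} s * max 0 (f s w)))"
          using pq by (auto simp: indicator_def fun_eq_iff)
        finally show "integrable lborel \<dots>" .
        \<comment> \<open>The intervals \<open>{p..<q}\<close> and \<open>{p<..q}\<close> differ by end points only.\<close>
        have "AE s in lborel. s \<noteq> p" by (rule AE_lborel_singleton)
        then show "AE s in lborel. indicat_real {p..<q} s *\<^sub>R f s w \<le>
            indicat_real {p<..q} s *\<^sub>R (indicat_real {0..T} s * max 0 (f s w))"
          by eventually_elim (use pq in \<open>auto simp: indicator_def\<close>)
      qed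
      with elim split show ?case by simp
    qed
  qed
  ultimately show ?eq by blast
  assume a: "0 \<le> a" "a < T" and \<epsilon>: "0 < \<epsilon>"
  then have \<epsilon>4: "0 < \<epsilon> / 4" by simp
  obtain P \<sigma> where \<sigma>: "step_process a T P \<sigma>" "energy (\<lambda>r w. on {a<..T} Z r w - \<sigma> r w) < ennreal (\<epsilon> / 4)"
    using solution_approx[OF s a \<epsilon>4] by blast
  obtain P' \<sigma>' where \<sigma>': "step_process a T P' \<sigma>'" "energy (\<lambda>r w. on {a<..T} Z' r w - \<sigma>' r w) < ennreal (\<epsilon> / 4)"
    using solution_approx[OF s' a \<epsilon>4] by blast
  have "a \<in> {0..T}" using a by simp
  then have jm: "jointly_meas (on {a<..T} Z)" "jointly_meas (on {a<..T} Z')" "jointly_meas \<sigma>" "jointly_meas \<sigma>'"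
    using I I' \<sigma>(1) \<sigma>'(1) by (auto simp: ito_def step_process_def)
  have "(\<lambda>r w. on {a<..T} \<zeta> r w - (\<sigma>' r w - \<sigma> r w)) =
      (\<lambda>r w. (on {a<..T} Z' r w - \<sigma>' r w) - (on {a<..T} Z r w - \<sigma> r w))"
    using \<zeta>eq[OF a(1)] by (simp add: fun_eq_iff algebra_simps)
  then have "energy (\<lambda>r w. on {a<..T} \<zeta> r w - (\<sigma>' r w - \<sigma> r w)) \<le>
      2 * energy (\<lambda>r w. on {a<..T} Z' r w - \<sigma>' r w) + 2 * energy (\<lambda>r w. on {a<..T} Z r w - \<sigma> r w)"
    using energy_diff_le[OF jointly_meas_diff[OF jm(2,4)] jointly_meas_diff[OF jm(1,3)]] by simp
  also have "\<dots> \<le> 2 * ennreal (\<epsilon> / 4) + 2 * ennreal (\<epsilon> / 4)"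
    using \<sigma>(2) \<sigma>'(2) by (intro add_mono mult_left_mono less_imp_le) auto
  also have "\<dots> = ennreal \<epsilon>"
    using \<epsilon> by (simp add: ennreal_mult[symmetric] ennreal_plus[symmetric] del: ennreal_plus flip: ennreal_numeral)
  finally show ?approx using step_process_diff[OF \<sigma>'(1) \<sigma>(1)] by blast
qed

lemma second_moment_sup_finite:
  assumes "Y \<in> S2_proc M B 0 T"
  obtains C where "0 \<le> C" "\<And>t. t \<in> {0..T} \<Longrightarrow> (\<integral>\<^sup>+w. ennreal ((Y t w :: real)\<^sup>2) \<partial>M) \<le> ennreal C"
proof -
  let ?S = "\<integral>\<^sup>+ w. (SUP r\<in>{0..T}. ennreal ((norm (Y r w))\<^sup>2)) \<partial>M"
  have "?S < \<infinity>" using assms by (simp add: S2_proc_def)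
  then obtain C where C: "?S = ennreal C" "0 \<le> C" by (cases ?S) auto
  have "(\<integral>\<^sup>+w. ennreal ((Y t w)\<^sup>2) \<partial>M) \<le> ?S" if "t \<in> {0..T}" for t
  proof (rule nn_integral_mono)
    fix w
    show "ennreal ((Y t w)\<^sup>2) \<le> (SUP r\<in>{0..T}. ennreal ((norm (Y r w))\<^sup>2))"
      by (rule SUP_upper2[OF that]) simp
  qed
  then show ?thesis using that[of C] C by simp
qed

text \<open>
  Jensen's inequality for \<open>\<mu>\<close> and Fubini. A shift by \<open>r \<ge> - l\<close> changes the weight \<open>exp (- \<beta> s)\<close> by at
  most the factor \<open>exp (\<beta> l)\<close>: this is where the length of the delay enters.
\<close>

lemma averaged_square_le:
  fixes \<delta> :: "real \<Rightarrow> 'w \<Rightarrow> real"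
  assumes \<delta>: "jointly_meas \<delta>" "\<And>r w. 0 \<le> \<delta> r w"
    and \<mu>: "prob_measure_on (-l) u \<mu>" and pos: "0 < \<beta>" "0 \<le> N"
    and bound: "\<And>r. (\<integral>\<^sup>+w. ennreal ((\<delta> r w)\<^sup>2) \<partial>M) \<le> ennreal (N * exp (- \<beta> * r))"
  shows "(\<lambda>w. \<integral>\<^sup>+r. ennreal (\<delta> (s + r) w) \<partial>\<mu>) \<in> borel_measurable M"
    and "(\<integral>\<^sup>+w. (\<integral>\<^sup>+r. ennreal (\<delta> (s + r) w) \<partial>\<mu>)\<^sup>2 \<partial>M) \<le> ennreal (exp (\<beta> * l) * (N * exp (- \<beta> * s)))"
    and "w \<in> space M \<Longrightarrow> (\<lambda>r. \<delta> (s + r) w) \<in> borel_measurable \<mu>"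
proof -
  interpret \<mu>: prob_space \<mu> using \<mu> by (simp add: prob_measure_on_def)
  have sets: "sets \<mu> = sets (restrict_space borel {-l..u})" using \<mu> by (simp add: prob_measure_on_def)
  have space: "space \<mu> = {-l..u}" using sets_eq_imp_space_eq[OF sets] by (simp add: space_restrict_space)
  have "(\<lambda>r. r) \<in> borel_measurable (restrict_space borel {-l..u})"
    by (intro measurable_restrict_space1) simp
  then have id[measurable]: "(\<lambda>r. r) \<in> borel_measurable \<mu>" by (simp add: measurable_cong_sets[OF sets refl])
  have D: "(\<lambda>p. \<delta> (fst p) (snd p)) \<in> borel_measurable (borel \<Otimes>\<^sub>M M)" using \<delta> by (simp add: jointly_meas_def)
  have "snd \<in> borel_measurable (M \<Otimes>\<^sub>M \<mu>)" using measurable_compose[OF measurable_snd[of M \<mu>] id] by simp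
  then have "(\<lambda>p. (s + snd p, fst p)) \<in> measurable (M \<Otimes>\<^sub>M \<mu>) (borel \<Otimes>\<^sub>M M)" by measurable
  from measurable_compose[OF this D]
  have [measurable]: "(\<lambda>p. \<delta> (s + snd p) (fst p)) \<in> borel_measurable (M \<Otimes>\<^sub>M \<mu>)" by simp
  have "fst \<in> borel_measurable (\<mu> \<Otimes>\<^sub>M M)" using measurable_compose[OF measurable_fst[of \<mu> M] id] by simp
  then have "(\<lambda>p. (s + fst p, snd p)) \<in> measurable (\<mu> \<Otimes>\<^sub>M M) (borel \<Otimes>\<^sub>M M)" by measurable
  from measurable_compose[OF this D]
  have [measurable]: "(\<lambda>p. \<delta> (s + fst p) (snd p)) \<in> borel_measurable (\<mu> \<Otimes>\<^sub>M M)" by simp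
  show "(\<lambda>w. \<integral>\<^sup>+r. ennreal (\<delta> (s + r) w) \<partial>\<mu>) \<in> borel_measurable M" by measurable
  show sec: "(\<lambda>r. \<delta> (s + r) w) \<in> borel_measurable \<mu>" if "w \<in> space M" for w
  proof -
    have "(\<lambda>r. (s + r, w)) \<in> measurable \<mu> (borel \<Otimes>\<^sub>M M)" using that by measurable
    from measurable_compose[OF this D] show ?thesis by simp
  qed
  interpret P: pair_sigma_finite \<mu> M ..
  have "(\<integral>\<^sup>+w. (\<integral>\<^sup>+r. ennreal (\<delta> (s + r) w) \<partial>\<mu>)\<^sup>2 \<partial>M) \<le> (\<integral>\<^sup>+w. (\<integral>\<^sup>+r. ennreal ((\<delta> (s + r) w)\<^sup>2) \<partial>\<mu>) \<partial>M)"
  proof (rule nn_integral_mono)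
    fix w assume "w \<in> space M"
    note [measurable] = sec[OF this]
    have "(\<integral>\<^sup>+r. ennreal (\<delta> (s + r) w) * 1 \<partial>\<mu>)\<^sup>2 \<le> (\<integral>\<^sup>+r. (ennreal (\<delta> (s + r) w))\<^sup>2 \<partial>\<mu>) * (\<integral>\<^sup>+r. 1\<^sup>2 \<partial>\<mu>)"
      by (rule Cauchy_Schwarz_nn_integral) auto
    then show "(\<integral>\<^sup>+r. ennreal (\<delta> (s + r) w) \<partial>\<mu>)\<^sup>2 \<le> (\<integral>\<^sup>+r. ennreal ((\<delta> (s + r) w)\<^sup>2) \<partial>\<mu>)"
      using \<delta>(2) by (simp add: ennreal_power \<mu>.emeasure_space_1)
  qed
  also have "\<dots> = (\<integral>\<^sup>+r. (\<integral>\<^sup>+w. ennreal ((\<delta> (s + r) w)\<^sup>2) \<partial>M) \<partial>\<mu>)"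
    using P.Fubini[of "\<lambda>p. ennreal ((\<delta> (s + fst p) (snd p))\<^sup>2)"] by simp
  also have "\<dots> \<le> (\<integral>\<^sup>+r. ennreal (exp (\<beta> * l) * (N * exp (- \<beta> * s))) \<partial>\<mu>)"
  proof (rule nn_integral_mono)
    fix r assume "r \<in> space \<mu>"
    then have r: "- l \<le> r" using space by simp
    have "- \<beta> * (s + r) \<le> \<beta> * l + - \<beta> * s" using pos r mult_left_mono[OF r, of \<beta>] by (simp add: algebra_simps)
    then have "exp (- \<beta> * (s + r)) \<le> exp (\<beta> * l) * exp (- \<beta> * s)" unfolding exp_add[symmetric] by simp
    then have "N * exp (- \<beta> * (s + r)) \<le> exp (\<beta> * l) * (N * exp (- \<beta> * s))"
      using mult_left_mono[OF _ pos(2)] by (fastforce simp: mult.left_commute)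
    with bound[of "s + r"] show "(\<integral>\<^sup>+w. ennreal ((\<delta> (s + r) w)\<^sup>2) \<partial>M) \<le> ennreal (exp (\<beta> * l) * (N * exp (- \<beta> * s)))"
      by (meson ennreal_leI order_trans)
  qed
  also have "\<dots> = ennreal (exp (\<beta> * l) * (N * exp (- \<beta> * s)))" by (simp add: \<mu>.emeasure_space_1)
  finally show "(\<integral>\<^sup>+w. (\<integral>\<^sup>+r. ennreal (\<delta> (s + r) w) \<partial>\<mu>)\<^sup>2 \<partial>M) \<le> ennreal (exp (\<beta> * l) * (N * exp (- \<beta> * s)))" .
qed

text \<open>
  The weighted supremum \<open>N\<close> of \<open>E (D\<^sub>t\<^sup>+)\<^sup>2\<close> is finite because both solutions have square integrable
  suprema, and \<open>backward_inequality\<close> bounds it by \<open>\<theta> N\<close> with \<open>\<theta> < 1\<close>. So it is \<open>0\<close>, which settles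
  \<open>[0, T]\<close>; before \<open>0\<close> both solutions are frozen at their values at \<open>0\<close>, and from \<open>T\<close> on they are
  prescribed.
\<close>

lemma comparison:
  fixes T u l K \<beta> :: real and g g' :: "('w, 'd) generator"
  assumes T: "0 < T" and u: "0 \<le> u" and l: "0 \<le> l" and K: "0 < K" and \<beta>: "0 < \<beta>"
    and small: "K + 2 * K\<^sup>2 + K * exp (\<beta> * l) < \<beta>"
    and pg: "prog_generator M B l T u g" "prog_generator M B l T u g'"
    and \<mu>: "prob_measure_on (-l) u \<mu>" and lip: "lipschitz_generator M B l T u K \<mu> g'"
    and \<xi>: "\<And>t. t \<in> {T..T + u} \<Longrightarrow> AE w in M. \<xi> t w \<ge> \<xi>' t w"
    and gg: "\<And>t y z. t \<in> {0..T} \<Longrightarrow> y \<in> L2_bar M B l (T + u) \<Longrightarrow> z \<in> L2_bar M B l (T + u) \<Longrightarrow>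
        AE w in M. g t y (z t) w \<ge> g' t y (z t) w"
    and mono: "\<And>t z y y'. t \<in> {0..T} \<Longrightarrow> z \<in> L2_bar M B l (T + u) \<Longrightarrow> y \<in> L2_bar M B l (T + u) \<Longrightarrow>
        y' \<in> L2_bar M B l (T + u) \<Longrightarrow> (\<forall>r\<in>{0..T}. AE w in M. y r w \<ge> y' r w) \<Longrightarrow>
        AE w in M. g' t y (z t) w \<ge> g' t y' (z t) w"
    and s: "bsde_solution M B l T u g \<xi> \<eta> Y Z" and s': "bsde_solution M B l T u g' \<xi>' \<eta>' Y' Z'"
    and t: "t \<in> {-l..T + u}"
  shows "AE w in M. Y t w \<ge> Y' t w"
proof -
  have YS: "Y \<in> S2_proc M B 0 T" "Y' \<in> S2_proc M B 0 T" and YL: "Y \<in> L2_proc M B 0 T" "Y' \<in> L2_proc M B 0 T"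
    and ZL: "Z \<in> L2_proc M B 0 T" "Z' \<in> L2_proc M B 0 T"
    and Yb: "Y \<in> L2_bar M B l (T + u)" "Y' \<in> L2_bar M B l (T + u)"
    and Zb: "Z \<in> L2_bar M B l (T + u)" "Z' \<in> L2_bar M B l (T + u)"
    using s s' by (auto simp: bsde_solution_def S2_proc_def)
  have final: "AE w in M. Y t w = \<xi> t w" "AE w in M. Y' t w = \<xi>' t w" if "t \<in> {T..T + u}" for t
    using s s' that unfolding bsde_solution_def by (auto elim: eventually_mono)
  have late: "AE w in M. Y t w \<ge> Y' t w" if "t \<in> {T..T + u}" for t
    using \<xi>[OF that] final[OF that] by eventually_elim simp
  define D where "D = (\<lambda>t w. Y' t w - Y t w)"
  define f where "f = (\<lambda>s w. g' s Y' (Z' s) w - g s Y (Z s) w)"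
  define \<zeta> where "\<zeta> = (\<lambda>r w. indicator {0..T} r *\<^sub>R (Z' r w - Z r w))"
  define \<phi> where "\<phi> = (\<lambda>s w. indicator {0..T} s * max 0 (f s w))"
  define \<delta> where "\<delta> = (\<lambda>s w. indicator {0..T} s * max 0 (D s w))"
  define y where "y = (\<lambda>r w. if 0 \<le> r \<and> r \<le> T then max (Y r w) (Y' r w) else Y r w)"
  define V where "V = (\<lambda>t. pos_sq (D t))"
  have yb: "y \<in> L2_bar M B l (T + u)" unfolding y_def by (rule L2_bar_max[OF Yb l u T])
  have jm: "jointly_meas (on {0..T} \<psi>)" if "prog_measurable M B 0 T \<psi>"
    for \<psi> :: "real \<Rightarrow> 'w \<Rightarrow> 'b::euclidean_space"
    using T by (intro prog_jointly_meas[OF that]) auto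
  have \<zeta>m: "jointly_meas \<zeta>"
    using jointly_meas_diff[OF jm[OF L2_proc_prog[OF ZL(2)]] jm[OF L2_proc_prog[OF ZL(1)]]]
    unfolding \<zeta>_def by (simp add: scaleR_diff_right)
  have posm: "jointly_meas (\<lambda>r w. indicator {0..T} r * max 0 (\<psi>' r w - \<psi> r w))"
    if "prog_measurable M B 0 T \<psi>" "prog_measurable M B 0 T \<psi>'" for \<psi> \<psi>' :: "real \<Rightarrow> 'w \<Rightarrow> real"
  proof -
    have "jointly_meas (\<lambda>r w. max 0 (indicator {0..T} r *\<^sub>R \<psi>' r w - indicator {0..T} r *\<^sub>R \<psi> r w))"
      using jm[OF that(1)] jm[OF that(2)] unfolding jointly_meas_def by measurable
    also have "(\<lambda>r w. max 0 (indicator {0..T} r *\<^sub>R \<psi>' r w - indicator {0..T} r *\<^sub>R \<psi> r w)) =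
        (\<lambda>r w. indicator {0..T} r * max 0 (\<psi>' r w - \<psi> r w))"
      by (auto simp: fun_eq_iff indicator_def)
    finally show ?thesis .
  qed
  have \<phi>m: "jointly_meas \<phi>"
    unfolding \<phi>_def f_def using pg Yb Zb by (intro posm) (auto simp: prog_generator_def)
  have \<delta>m: "jointly_meas \<delta>"
    unfolding \<delta>_def D_def using YL by (intro posm L2_proc_prog)
  have DF: "D t \<in> borel_measurable (F t)" if "t \<in> {0..T}" for t
    unfolding D_def using prog_slice[OF L2_proc_prog[OF YL(1)] that] prog_slice[OF L2_proc_prog[OF YL(2)] that]
    by measurable
  obtain C1 C2 where C: "0 \<le> C1" "0 \<le> C2" "\<And>t. t \<in> {0..T} \<Longrightarrow> (\<integral>\<^sup>+w. ennreal ((Y t w)\<^sup>2) \<partial>M) \<le> ennreal C1"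
    "\<And>t. t \<in> {0..T} \<Longrightarrow> (\<integral>\<^sup>+w. ennreal ((Y' t w)\<^sup>2) \<partial>M) \<le> ennreal C2"
    using second_moment_sup_finite[OF YS(1)] second_moment_sup_finite[OF YS(2)] by metis
  have Y_sq: "sq_int (Y t)" "sq_int (Y' t)" if "t \<in> {0..T}" for t
  proof -
    show "sq_int (Y t)"
      by (rule sq_intI[OF F_imp_M[OF prog_slice[OF L2_proc_prog[OF YL(1)] that]] le_less_trans[OF C(3)[OF that]]]) simp
    show "sq_int (Y' t)"
      by (rule sq_intI[OF F_imp_M[OF prog_slice[OF L2_proc_prog[OF YL(2)] that]] le_less_trans[OF C(4)[OF that]]]) simp
  qed
  have D_sq: "sq_int (D t)" if "t \<in> {0..T}" for t
    unfolding D_def using Y_sq[OF that] by (intro sq_int_diff)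
  have VC: "V t \<le> ennreal (2 * C2 + 2 * C1)" if t: "t \<in> {0..T}" for t
  proof -
    have "V t \<le> mean_sq (\<lambda>w. Y' t w + - Y t w)"
      unfolding V_def D_def by (intro nn_integral_mono ennreal_leI) (auto simp: max_def power2_commute)
    also have "\<dots> \<le> 2 * mean_sq (Y' t) + 2 * mean_sq (\<lambda>w. - Y t w)"
      using sq_int_meas[OF Y_sq(1)[OF t]] sq_int_meas[OF Y_sq(2)[OF t]] by (intro nn_norm_add_square_le) auto
    also have "\<dots> \<le> 2 * ennreal C2 + 2 * ennreal C1"
      using C(3,4)[OF t] by (intro add_mono mult_left_mono) auto
    also have "\<dots> = ennreal (2 * C2 + 2 * C1)" using C by (simp add: ennreal_mult)
    finally show ?thesis .
  qed
  define N0 where "N0 = (SUP t\<in>{0..T}. ennreal (exp (\<beta> * t)) * V t)"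
  have "N0 \<le> ennreal (exp (\<beta> * T)) * ennreal (2 * C2 + 2 * C1)"
    unfolding N0_def using \<beta> by (intro SUP_least mult_mono VC ennreal_leI) auto
  also have "\<dots> < top" by (simp add: ennreal_mult_less_top)
  finally obtain N where N: "N0 = ennreal N" "0 \<le> N" by (cases N0) auto
  have VN: "V t \<le> ennreal (N * exp (- \<beta> * t))" if "t \<in> {0..T}" for t
  proof -
    have "ennreal (exp (\<beta> * t)) * V t \<le> ennreal N"
      unfolding N(1)[symmetric] N0_def using that by (intro SUP_upper)
    then have "ennreal (exp (- \<beta> * t)) * (ennreal (exp (\<beta> * t)) * V t) \<le> ennreal (exp (- \<beta> * t)) * ennreal N"
      by (intro mult_left_mono) auto
    moreover have "ennreal (exp (- \<beta> * t)) * (ennreal (exp (\<beta> * t)) * V t) = V t"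
      by (simp add: mult.assoc[symmetric] ennreal_mult[symmetric] exp_add[symmetric])
    ultimately show ?thesis using N by (simp add: ennreal_mult[symmetric] mult.commute)
  qed
  have \<delta>N: "(\<integral>\<^sup>+w. ennreal ((\<delta> r w)\<^sup>2) \<partial>M) \<le> ennreal (N * exp (- \<beta> * r))" for r
  proof (cases "r \<in> {0..T}")
    case True
    then have "(\<integral>\<^sup>+w. ennreal ((\<delta> r w)\<^sup>2) \<partial>M) = V r" unfolding V_def \<delta>_def by simp
    with VN[OF True] show ?thesis by simp
  next
    case False
    then have "\<delta> r w = 0" for w by (simp add: \<delta>_def)
    then show ?thesis by simp
  qed
  have \<delta>0: "0 \<le> \<delta> r w" for r w by (simp add: \<delta>_def)
  have y\<delta>: "\<bar>y r w - Y r w\<bar> = \<delta> r w" for r w by (auto simp: y_def \<delta>_def D_def max_def)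
  define X where "X = (\<lambda>s w. \<integral>\<^sup>+r. ennreal (\<delta> (s + r) w) \<partial>\<mu>)"
  define G where "G = (\<lambda>s. ennreal (exp (\<beta> * l) * (N * exp (- \<beta> * s))))"
  note avg = averaged_square_le[OF \<delta>m \<delta>0 \<mu> \<beta> N(2) \<delta>N]
  have X: "X s \<in> borel_measurable M" "(\<integral>\<^sup>+w. (X s w)\<^sup>2 \<partial>M) \<le> G s" for s
    using avg(1,2) unfolding X_def G_def by auto
  define A where "A = (\<lambda>s. nn_cond_exp M (F s) (\<lambda>w. \<integral>\<^sup>+ r. ennreal \<bar>y (s + r) w - Y (s + r) w\<bar> \<partial>completion \<mu>))"
  have AX: "(\<integral>\<^sup>+ r. ennreal \<bar>y (s + r) w - Y (s + r) w\<bar> \<partial>completion \<mu>) = X s w" for s w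
    unfolding y\<delta> X_def by (rule nn_integral_completion)
  have Am: "(\<lambda>w. \<integral>\<^sup>+ r. ennreal \<bar>y (s + r) w - Y (s + r) w\<bar> \<partial>completion \<mu>) \<in> borel_measurable M" for s
    using X(1)[of s] AX by (subst measurable_cong[where g="X s"]) auto
  have A_F: "A s \<in> borel_measurable (F s)" for s unfolding A_def by simp
  have A_int: "(\<integral>\<^sup>+w. h w * A s w \<partial>M) = (\<integral>\<^sup>+w. h w * X s w \<partial>M)" if "h \<in> borel_measurable (F s)" for h s
  proof -
    interpret S: sigma_finite_subalgebra M "F s" by (rule sigma_finite_F)
    have "(\<integral>\<^sup>+w. h w * A s w \<partial>M) = (\<integral>\<^sup>+w. h w * (\<integral>\<^sup>+ r. ennreal \<bar>y (s + r) w - Y (s + r) w\<bar> \<partial>completion \<mu>) \<partial>M)"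
      unfolding A_def by (rule S.nn_cond_exp_intg[OF that Am])
    also have "\<dots> = (\<integral>\<^sup>+w. h w * X s w \<partial>M)" by (intro nn_integral_cong) (simp add: AX)
    finally show ?thesis .
  qed
  have A2: "(\<integral>\<^sup>+w. (A s w)\<^sup>2 \<partial>M) \<le> G s" for s
  proof -
    have "(\<integral>\<^sup>+w. (A s w)\<^sup>2 \<partial>M) \<le> (\<integral>\<^sup>+w. (\<integral>\<^sup>+ r. ennreal \<bar>y (s + r) w - Y (s + r) w\<bar> \<partial>completion \<mu>)\<^sup>2 \<partial>M)"
      unfolding A_def by (rule nn_cond_exp_square_le[OF Am])
    also have "\<dots> = (\<integral>\<^sup>+w. (X s w)\<^sup>2 \<partial>M)" by (intro nn_integral_cong) (simp add: AX)
    finally show ?thesis using X(2) order_trans by blast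
  qed
  have key: "AE s in lborel. s \<in> {0..T} \<longrightarrow> (AE w in M. ennreal (\<phi> s w) \<le> ennreal K * (A s w + ennreal (norm (\<zeta> s w))))"
    using L2_proc_AE_L2_rv[OF ZL(1) less_imp_le[OF T]] L2_proc_AE_L2_rv[OF ZL(2) less_imp_le[OF T]]
  proof eventually_elim
    case (elim s)
    show ?case
    proof
      assume s: "s \<in> {0..T}"
      with elim have Zs: "Z s \<in> L2_rv M B s" "Z' s \<in> L2_rv M B s" by auto
      have me: "AE w in M. (\<lambda>r. \<bar>y (s + r) w - Y (s + r) w\<bar>) \<in> borel_measurable (completion \<mu>)"
        unfolding y\<delta> using avg(3) by (intro AE_I2 measurable_completion) auto
      \<comment> \<open>\<open>g(s, Y, Z) \<ge> g'(s, Y, Z)\<close> and \<open>g'(s, Y', Z') \<le> g'(s, y, Z')\<close> leave a difference of values of \<open>g'\<close> only.\<close>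
      have 1: "AE w in M. g' s y (Z' s) w \<ge> g' s Y' (Z' s) w"
        by (rule mono[OF s Zb(2) yb Yb(2)]) (auto simp: y_def)
      have 2: "AE w in M. g s Y (Z s) w \<ge> g' s Y (Z s) w" by (rule gg[OF s Yb(1) Zb(1)])
      have 3: "AE w in M. ennreal \<bar>g' s y (Z' s) w - g' s Y (Z s) w\<bar> \<le>
          ennreal K * (A s w + ennreal (norm (Z' s w - Z s w)))"
        using lip s yb Yb(1) Zs me unfolding lipschitz_generator_def A_def by blast
      show "AE w in M. ennreal (\<phi> s w) \<le> ennreal K * (A s w + ennreal (norm (\<zeta> s w)))"
        using 1 2 3
      proof eventually_elim
        case (elim w)
        have "\<phi> s w \<le> \<bar>g' s y (Z' s) w - g' s Y (Z s) w\<bar>" using s elim by (simp add: \<phi>_def f_def)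
        then have "ennreal (\<phi> s w) \<le> ennreal \<bar>g' s y (Z' s) w - g' s Y (Z s) w\<bar>" by (rule ennreal_leI)
        also have "\<dots> \<le> ennreal K * (A s w + ennreal (norm (Z' s w - Z s w)))" by (rule elim(3))
        finally show ?case using s by (simp add: \<zeta>_def)
      qed
    qed
  qed
  have \<zeta>s[measurable]: "\<zeta> s \<in> borel_measurable M" for s by (rule jointly_meas_slice[OF \<zeta>m])
  have A_M[measurable]: "A s \<in> borel_measurable M" for s using A_F by (rule F_imp_M)
  have drift: "AE s in lborel. s \<in> {a<..T} \<longrightarrow> (\<forall>x\<in>borel_measurable (F s).
        drift_le K (\<lambda>w. ennreal (\<phi> s w)) (X s) (\<zeta> s) x)" if "0 \<le> a" for a
    using key
  proof eventually_elim
    case (elim s)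
    show ?case
    proof (intro impI ballI)
      fix x :: "'w \<Rightarrow> real" assume s: "s \<in> {a<..T}" and x: "x \<in> borel_measurable (F s)"
      have [measurable]: "x \<in> borel_measurable M" using x by (rule F_imp_M)
      have "AE w in M. ennreal (\<phi> s w) \<le> ennreal K * (A s w + ennreal (norm (\<zeta> s w)))" using elim s that by auto
      then have "AE w in M. ennreal (max 0 (x w)) * ennreal (\<phi> s w) \<le>
        ennreal K * (ennreal (max 0 (x w)) * A s w + ennreal (max 0 (x w)) * ennreal (norm (\<zeta> s w)))"
      proof eventually_elim
        case (elim w)
        from mult_left_mono[OF elim, of "ennreal (max 0 (x w))"] show ?case
          by (simp add: distrib_left mult.left_commute)
      qed
      then have "pos_dot x (\<lambda>w. ennreal (\<phi> s w)) \<le>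
          (\<integral>\<^sup>+w. ennreal K * (ennreal (max 0 (x w)) * A s w + ennreal (max 0 (x w)) * ennreal (norm (\<zeta> s w))) \<partial>M)"
        by (rule nn_integral_mono_AE)
      also have "\<dots> = ennreal K * (pos_dot x (A s) +
          pos_dot x (\<lambda>w. ennreal (norm (\<zeta> s w))))"
        by (subst nn_integral_cmult) (auto simp: nn_integral_add)
      also have "pos_dot x (A s) = pos_dot x (X s)"
        by (rule A_int, rule measurable_compose[OF x]) simp
      finally show "drift_le K (\<lambda>w. ennreal (\<phi> s w)) (X s) (\<zeta> s) x" .
    qed
  qed
  define z where "z = (\<lambda>s. mean_sq (\<zeta> s))"
  have drift2: "AE s in lborel. s \<in> {a<..T} \<longrightarrow>
      (\<integral>\<^sup>+w. ennreal ((\<phi> s w)\<^sup>2) \<partial>M) \<le> ennreal (2 * K\<^sup>2) * (G s + z s)" if "0 \<le> a" for a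
    using key
  proof eventually_elim
    case (elim s)
    show ?case
    proof
      assume s: "s \<in> {a<..T}"
      have "AE w in M. ennreal (\<phi> s w) \<le> ennreal K * (A s w + ennreal (norm (\<zeta> s w)))" using elim s that by auto
      then have "AE w in M. ennreal ((\<phi> s w)\<^sup>2) \<le> ennreal (2 * K\<^sup>2) * ((A s w)\<^sup>2 + ennreal ((norm (\<zeta> s w))\<^sup>2))"
      proof eventually_elim
        case (elim w)
        let ?a = "A s w" and ?b = "ennreal (norm (\<zeta> s w))"
        have "ennreal ((\<phi> s w)\<^sup>2) = (ennreal (\<phi> s w))\<^sup>2" by (simp add: ennreal_power \<phi>_def)
        also have "\<dots> \<le> (ennreal K * (?a + ?b))\<^sup>2" by (intro power_mono elim) simp
        also have "\<dots> = ennreal (K\<^sup>2) * (?a\<^sup>2 + ?b\<^sup>2 + 2 * (?a * ?b))"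
          using K by (simp add: power_mult_distrib ennreal_power power2_sum mult.assoc)
        also have "\<dots> \<le> ennreal (K\<^sup>2) * (?a\<^sup>2 + ?b\<^sup>2 + (?a\<^sup>2 + ?b\<^sup>2))"
          by (intro mult_left_mono add_left_mono ennreal_young) simp
        also have "\<dots> = ennreal (2 * K\<^sup>2) * (?a\<^sup>2 + ?b\<^sup>2)"
        proof -
          have "ennreal (2 * K\<^sup>2) = 2 * ennreal (K\<^sup>2)" by (simp add: ennreal_mult)
          moreover have "?a\<^sup>2 + ?b\<^sup>2 + (?a\<^sup>2 + ?b\<^sup>2) = 2 * (?a\<^sup>2 + ?b\<^sup>2)" by (rule mult_2[symmetric])
          ultimately show ?thesis by (simp only: mult.assoc mult.left_commute)
        qed
        finally show ?case by (simp add: ennreal_power)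
      qed
      then have "(\<integral>\<^sup>+w. ennreal ((\<phi> s w)\<^sup>2) \<partial>M) \<le>
          (\<integral>\<^sup>+w. ennreal (2 * K\<^sup>2) * ((A s w)\<^sup>2 + ennreal ((norm (\<zeta> s w))\<^sup>2)) \<partial>M)"
        by (rule nn_integral_mono_AE)
      also have "\<dots> = ennreal (2 * K\<^sup>2) * ((\<integral>\<^sup>+w. (A s w)\<^sup>2 \<partial>M) + z s)"
        unfolding z_def by (subst nn_integral_cmult) (auto simp: nn_integral_add)
      also have "\<dots> \<le> ennreal (2 * K\<^sup>2) * (G s + z s)"
        by (intro mult_left_mono add_right_mono A2) simp
      finally show "(\<integral>\<^sup>+w. ennreal ((\<phi> s w)\<^sup>2) \<partial>M) \<le> ennreal (2 * K\<^sup>2) * (G s + z s)" .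
    qed
  qed
  have fin: "(\<integral>\<^sup>+s\<in>{a<..T}. (G s + z s) \<partial>lborel) < \<infinity>" if a: "0 \<le> a" "a < T" for a
  proof -
    have [measurable]: "z \<in> borel_measurable borel" unfolding z_def by (rule jointly_meas_nn[OF \<zeta>m])
    have "(\<integral>\<^sup>+s\<in>{a<..T}. (G s + z s) \<partial>lborel) \<le>
        (\<integral>\<^sup>+s. ennreal (exp (\<beta> * l) * N) * (ennreal (exp (- \<beta> * s)) * indicator {a<..T} s) + z s \<partial>lborel)"
      unfolding G_def using N(2) by (intro nn_integral_mono) (auto simp: indicator_def ennreal_mult mult.assoc)
    also have "\<dots> = ennreal (exp (\<beta> * l) * N) * (\<integral>\<^sup>+s\<in>{a<..T}. ennreal (exp (- \<beta> * s)) \<partial>lborel) + (\<integral>\<^sup>+s. z s \<partial>lborel)"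
      by (simp add: nn_integral_add nn_integral_cmult)
    also have "\<dots> < \<infinity>"
    proof -
      have "(\<integral>\<^sup>+s\<in>{a<..T}. ennreal (exp (- \<beta> * s)) \<partial>lborel) < \<infinity>"
        using nn_integral_exp_tail[OF \<beta>] by (rule le_less_trans) simp
      moreover have "(\<integral>\<^sup>+s. z s \<partial>lborel) < \<infinity>"
      proof -
        have e: "energy (on {0..T} Z') < \<infinity>" "energy (on {0..T} Z) < \<infinity>"
          using L2_proc_energy[OF ZL(1)] L2_proc_energy[OF ZL(2)] T by auto
        have "energy \<zeta> \<le> 2 * energy (on {0..T} Z') + 2 * energy (on {0..T} Z)"
          unfolding \<zeta>_def scaleR_diff_right
          by (intro energy_diff_le jm L2_proc_prog ZL)
        also have "\<dots> < \<infinity>" using e by (simp add: ennreal_mult_less_top)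
        finally show ?thesis unfolding z_def energy_def .
      qed
      ultimately show ?thesis by (simp add: ennreal_mult_less_top)
    qed
    finally show ?thesis .
  qed
  have VT: "V T = 0"
  proof -
    have "AE w in M. ennreal ((max 0 (D T w))\<^sup>2) = 0"
      using late[of T] u by (auto simp: D_def elim: eventually_mono)
    then have "V T = (\<integral>\<^sup>+w. 0 \<partial>M)" unfolding V_def by (intro nn_integral_cong_AE) simp
    then show ?thesis by simp
  qed
  define \<theta> where "\<theta> = (K + 2 * K\<^sup>2 + K * exp (\<beta> * l)) / \<beta>"
  have \<theta>: "0 \<le> \<theta>" "\<theta> < 1" using small \<beta> K by (auto simp: \<theta>_def)
  obtain J where J1: "\<forall>t\<in>{0..T}. ito t (on {t<..T} \<zeta>) (J t)"
    and J2: "\<forall>p q. 0 \<le> p \<longrightarrow> p < q \<longrightarrow> q \<le> T \<longrightarrow>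
      (AE w in M. D p w + (J p w - J q w) - (LINT s:{p<..q}|lborel. \<phi> s w) \<le> D q w)"
    using solution_differences(1)[OF T u s s'] unfolding D_def \<phi>_def f_def \<zeta>_def by blast
  have J3: "\<exists>P \<sigma>. step_process a T P \<sigma> \<and> energy (\<lambda>r w. on {a<..T} \<zeta> r w - \<sigma> r w) \<le> ennreal \<epsilon>"
    if "0 \<le> a" "a < T" "0 < \<epsilon>" for a \<epsilon>
    unfolding \<zeta>_def by (rule solution_differences(2)[OF T u s s' that])
  have step: "V a \<le> ennreal (N * \<theta> * exp (- \<beta> * a))" if a: "0 \<le> a" "a < T" for a
  proof -
    have "V a \<le> ennreal (N * (K + 2 * K\<^sup>2 + K * exp (\<beta> * l)) / \<beta> * exp (- \<beta> * a))"
      unfolding V_def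
    proof (rule backward_inequality[where D=D and T=T and \<zeta>=\<zeta> and \<phi>=\<phi> and J=J and X=X and G=G])
      show "sq_int (D t)" "D t \<in> borel_measurable (F t)" if "a \<le> t" "t \<le> T" for t
        using that a D_sq DF by auto
      show "ito t (on {t<..T} \<zeta>) (J t)" if "a \<le> t" "t \<le> T" for t
        using that a J1 by auto
      show "AE w in M. D p w + (J p w - J q w) - (LINT s:{p<..q}|lborel. \<phi> s w) \<le> D q w"
        if "a \<le> p" "p < q" "q \<le> T" for p q using that a J2 by auto
      show "pos_sq (D t) \<le> ennreal (N * exp (- \<beta> * t))" if "a \<le> t" "t \<le> T" for t
        using VN[of t] that a by (simp add: V_def)
      show "0 \<le> \<phi> s w" for s w by (simp add: \<phi>_def)
      show "pos_sq (D T) = 0" using VT by (simp add: V_def)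
      show "G = (\<lambda>s. ennreal (exp (\<beta> * l) * (N * exp (- \<beta> * s))))" by (simp add: G_def)
    qed (use a \<zeta>m \<phi>m X drift drift2 fin J3 \<beta> K N in \<open>auto simp: z_def\<close>)
    then show ?thesis by (simp add: \<theta>_def)
  qed
  have "N0 \<le> ennreal (N * \<theta>)"
    unfolding N0_def
  proof (rule SUP_least)
    fix a assume a: "a \<in> {0..T}"
    show "ennreal (exp (\<beta> * a)) * V a \<le> ennreal (N * \<theta>)"
    proof (cases "a = T")
      case False
      then have "ennreal (exp (\<beta> * a)) * V a \<le> ennreal (exp (\<beta> * a)) * ennreal (N * \<theta> * exp (- \<beta> * a))"
        using a by (intro mult_left_mono step) auto
      also have "\<dots> = ennreal (N * \<theta>)"
        using N \<theta> by (simp add: ennreal_mult[symmetric] exp_minus field_simps)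
      finally show ?thesis .
    qed (simp add: VT)
  qed
  then have "N \<le> N * \<theta>" using N \<theta> by simp
  have "N = 0"
  proof (rule ccontr)
    assume "N \<noteq> 0"
    then have "N * \<theta> < N * 1" using N \<theta> by (intro mult_strict_left_mono) auto
    with \<open>N \<le> N * \<theta>\<close> show False by simp
  qed
  have mid: "AE w in M. Y t w \<ge> Y' t w" if t: "t \<in> {0..T}" for t
  proof -
    have "V t = 0" using VN[OF t] \<open>N = 0\<close> by simp
    moreover have "(\<lambda>w. ennreal ((max 0 (D t w))\<^sup>2)) \<in> borel_measurable M"
      using sq_int_meas[OF sq_int_pos[OF D_sq[OF t]]] by measurable
    ultimately have "AE w in M. ennreal ((max 0 (D t w))\<^sup>2) = 0"
      unfolding V_def by (simp add: nn_integral_0_iff_AE)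
    then show ?thesis by eventually_elim (auto simp: D_def max_def split: if_splits)
  qed
  consider "t \<in> {-l..<0}" | "t \<in> {0..T}" | "t \<in> {T..T + u}" using t by force
  then show ?thesis
  proof cases
    case 1
    have "AE w in M. Y t w = Y 0 w" "AE w in M. Y' t w = Y' 0 w"
      using s s' 1 unfolding bsde_solution_def by (auto elim: eventually_mono)
    then show ?thesis using mid[of 0] T by (auto elim: eventually_elim2)
  qed (auto intro: mid late)
qed

end

text \<open>
  For fixed \<open>K\<close> and \<open>l\<close> below \<open>ln 2 / \<beta>\<close> the factor \<open>exp (\<beta> l)\<close> is below \<open>2\<close>.
\<close>

lemma small_delay_rate:
  fixes K :: real
  assumes K: "0 < K"
  shows "\<exists>l\<^sub>0>0. \<forall>l\<ge>0. l < l\<^sub>0 \<longrightarrow> (\<exists>\<beta>>0. K + 2 * K\<^sup>2 + K * exp (\<beta> * l) < \<beta>)"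
proof -
  define \<beta> where "\<beta> = 2 * K\<^sup>2 + 3 * K"
  have \<beta>: "0 < \<beta>" using K by (simp add: \<beta>_def add_nonneg_pos)
  have "K + 2 * K\<^sup>2 + K * exp (\<beta> * l) < \<beta>" if l: "0 \<le> l" "l < ln 2 / \<beta>" for l
  proof -
    have "\<beta> * l < ln 2" using l \<beta> by (simp add: field_simps)
    then have "exp (\<beta> * l) < exp (ln 2)" by (subst exp_less_cancel_iff)
    then have "K * exp (\<beta> * l) < K * 2" using K by (intro mult_strict_left_mono) auto
    then show ?thesis by (simp add: \<beta>_def)
  qed
  then show ?thesis using \<beta> by (intro exI[of _ "ln 2 / \<beta>"]) auto
qed

lemma small_constant_rate:
  fixes l :: real
  shows "\<exists>K\<^sub>0>0. \<forall>K>0. K < K\<^sub>0 \<longrightarrow> K + 2 * K\<^sup>2 + K * exp (1 * l) < 1"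
proof (intro exI[of _ "1 / (3 + exp l)"] conjI allI impI)
  have pos: "0 < 3 + exp l" by (simp add: add_pos_pos)
  then show "0 < 1 / (3 + exp l)" by simp
  fix K assume K: "0 < K" "K < 1 / (3 + exp l)"
  then have small: "K * (3 + exp l) < 1" using pos by (simp add: pos_less_divide_eq)
  have "K * 1 \<le> K * (3 + exp l)" using K(1) by (intro mult_left_mono) (auto simp: add_increasing2)
  with small have "K \<le> 1" by simp
  then have "K\<^sup>2 \<le> K" using K(1) by (simp add: power2_eq_square)
  then have "K + 2 * K\<^sup>2 + K * exp l \<le> K * (3 + exp l)" by (simp add: algebra_simps)
  with small show "K + 2 * K\<^sup>2 + K * exp (1 * l) < 1" by simp
qed

theorem proposition2p6:
  fixes M :: "'w measure" and B :: "real \<Rightarrow> 'w \<Rightarrow> real ^ 'd" and T u :: real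
  assumes "prob_space M" and "complete_measure M" and "standard_brownian_motion M B"
    and "0 < T" and "0 \<le> u"
  shows "let comparison = (\<lambda>l K'.
      \<forall>\<xi> \<xi>' \<eta> \<eta>' (g :: ('w, 'd) generator) (g' :: ('w, 'd) generator) Y Z Y' Z'.
        \<xi> \<in> L2_proc M B T (T + u) \<longrightarrow> \<xi>' \<in> L2_proc M B T (T + u) \<longrightarrow>
        \<eta> \<in> L2_proc M B T (T + u) \<longrightarrow> \<eta>' \<in> L2_proc M B T (T + u) \<longrightarrow>
        \<xi> T \<in> L2_rv M B T \<longrightarrow> \<xi>' T \<in> L2_rv M B T \<longrightarrow>
        prog_generator M B l T u g \<longrightarrow> prog_generator M B l T u g' \<longrightarrow>
        (\<lambda>t. g t (\<lambda>_ _. 0) (\<lambda>_. 0)) \<in> L2_proc M B 0 T \<longrightarrow>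
        (\<lambda>t. g' t (\<lambda>_ _. 0) (\<lambda>_. 0)) \<in> L2_proc M B 0 T \<longrightarrow>
        (\<exists>\<mu>. prob_measure_on (-l) u \<mu> \<and> lipschitz_generator M B l T u K' \<mu> g) \<longrightarrow>
        (\<exists>\<mu>. prob_measure_on (-l) u \<mu> \<and> lipschitz_generator M B l T u K' \<mu> g') \<longrightarrow>
        (\<forall>t\<in>{T..T + u}. AE \<omega> in M. \<xi> t \<omega> \<ge> \<xi>' t \<omega>) \<longrightarrow>
        (\<forall>t\<in>{0..T}. \<forall>y\<in>L2_bar M B l (T + u). \<forall>z\<in>L2_bar M B l (T + u).
           AE \<omega> in M. g t y (z t) \<omega> \<ge> g' t y (z t) \<omega>) \<longrightarrow>
        (\<forall>t\<in>{0..T}. \<forall>z\<in>L2_bar M B l (T + u).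
           \<forall>y\<in>L2_bar M B l (T + u). \<forall>y'\<in>L2_bar M B l (T + u).
             (\<forall>r\<in>{0..T}. AE \<omega> in M. y r \<omega> \<ge> y' r \<omega>) \<longrightarrow>
             (AE \<omega> in M. g' t y (z t) \<omega> \<ge> g' t y' (z t) \<omega>)) \<longrightarrow>
        bsde_solution M B l T u g \<xi> \<eta> Y Z \<longrightarrow>
        bsde_solution M B l T u g' \<xi>' \<eta>' Y' Z' \<longrightarrow>
        (\<forall>t\<in>{-l..T + u}. AE \<omega> in M. Y t \<omega> \<ge> Y' t \<omega>))
    in (\<forall>K'>0. \<exists>l\<^sub>0>0. \<forall>l\<ge>0. l < l\<^sub>0 \<longrightarrow> comparison l K') \<and>
       (\<forall>l\<ge>0. \<exists>K\<^sub>0>0. \<forall>K'>0. K' < K\<^sub>0 \<longrightarrow> comparison l K')"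
proof -
  interpret brownian M B
    using assms(1,3) by (simp add: brownian_def brownian_axioms_def)
  let "Let ?comparison _" = ?thesis
  have main: "?comparison l K" if l: "0 \<le> l" and K: "0 < K" and \<beta>: "\<exists>\<beta>>0. K + 2 * K\<^sup>2 + K * exp (\<beta> * l) < \<beta>" for l K
    apply (intro allI impI ballI)
    subgoal premises p for \<xi> \<xi>' \<eta> \<eta>' g g' Y Z Y' Z' t
    proof -
      obtain \<mu> where \<mu>: "prob_measure_on (-l) u \<mu>" and lip: "lipschitz_generator M B l T u K \<mu> g'"
        using p(12) by blast
      obtain \<beta> where "0 < \<beta>" "K + 2 * K\<^sup>2 + K * exp (\<beta> * l) < \<beta>" using \<beta> by blast
      from comparison[OF assms(4,5) l K this p(7,8) \<mu> lip _ _ _ p(16-18)] show ?thesis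
        using p(13-15) by blast
    qed
    done
  show ?thesis
    unfolding Let_def
  proof (rule conjI; intro allI impI)
    fix K :: real assume K: "0 < K"
    from small_delay_rate[OF K] obtain l\<^sub>0 where "0 < l\<^sub>0"
      and l\<^sub>0: "\<And>l. 0 \<le> l \<Longrightarrow> l < l\<^sub>0 \<Longrightarrow> \<exists>\<beta>>0. K + 2 * K\<^sup>2 + K * exp (\<beta> * l) < \<beta>" by blast
    show "\<exists>l\<^sub>0>0. \<forall>l\<ge>0. l < l\<^sub>0 \<longrightarrow> ?comparison l K"
    proof (rule exI[of _ l\<^sub>0], rule conjI, fact, rule allI, rule impI, rule impI)
      fix l assume l: "0 \<le> l" "l < l\<^sub>0"
      show "?comparison l K" by (rule main[OF l(1) K l\<^sub>0[OF l]])
    qed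
  next
    fix l :: real assume l: "0 \<le> l"
    from small_constant_rate[of l] obtain K\<^sub>0 where "0 < K\<^sub>0"
      and K\<^sub>0: "\<And>K. 0 < K \<Longrightarrow> K < K\<^sub>0 \<Longrightarrow> K + 2 * K\<^sup>2 + K * exp (1 * l) < 1" by blast
    show "\<exists>K\<^sub>0>0. \<forall>K'>0. K' < K\<^sub>0 \<longrightarrow> ?comparison l K'"
    proof (rule exI[of _ K\<^sub>0], rule conjI, fact, rule allI, rule impI, rule impI)
      fix K assume K: "0 < K" "K < K\<^sub>0"
      have "\<exists>\<beta>>0. K + 2 * K\<^sup>2 + K * exp (\<beta> * l) < \<beta>" using K\<^sub>0[OF K] by (intro exI[of _ 1]) simp
      then show "?comparison l K" by (rule main[OF l K(1)])
    qed
  qed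
qed

end
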